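(* Let $\vartheta_0=1$, let $\vartheta_1$ be the only positive root of $\varphi(x)=x^2+2x^{\frac32}+x-1$, and, for every integer $n\ge2$, let $\vartheta_n$ be the smallest positive root of $$\varphi_n(x)=x^{n+1}+2\sum_{i=0}^{n-1}x^{n-i+\frac12}+2\sum_{i=0}^{n-2}x^{i+2}+x-1.$$ For $n\ge0$ let $\xi_n=2+\vartheta_n^{\frac12}+\vartheta_n^{-\frac12}$, and let $$\varepsilon=\tfrac13\left((54-6\sqrt{33})^{\frac13}+(54+6\sqrt{33})^{\frac13}\right).$$ Then $4=\xi_0<\xi_1<\xi_2<\cdots$, $\lim_{n\to\infty}\xi_n=2+\varepsilon$, and the numbers $\xi_n$ ($n\ge0$) are all the limit points of the Laplacian spectral radius of graphs smaller than $2+\varepsilon$, and likewise all the limit points of the signless Laplacian spectral radius of graphs smaller than $2+\varepsilon$.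
   Context: Graphs are finite, simple and undirected. For a graph $G$ with adjacency matrix $A(G)$ and diagonal degree matrix $D(G)$, the Laplacian matrix is $L(G)=D(G)-A(G)$ and the signless Laplacian matrix is $Q(G)=D(G)+A(G)$. For $M\in\{L,Q\}$, the $M$-spectral radius $\rho_M(G)$ is the largest absolute value of an eigenvalue of $M(G)$; these are the Laplacian and the signless Laplacian spectral radius. A real number $\gamma$ is a limit point of the $M$-spectral radius of graphs if there is a sequence of graphs $(G_k)_{k\in\mathbb N}$ with $\rho_M(G_i)\ne\rho_M(G_j)$ whenever $i\ne j$ and $\lim_{k\to\infty}\rho_M(G_k)=\gamma$. *)

theory Defs
  imports
    Complex_Main
    "Graph_Theory.Pair_Digraph"
    "Jordan_Normal_Form.Spectral_Radius"
begin

text \<open>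
  A finite simple undirected graph is a \<^locale>\<open>pair_graph\<close>: a finite, loop-free, symmetric digraph
  whose arcs are ordered pairs of vertices.  Its matrices are indexed by the positions of the
  vertices in increasing order; the spectrum does not depend on this choice of ordering.
\<close>

definition vertex_list :: "'a::linorder pair_pre_digraph \<Rightarrow> 'a list" where
  "vertex_list G = sorted_list_of_set (pverts G)"

definition adjacency_matrix :: "'a::linorder pair_pre_digraph \<Rightarrow> real mat" where
  "adjacency_matrix G = Matrix.mat (card (pverts G)) (card (pverts G))
     (\<lambda>(i, j). if (vertex_list G ! i, vertex_list G ! j) \<in> parcs G then 1 else 0)"

text \<open>In a symmetric digraph representing an undirected graph, the out-degree is the degree.\<close>

definition degree_matrix :: "'a::linorder pair_pre_digraph \<Rightarrow> real mat" where
  "degree_matrix G = Matrix.mat (card (pverts G)) (card (pverts G))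
     (\<lambda>(i, j). if i = j then real (out_degree (with_proj G) (vertex_list G ! i)) else 0)"

definition laplacian_matrix :: "'a::linorder pair_pre_digraph \<Rightarrow> real mat" where
  "laplacian_matrix G = degree_matrix G - adjacency_matrix G"

definition signless_laplacian_matrix :: "'a::linorder pair_pre_digraph \<Rightarrow> real mat" where
  "signless_laplacian_matrix G = degree_matrix G + adjacency_matrix G"

definition laplacian_spectral_radius :: "'a::linorder pair_pre_digraph \<Rightarrow> real" where
  "laplacian_spectral_radius G =
     spectral_radius (map_mat complex_of_real (laplacian_matrix G))"

definition signless_laplacian_spectral_radius :: "'a::linorder pair_pre_digraph \<Rightarrow> real" where
  "signless_laplacian_spectral_radius G =
     spectral_radius (map_mat complex_of_real (signless_laplacian_matrix G))"

text \<open>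
  Taking the vertices from the natural numbers loses no finite graph up to isomorphism.  The graph
  without vertices is excluded because its matrices have no eigenvalue.
\<close>

definition is_limit_point_of_graphs :: "(nat pair_pre_digraph \<Rightarrow> real) \<Rightarrow> real \<Rightarrow> bool" where
  "is_limit_point_of_graphs \<rho> \<gamma> \<longleftrightarrow>
     (\<exists>G :: nat \<Rightarrow> nat pair_pre_digraph.
        (\<forall>k. pair_graph (G k) \<and> pverts (G k) \<noteq> {}) \<and>
        (\<forall>i j. i \<noteq> j \<longrightarrow> \<rho> (G i) \<noteq> \<rho> (G j)) \<and>
        (\<lambda>k. \<rho> (G k)) \<longlonglongrightarrow> \<gamma>)"

definition phi1 :: "real \<Rightarrow> real" where
  "phi1 x = x ^ 2 + 2 * x powr (3 / 2) + x - 1"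

definition phi :: "nat \<Rightarrow> real \<Rightarrow> real" where
  "phi n x = x ^ (n + 1) + 2 * (\<Sum>i = 0..n - 1. x powr (real n - real i + 1 / 2))
     + 2 * (\<Sum>i = 0..n - 2. x ^ (i + 2)) + x - 1"

definition vartheta :: "nat \<Rightarrow> real" where
  "vartheta n =
     (if n = 0 then 1
      else if n = 1 then (THE x. 0 < x \<and> phi1 x = 0)
      else (LEAST x. 0 < x \<and> phi n x = 0))"

definition xi :: "nat \<Rightarrow> real" where
  "xi n = 2 + vartheta n powr (1 / 2) + vartheta n powr (- 1 / 2)"

definition epsilon :: real where
  "epsilon = 1 / 3 * ((54 - 6 * sqrt 33) powr (1 / 3) + (54 + 6 * sqrt 33) powr (1 / 3))"

text \<open>The descriptions in the definition of \<^const>\<open>vartheta\<close> denote:\<close>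

lemma ex1_positive_root:
  fixes f :: "real \<Rightarrow> real"
  assumes "continuous_on {0..1} f" "f 0 < 0" "0 \<le> f 1"
    and mono: "\<And>x y. 0 < x \<Longrightarrow> x < y \<Longrightarrow> f x < f y"
  shows "\<exists>!x. 0 < x \<and> f x = 0"
proof -
  obtain x where x: "0 \<le> x" "f x = 0"
    using IVT'[of f 0 0 1] assms(1-3) by auto
  with assms(2) have "0 < x" by (cases "x = 0") auto
  moreover have "y = x" if "0 < y" "f y = 0" for y
    using mono[OF \<open>0 < x\<close>, of y] mono[OF \<open>0 < y\<close>, of x] that(2) x(2) by linarith
  ultimately show ?thesis using x(2) by blast
qed

lemma ex1_phi1: "\<exists>!x. 0 < x \<and> phi1 x = 0"
proof (rule ex1_positive_root)
  show "continuous_on {0..1} phi1"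
    unfolding phi1_def by (intro continuous_intros continuous_on_powr') auto
  show "phi1 x < phi1 y" if "0 < x" "x < y" for x y
  proof -
    have "x ^ 2 \<le> y ^ 2" "x powr (3 / 2) \<le> y powr (3 / 2)"
      using that by (auto intro!: power_mono powr_mono2)
    with that show ?thesis unfolding phi1_def by linarith
  qed
qed (auto simp: phi1_def)

lemma ex1_phi:
  assumes "2 \<le> n"
  shows "\<exists>!x. 0 < x \<and> phi n x = 0"
proof (rule ex1_positive_root)
  show "continuous_on {0..1} (phi n)"
    unfolding phi_def using assms by (intro continuous_intros continuous_on_powr') auto
  show "phi n x < phi n y" if "0 < x" "x < y" for x y
  proof -
    have "x ^ (n + 1) \<le> y ^ (n + 1)" using that by (intro power_mono) auto
    moreover have "(\<Sum>i = 0..n - 1. x powr (real n - real i + 1 / 2))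
        \<le> (\<Sum>i = 0..n - 1. y powr (real n - real i + 1 / 2))"
      using that assms by (intro sum_mono powr_mono2) auto
    moreover have "(\<Sum>i = 0..n - 2. x ^ (i + 2)) \<le> (\<Sum>i = 0..n - 2. y ^ (i + 2))"
      using that by (intro sum_mono power_mono) auto
    ultimately show ?thesis using that unfolding phi_def by linarith
  qed
  have "(\<Sum>i = 0..n - 1. (0::real) powr (real n - real i + 1 / 2)) = 0"
    and "(\<Sum>i = 0..n - 2. (0::real) ^ (i + 2)) = 0"
    by (auto intro: sum.neutral)
  then show "phi n 0 < 0" unfolding phi_def by (simp only:) simp
  have "0 \<le> (\<Sum>i = 0..n - 1. (1::real) powr (real n - real i + 1 / 2))"
    and "0 \<le> (\<Sum>i = 0..n - 2. (1::real) ^ (i + 2))"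
    by (auto intro: sum_nonneg)
  moreover have "(1::real) ^ (n + 1) = 1" by simp
  ultimately show "0 \<le> phi n 1" unfolding phi_def by linarith
qed

lemma vartheta_1: "0 < vartheta 1" "phi1 (vartheta 1) = 0"
  using theI'[OF ex1_phi1] by (simp_all add: vartheta_def)

lemma vartheta_ge_2:
  assumes "2 \<le> n"
  shows "0 < vartheta n" "phi n (vartheta n) = 0"
    and "\<And>x. 0 < x \<Longrightarrow> phi n x = 0 \<Longrightarrow> vartheta n \<le> x"
proof -
  obtain a where a: "0 < a" "phi n a = 0" and uniq: "\<And>x. 0 < x \<Longrightarrow> phi n x = 0 \<Longrightarrow> x = a"
    using ex1_phi[OF assms] by blast
  have "(LEAST x. 0 < x \<and> phi n x = 0) = a"
    using a by (intro Least_equality) (auto dest!: uniq)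
  then have *: "vartheta n = a" using assms by (simp add: vartheta_def)
  show "0 < vartheta n" "phi n (vartheta n) = 0"
    and "\<And>x. 0 < x \<Longrightarrow> phi n x = 0 \<Longrightarrow> vartheta n \<le> x"
    unfolding * using a by (auto dest!: uniq)
qed

end

theory Submission
  imports Defs
begin

text \<open>
  Write \<open>\<mu> = 2 + s + 1/s\<close>. Along a path the equations of the signless Laplacian for the value \<open>\<mu>\<close> are
  \<open>z (k - 1) + z (k + 1) = (s + 1/s) z k\<close>, with solutions \<open>s\<^sup>k\<close> and \<open>s\<^sup>-\<^sup>k\<close>. Solving them on a one-way
  infinite path with a pendant vertex at distance \<open>n\<close> from its end gives \<open>\<mu> = \<xi>\<^sub>n\<close> with \<open>s\<^sup>2 = \<vartheta>\<^sub>n\<close>,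
  and on the two-way infinite path with one pendant vertex \<open>\<mu> = 2 + \<epsilon>\<close>. Rayleigh quotients of truncated
  solutions bound both spectral radii from below (trees are bipartite, so signs do not matter);
  positive supersolutions of the signless Laplacian bound both from above.

  If the radius of a large connected graph stays below \<open>c < 2 + \<epsilon>\<close>, then its longest path has no pendant
  vertex far from both ends, no two near the same end, no chords except possibly the one
  closing a cycle, and every other vertex is a leaf attached to the path. Hence the graph has maximal
  degree two and radius close to 4, or it is a caterpillar whose radius is close to
  \<open>\<xi>\<^sub>n\<close>, where \<open>n\<close> is the largest distance of a pendant vertex from the nearer end. Only the
  Laplacian tolerates a triangle at an end of the path; deleting the edge between its two vertices of
  degree two does not change the radius.
\<close>

section \<open>The signless Laplacian and the Laplacian as quadratic forms\<close>

text \<open>A limit point needs infinitely many different radii, while graphs with a bounded number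
  of vertices have only finitely many; so the graphs in question become arbitrarily large. After
  passing to a component that carries an eigenfunction, a radius below \<open>2 + epsilon\<close>
  excludes degree four, and a large connected graph of degree at most three contains a long path.
  The resulting classification is approximate: it places the radius within \<delta> of some
  \<open>xi n\<close>. Since these numbers accumulate only at \<open>2 + epsilon\<close>, a smaller
  limit point must be one of them. For the converse, convergence to \<open>xi n\<close> is not
  enough: the radii have to differ from their limit, so each construction comes with a strict
  inequality. The radius is a maximal modulus over a complex spectrum, whereas the estimates concern
  real quadratic forms. The link is made for both matrices at once, \<open>\<sigma>\<close> being
  the sign in front of the adjacency matrix; \<open>\<sigma>\<^sup>2 = 1\<close> turns the form into
  a sum of squares over the edges.\<close>

definition signed_laplacian :: "real \<Rightarrow> nat pair_pre_digraph \<Rightarrow> complex mat" where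
  "signed_laplacian \<sigma> G = map_mat complex_of_real (degree_matrix G + \<sigma> \<cdot>\<^sub>m adjacency_matrix G)"

definition rad :: "real \<Rightarrow> nat pair_pre_digraph \<Rightarrow> real" where
  "rad \<sigma> G = spectral_radius (signed_laplacian \<sigma> G)"

definition sop :: "real \<Rightarrow> nat rel \<Rightarrow> (nat \<Rightarrow> real) \<Rightarrow> nat \<Rightarrow> real" where
  "sop \<sigma> E z v = (\<Sum>u\<in>E``{v}. z v + \<sigma> * z u)"

lemma laplacian_spectral_radius_eq: "laplacian_spectral_radius G = rad (-1) G"
proof -
  have "laplacian_matrix G = degree_matrix G + (-1) \<cdot>\<^sub>m adjacency_matrix G"
    by (rule eq_matI) (auto simp: laplacian_matrix_def degree_matrix_def adjacency_matrix_def)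
  then show ?thesis by (simp add: laplacian_spectral_radius_def rad_def signed_laplacian_def)
qed

lemma signless_laplacian_spectral_radius_eq: "signless_laplacian_spectral_radius G = rad 1 G"
proof -
  have "signless_laplacian_matrix G = degree_matrix G + 1 \<cdot>\<^sub>m adjacency_matrix G"
    by (rule eq_matI) (auto simp: signless_laplacian_matrix_def degree_matrix_def adjacency_matrix_def)
  then show ?thesis by (simp add: signless_laplacian_spectral_radius_def rad_def signed_laplacian_def)
qed

text \<open>Cauchy-Schwarz, from expanding the squares of
  \<open>?N * b v - ?P * a v\<close>.\<close>

lemma sum_mult_square_le:
  fixes a b :: "'a \<Rightarrow> real"
  assumes N: "0 < (\<Sum>v\<in>V. (a v)\<^sup>2)"
  shows "(\<Sum>v\<in>V. a v * b v)\<^sup>2 \<le> (\<Sum>v\<in>V. (a v)\<^sup>2) * (\<Sum>v\<in>V. (b v)\<^sup>2)"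
proof -
  let ?N = "\<Sum>v\<in>V. (a v)\<^sup>2" and ?P = "\<Sum>v\<in>V. a v * b v"
  have "0 \<le> (\<Sum>v\<in>V. (?N * b v - ?P * a v)\<^sup>2)" by (intro sum_nonneg) auto
  also have "\<dots> = (\<Sum>v\<in>V. ?N\<^sup>2 * (b v)\<^sup>2 - 2 * ?N * ?P * (a v * b v) + ?P\<^sup>2 * (a v)\<^sup>2)"
    by (intro sum.cong refl) (simp add: power2_eq_square algebra_simps)
  also have "\<dots> = ?N\<^sup>2 * (\<Sum>v\<in>V. (b v)\<^sup>2) - 2 * ?N * ?P * ?P + ?P\<^sup>2 * ?N"
    by (simp only: sum.distrib sum_subtractf sum_distrib_left)
  also have "\<dots> = ?N * (?N * (\<Sum>v\<in>V. (b v)\<^sup>2) - ?P\<^sup>2)"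
    by (simp add: power2_eq_square algebra_simps)
  finally show ?thesis using N by (simp add: zero_le_mult_iff)
qed

section \<open>Spectrum, quadratic form and comparison for a single graph\<close>

context
  fixes G :: "nat pair_pre_digraph"
  assumes G: "pair_graph G"
begin

interpretation pair_graph G by (rule G)

lemma
  shows finite_pverts: "finite (pverts G)" and finite_parcs: "finite (parcs G)"
    and arc_sym: "(u, v) \<in> parcs G \<Longrightarrow> (v, u) \<in> parcs G"
    and no_loop: "(u, u) \<notin> parcs G"
    and arc_fst: "(u, v) \<in> parcs G \<Longrightarrow> u \<in> pverts G"
    and arc_snd: "(u, v) \<in> parcs G \<Longrightarrow> v \<in> pverts G"
    and finite_neighbours: "finite (parcs G `` {w})"
    and neighbours_subset: "parcs G `` {w} \<subseteq> pverts G"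
proof -
  show "finite (pverts G)" "finite (parcs G)" by auto
  show "(u, v) \<in> parcs G \<Longrightarrow> (v, u) \<in> parcs G" by (rule arcs_symmetric)
  show "(u, u) \<notin> parcs G" using no_loops' by blast
  show "(u, v) \<in> parcs G \<Longrightarrow> u \<in> pverts G" "(u, v) \<in> parcs G \<Longrightarrow> v \<in> pverts G"
    by (auto dest: wellformed')
  show "parcs G `` {w} \<subseteq> pverts G" by (auto dest: wellformed')
  then show "finite (parcs G `` {w})" using \<open>finite (pverts G)\<close> finite_subset by blast
qed

lemma vertex_list_props:
  "set (vertex_list G) = pverts G" "distinct (vertex_list G)" "length (vertex_list G) = card (pverts G)"
  by (auto simp: vertex_list_def finite_pverts)

lemma vertex_index:
  assumes "v \<in> pverts G"
  obtains i where "i < card (pverts G)" "v = vertex_list G ! i"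
  using assms vertex_list_props by (metis in_set_conv_nth)

lemma sum_vertex_list: "(\<Sum>j<card (pverts G). f (vertex_list G ! j)) = (\<Sum>v\<in>pverts G. f v)"
  using sum.distinct_set_conv_list[OF vertex_list_props(2), of f] vertex_list_props
  by (simp add: sum_list_sum_nth atLeast0LessThan)

lemma out_degree_eq: "out_degree (with_proj G) v = card (parcs G `` {v})"
proof -
  have "{e \<in> parcs G. fst e = v} = Pair v ` (parcs G `` {v})" by force
  then show ?thesis by (simp add: out_degree_def out_arcs_def card_image inj_on_def)
qed

lemma signed_laplacian_carrier:
  "signed_laplacian \<sigma> G \<in> carrier_mat (card (pverts G)) (card (pverts G))"
  by (simp add: signed_laplacian_def degree_matrix_def adjacency_matrix_def)

lemma signed_laplacian_mult_vec:
  assumes i: "i < card (pverts G)" and x: "x = vec (card (pverts G)) (\<lambda>j. c (vertex_list G ! j))"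
  shows "(signed_laplacian \<sigma> G *\<^sub>v x) $ i
    = (\<Sum>u\<in>parcs G `` {vertex_list G ! i}. c (vertex_list G ! i) + of_real \<sigma> * c u)"
proof -
  let ?n = "card (pverts G)" and ?v = "\<lambda>j. vertex_list G ! j"
  have "(signed_laplacian \<sigma> G *\<^sub>v x) $ i = (\<Sum>j<?n. signed_laplacian \<sigma> G $$ (i, j) * c (?v j))"
    using i signed_laplacian_carrier[of \<sigma>]
    by (auto simp: x scalar_prod_def atLeast0LessThan intro!: sum.cong)
  also have "\<dots> = (\<Sum>j<?n. (if j = i then of_nat (card (parcs G `` {?v i})) * c (?v i) else 0)
      + of_real \<sigma> * (if (?v i, ?v j) \<in> parcs G then c (?v j) else 0))"
    using i by (intro sum.cong refl)
      (auto simp: signed_laplacian_def degree_matrix_def adjacency_matrix_def out_degree_eq algebra_simps)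
  also have "\<dots> = of_nat (card (parcs G `` {?v i})) * c (?v i)
      + of_real \<sigma> * (\<Sum>j<?n. (if (?v i, ?v j) \<in> parcs G then c (?v j) else 0))"
    using i by (simp add: sum.distrib sum_distrib_left)
  also have "(\<Sum>j<?n. (if (?v i, ?v j) \<in> parcs G then c (?v j) else 0))
      = (\<Sum>u\<in>pverts G. if (?v i, u) \<in> parcs G then c u else 0)"
    by (rule sum_vertex_list)
  also have "\<dots> = (\<Sum>u\<in>parcs G `` {?v i}. c u)"
    using neighbours_subset finite_pverts by (intro sum.mono_neutral_cong_right) auto
  finally show ?thesis by (simp add: sum.distrib sum_distrib_left)
qed

lemma sum_arcs: "(\<Sum>(u, v)\<in>parcs G. f u v) = (\<Sum>u\<in>pverts G. \<Sum>v\<in>parcs G `` {u}. f u v)"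
proof -
  have "parcs G = Sigma (pverts G) (\<lambda>u. parcs G `` {u})" by (auto dest: arc_fst)
  moreover have "(\<Sum>u\<in>pverts G. \<Sum>v\<in>parcs G `` {u}. f u v)
      = (\<Sum>(u, v)\<in>Sigma (pverts G) (\<lambda>u. parcs G `` {u}). f u v)"
    by (rule sum.Sigma) (auto simp: finite_pverts finite_neighbours)
  ultimately show ?thesis by simp
qed

lemma sum_arcs_swap: "(\<Sum>(u, v)\<in>parcs G. f u v) = (\<Sum>(u, v)\<in>parcs G. f v u)"
  by (rule sum.reindex_bij_witness[of _ prod.swap prod.swap]) (auto dest: arc_sym)

text \<open>Adding the contributions of an arc and of its reverse gives a product, because
  \<open>\<sigma>\<^sup>2 = 1\<close>. This makes the form symmetric in \<open>y\<close> and
  \<open>z\<close>, and a sum of squares for \<open>y = z\<close>. The factor 2 counts every edge as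
  two arcs.\<close>

lemma sum_sop_bilinear:
  assumes "\<sigma>\<^sup>2 = 1"
  shows "2 * (\<Sum>v\<in>pverts G. y v * sop \<sigma> (parcs G) z v)
    = (\<Sum>(u, v)\<in>parcs G. (y u + \<sigma> * y v) * (z u + \<sigma> * z v))"
proof -
  have \<sigma>: "a * (c + \<sigma> * d) + b * (d + \<sigma> * c) = (a + \<sigma> * b) * (c + \<sigma> * d)" for a b c d
  proof -
    have "(a + \<sigma> * b) * (c + \<sigma> * d) = a * (c + \<sigma> * d) + b * (\<sigma>\<^sup>2 * d + \<sigma> * c)"
      by (simp add: power2_eq_square algebra_simps)
    then show ?thesis using assms by simp
  qed
  have 1: "(\<Sum>v\<in>pverts G. y v * sop \<sigma> (parcs G) z v) = (\<Sum>(u, v)\<in>parcs G. y u * (z u + \<sigma> * z v))"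
    by (subst sum_arcs) (simp only: sop_def sum_distrib_left)
  also have "\<dots> = (\<Sum>(u, v)\<in>parcs G. y v * (z v + \<sigma> * z u))"
    by (rule sum_arcs_swap)
  finally have "2 * (\<Sum>v\<in>pverts G. y v * sop \<sigma> (parcs G) z v)
      = (\<Sum>(u, v)\<in>parcs G. y u * (z u + \<sigma> * z v)) + (\<Sum>(u, v)\<in>parcs G. y v * (z v + \<sigma> * z u))"
    using 1 by simp
  then show ?thesis
    by (simp only: sum.distrib[symmetric] case_prod_unfold \<sigma>)
qed

lemma sop_self_adjoint:
  assumes "\<sigma>\<^sup>2 = 1"
  shows "(\<Sum>v\<in>pverts G. y v * sop \<sigma> (parcs G) z v) = (\<Sum>v\<in>pverts G. sop \<sigma> (parcs G) y v * z v)"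
  using sum_sop_bilinear[OF assms, of y z] sum_sop_bilinear[OF assms, of z y]
  by (simp add: mult.commute)

lemma rad_eigenfunction_complex:
  assumes "pverts G \<noteq> {}"
  obtains l c where "cmod l = rad \<sigma> G" "\<exists>v\<in>pverts G. c v \<noteq> 0"
    "\<And>v. v \<in> pverts G \<Longrightarrow> (\<Sum>u\<in>parcs G `` {v}. c v + of_real \<sigma> * c u) = l * c v"
proof -
  let ?n = "card (pverts G)" and ?A = "signed_laplacian \<sigma> G"
  have n: "0 < ?n" using assms finite_pverts by (simp add: card_gt_0_iff)
  have "spectral_radius ?A \<in> norm ` spectrum ?A"
    by (rule spectral_radius_mem_max(1)[OF signed_laplacian_carrier n])
  then obtain l where l: "cmod l = rad \<sigma> G" "eigenvalue ?A l"
    by (auto simp: rad_def spectrum_def)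
  then obtain x where x: "x \<in> carrier_vec ?n" "x \<noteq> 0\<^sub>v ?n" "?A *\<^sub>v x = l \<cdot>\<^sub>v x"
    using signed_laplacian_carrier[of \<sigma>] by (auto simp: eigenvalue_def eigenvector_def)
  have bij: "bij_betw (\<lambda>j. vertex_list G ! j) {..<?n} (pverts G)"
    using vertex_list_props bij_betw_nth by metis
  define idx where "idx = the_inv_into {..<?n} (\<lambda>j. vertex_list G ! j)"
  have idx: "idx (vertex_list G ! j) = j" if "j < ?n" for j
    unfolding idx_def by (rule the_inv_into_f_f) (use bij that in \<open>auto simp: bij_betw_def\<close>)
  define c where "c v = x $ idx v" for v
  have xc: "x = vec ?n (\<lambda>j. c (vertex_list G ! j))"
    using x(1) by (intro eq_vecI) (auto simp: c_def idx)
  have ev: "(\<Sum>u\<in>parcs G `` {v}. c v + of_real \<sigma> * c u) = l * c v" if "v \<in> pverts G" for v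
  proof -
    obtain i where i: "i < ?n" "v = vertex_list G ! i"
      using vertex_index[OF \<open>v \<in> pverts G\<close>] by metis
    have "(?A *\<^sub>v x) $ i = l * c v" using x(1,3) i by (simp add: c_def idx)
    then show ?thesis using signed_laplacian_mult_vec[OF i(1) xc] i(2) by simp
  qed
  have "\<exists>v\<in>pverts G. c v \<noteq> 0"
  proof (rule ccontr)
    assume "\<not> ?thesis"
    then have "x = 0\<^sub>v ?n" using bij by (subst xc, intro eq_vecI) (auto simp: bij_betw_def)
    then show False using x(2) by simp
  qed
  with l(1) ev show thesis by (intro that)
qed

text \<open>An eigenvalue of maximal modulus is real because the operator is self-adjoint and
  nonnegative because the form is a sum of squares, so it equals \<open>rad\<close>. Then the real
  and the imaginary part of a complex eigenfunction satisfy the same equation, and one of them is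
  nonzero.\<close>

lemma rad_eigenfunction:
  assumes "\<sigma> \<in> {-1, 1}" "pverts G \<noteq> {}"
  obtains z where "\<exists>v\<in>pverts G. z v \<noteq> 0"
    "\<And>v. v \<in> pverts G \<Longrightarrow> sop \<sigma> (parcs G) z v = rad \<sigma> G * z v"
proof -
  have \<sigma>: "\<sigma>\<^sup>2 = 1" using assms(1) by auto
  obtain l c where c: "cmod l = rad \<sigma> G" "\<exists>v\<in>pverts G. c v \<noteq> 0"
    "\<And>v. v \<in> pverts G \<Longrightarrow> (\<Sum>u\<in>parcs G `` {v}. c v + of_real \<sigma> * c u) = l * c v"
    using rad_eigenfunction_complex[OF assms(2)] by metis
  define x y where "x v = Re (c v)" and "y v = Im (c v)" for v
  have xy: "sop \<sigma> (parcs G) x v = Re l * x v - Im l * y v"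
    "sop \<sigma> (parcs G) y v = Re l * y v + Im l * x v" if "v \<in> pverts G" for v
    using arg_cong[OF c(3)[OF that], of Re] arg_cong[OF c(3)[OF that], of Im]
    by (simp_all add: sop_def x_def y_def)
  define N where "N = (\<Sum>v\<in>pverts G. (x v)\<^sup>2 + (y v)\<^sup>2)"
  have N: "N > 0"
  proof -
    obtain v where v: "v \<in> pverts G" "c v \<noteq> 0" using c(2) by auto
    then have "0 < (x v)\<^sup>2 + (y v)\<^sup>2"
      by (simp add: x_def y_def complex_eq_iff sum_power2_gt_zero_iff)
    then show ?thesis unfolding N_def using finite_pverts v(1) by (intro sum_pos2) auto
  qed
  have "(\<Sum>v\<in>pverts G. y v * sop \<sigma> (parcs G) x v) = (\<Sum>v\<in>pverts G. x v * sop \<sigma> (parcs G) y v)"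
    using sop_self_adjoint[OF \<sigma>, of y x] by (simp add: mult.commute)
  then have "(\<Sum>v\<in>pverts G. y v * (Re l * x v - Im l * y v)) = (\<Sum>v\<in>pverts G. x v * (Re l * y v + Im l * x v))"
    by (simp add: xy)
  then have "(\<Sum>v\<in>pverts G. y v * (Re l * x v - Im l * y v) - x v * (Re l * y v + Im l * x v)) = 0"
    by (simp add: sum_subtractf)
  then have "- Im l * N = 0"
    unfolding N_def sum_distrib_left by (simp add: power2_eq_square algebra_simps)
  then have im: "Im l = 0" using N by simp
  have "2 * (\<Sum>v\<in>pverts G. x v * sop \<sigma> (parcs G) x v) \<ge> 0" "2 * (\<Sum>v\<in>pverts G. y v * sop \<sigma> (parcs G) y v) \<ge> 0"
    unfolding sum_sop_bilinear[OF \<sigma>] by (auto intro!: sum_nonneg)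
  then have "0 \<le> (\<Sum>v\<in>pverts G. x v * (Re l * x v)) + (\<Sum>v\<in>pverts G. y v * (Re l * y v))"
    by (simp add: xy im)
  also have "\<dots> = Re l * N"
    by (simp add: N_def sum_distrib_left sum.distrib power2_eq_square algebra_simps)
  finally have "Re l \<ge> 0" using N by (simp add: zero_le_mult_iff)
  then have r: "Re l = rad \<sigma> G" using c(1) im by (simp add: cmod_def)
  obtain v where v: "v \<in> pverts G" "c v \<noteq> 0" using c(2) by auto
  then have "x v \<noteq> 0 \<or> y v \<noteq> 0" by (auto simp: x_def y_def complex_eq_iff)
  then show thesis using that[of x] that[of y] v(1) xy im r by auto
qed

text \<open>Compare at a vertex \<open>w\<close> where \<open>\<bar>z\<bar> / y\<close> is maximal.
  Taking absolute values there removes \<open>\<sigma>\<close>, which is why a supersolution of the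
  signless operator bounds both radii.\<close>

lemma rad_le_of_supersolution:
  assumes "\<sigma> \<in> {-1, 1}" "pverts G \<noteq> {}" "\<And>v. v \<in> pverts G \<Longrightarrow> 0 < y v"
    "\<And>v. v \<in> pverts G \<Longrightarrow> sop 1 (parcs G) y v \<le> \<mu> * y v"
  shows "rad \<sigma> G \<le> \<mu>"
proof -
  obtain z where z: "\<exists>v\<in>pverts G. z v \<noteq> 0"
    "\<And>v. v \<in> pverts G \<Longrightarrow> sop \<sigma> (parcs G) z v = rad \<sigma> G * z v"
    using rad_eigenfunction[OF assms(1,2)] by metis
  define r where "r = Max ((\<lambda>v. \<bar>z v\<bar> / y v) ` pverts G)"
  have rle: "\<bar>z v\<bar> \<le> r * y v" if "v \<in> pverts G" for v
  proof -
    have "\<bar>z v\<bar> / y v \<le> r" unfolding r_def using finite_pverts that by (intro Max_ge) auto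
    then show ?thesis using assms(3)[OF that] by (simp add: field_simps)
  qed
  have "r \<in> (\<lambda>v. \<bar>z v\<bar> / y v) ` pverts G" unfolding r_def using finite_pverts assms(2) by (intro Max_in) auto
  then obtain w where w: "w \<in> pverts G" "\<bar>z w\<bar> = r * y w" using assms(3) by (force simp: field_simps)
  obtain v where v: "v \<in> pverts G" "z v \<noteq> 0" using z(1) by auto
  have "0 < r * y v" using rle[OF v(1)] v(2) by linarith
  then have r: "r > 0" using assms(3)[OF v(1)] by (simp add: zero_less_mult_iff)
  have "rad \<sigma> G * \<bar>z w\<bar> \<le> \<bar>sop \<sigma> (parcs G) z w\<bar>"
    unfolding z(2)[OF w(1)] abs_mult by (intro mult_right_mono) auto
  also have "\<dots> \<le> (\<Sum>u\<in>parcs G `` {w}. \<bar>z w + \<sigma> * z u\<bar>)"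
    unfolding sop_def by (rule sum_abs)
  also have "\<dots> \<le> (\<Sum>u\<in>parcs G `` {w}. r * (y w + y u))"
  proof (intro sum_mono)
    fix u assume "u \<in> parcs G `` {w}"
    then have "u \<in> pverts G" using neighbours_subset by blast
    from rle[OF this] w(2) show "\<bar>z w + \<sigma> * z u\<bar> \<le> r * (y w + y u)"
      using assms(1) by (auto simp: algebra_simps)
  qed
  also have "\<dots> = r * sop 1 (parcs G) y w" by (simp only: sop_def sum_distrib_left mult_1)
  also have "\<dots> \<le> r * (\<mu> * y w)" using assms(4)[OF w(1)] r by simp
  also have "\<dots> = \<mu> * \<bar>z w\<bar>" by (simp add: w(2))
  finally have "rad \<sigma> G * \<bar>z w\<bar> \<le> \<mu> * \<bar>z w\<bar>" .
  moreover have "\<bar>z w\<bar> > 0" using w(2) r assms(3)[OF w(1)] by simp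
  ultimately show ?thesis by simp
qed

section \<open>Rayleigh lower bound by iterating the operator\<close>

lemma sop_pow_matrix:
  fixes \<sigma> \<mu> :: real
  defines "B \<equiv> complex_of_real (1 / \<mu>) \<cdot>\<^sub>m signed_laplacian \<sigma> G"
  assumes i: "i < card (pverts G)" and \<mu>: "\<mu> \<noteq> 0"
  shows "((B ^\<^sub>m k) *\<^sub>v vec (card (pverts G)) (\<lambda>j. complex_of_real (z (vertex_list G ! j)))) $ i
    = of_real ((sop \<sigma> (parcs G) ^^ k) z (vertex_list G ! i) / \<mu> ^ k)"
  using i
proof (induction k arbitrary: z i)
  case 0
  then show ?case using signed_laplacian_carrier[of \<sigma>] by (simp add: B_def)
next
  case (Suc k)
  let ?n = "card (pverts G)"
  let ?x = "\<lambda>z. vec ?n (\<lambda>j. complex_of_real (z (vertex_list G ! j)))"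
  have B: "B \<in> carrier_mat ?n ?n" using signed_laplacian_carrier[of \<sigma>] by (simp add: B_def)
  have Bx: "B *\<^sub>v ?x z = of_real (1 / \<mu>) \<cdot>\<^sub>v ?x (sop \<sigma> (parcs G) z)"
  proof (rule eq_vecI)
    fix i assume "i < dim_vec (of_real (1 / \<mu>) \<cdot>\<^sub>v ?x (sop \<sigma> (parcs G) z))"
    then have i: "i < ?n" by simp
    have "(B *\<^sub>v ?x z) $ i = of_real (1 / \<mu>) * (signed_laplacian \<sigma> G *\<^sub>v ?x z) $ i"
      using i signed_laplacian_carrier[of \<sigma>] by (auto simp: B_def)
    also have "(signed_laplacian \<sigma> G *\<^sub>v ?x z) $ i = of_real (sop \<sigma> (parcs G) z (vertex_list G ! i))"
      by (subst signed_laplacian_mult_vec[OF i, where c = "\<lambda>v. complex_of_real (z v)"]) (simp_all add: sop_def)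
    finally show "(B *\<^sub>v ?x z) $ i = (of_real (1 / \<mu>) \<cdot>\<^sub>v ?x (sop \<sigma> (parcs G) z)) $ i"
      using i by simp
  qed (use B in simp)
  have "(B ^\<^sub>m Suc k) *\<^sub>v ?x z = (B ^\<^sub>m k) *\<^sub>v (B *\<^sub>v ?x z)"
    using B by (simp add: assoc_mult_mat_vec[of _ ?n ?n _ ?n])
  also have "\<dots> = of_real (1 / \<mu>) \<cdot>\<^sub>v ((B ^\<^sub>m k) *\<^sub>v ?x (sop \<sigma> (parcs G) z))"
    unfolding Bx using B by (intro mult_mat_vec[of _ ?n ?n]) auto
  finally have "((B ^\<^sub>m Suc k) *\<^sub>v ?x z) $ i = of_real (1 / \<mu>) * ((B ^\<^sub>m k) *\<^sub>v ?x (sop \<sigma> (parcs G) z)) $ i"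
    using Suc.prems B by (simp del: pow_mat.simps)
  also have "\<dots> = of_real (1 / \<mu>) * of_real ((sop \<sigma> (parcs G) ^^ k) (sop \<sigma> (parcs G) z) (vertex_list G ! i) / \<mu> ^ k)"
    by (simp only: Suc.IH[OF Suc.prems])
  also have "(sop \<sigma> (parcs G) ^^ k) (sop \<sigma> (parcs G) z) = (sop \<sigma> (parcs G) ^^ Suc k) z"
    by (simp only: funpow_swap1 funpow.simps o_apply)
  also have "of_real (1 / \<mu>) * of_real ((sop \<sigma> (parcs G) ^^ Suc k) z (vertex_list G ! i) / \<mu> ^ k)
      = complex_of_real ((sop \<sigma> (parcs G) ^^ Suc k) z (vertex_list G ! i) / \<mu> ^ Suc k)"
    unfolding of_real_mult[symmetric] by (simp only: of_real_eq_iff) simp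
  finally show ?case .
qed

lemma sop_pow_self_adjoint:
  assumes "\<sigma>\<^sup>2 = 1"
  shows "(\<Sum>v\<in>pverts G. y v * (sop \<sigma> (parcs G) ^^ k) z v) = (\<Sum>v\<in>pverts G. (sop \<sigma> (parcs G) ^^ k) y v * z v)"
proof (induction k arbitrary: y)
  case (Suc k)
  have "(\<Sum>v\<in>pverts G. y v * (sop \<sigma> (parcs G) ^^ Suc k) z v)
      = (\<Sum>v\<in>pverts G. sop \<sigma> (parcs G) y v * (sop \<sigma> (parcs G) ^^ k) z v)"
    using sop_self_adjoint[OF assms] by simp
  also have "\<dots> = (\<Sum>v\<in>pverts G. (sop \<sigma> (parcs G) ^^ Suc k) y v * z v)"
    unfolding Suc.IH by (simp only: funpow_swap1 funpow.simps o_apply)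
  finally show ?case .
qed simp

text \<open>Exponents double in each step: by Cauchy-Schwarz the square of the form of
  \<open>S\<close> is at most the norm of \<open>z\<close> times that of \<open>S z\<close>, and
  self-adjointness turns the latter into the form of \<open>S\<close> applied twice.\<close>

lemma sop_pow_form_ge:
  assumes \<sigma>: "\<sigma>\<^sup>2 = 1" and "0 \<le> \<mu>" and N: "0 < (\<Sum>v\<in>pverts G. (z v)\<^sup>2)"
    and "\<mu> * (\<Sum>v\<in>pverts G. (z v)\<^sup>2) \<le> (\<Sum>v\<in>pverts G. z v * sop \<sigma> (parcs G) z v)"
  shows "\<mu> ^ 2 ^ j * (\<Sum>v\<in>pverts G. (z v)\<^sup>2) \<le> (\<Sum>v\<in>pverts G. z v * (sop \<sigma> (parcs G) ^^ 2 ^ j) z v)"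
proof (induction j)
  case 0
  then show ?case using assms(4) by simp
next
  case (Suc j)
  define S where "S = (sop \<sigma> (parcs G) ^^ 2 ^ j) z"
  let ?N = "\<Sum>v\<in>pverts G. (z v)\<^sup>2" and ?a = "\<mu> ^ 2 ^ j"
  have "(?a * ?N)\<^sup>2 \<le> (\<Sum>v\<in>pverts G. z v * S v)\<^sup>2"
    using Suc.IH N assms(2) unfolding S_def by (intro power_mono) auto
  also have "\<dots> \<le> ?N * (\<Sum>v\<in>pverts G. (S v)\<^sup>2)"
    by (rule sum_mult_square_le[OF N])
  finally have "?N * (?a\<^sup>2 * ?N) \<le> ?N * (\<Sum>v\<in>pverts G. (S v)\<^sup>2)"
    by (simp only: power2_eq_square ac_simps)
  then have "?a\<^sup>2 * ?N \<le> (\<Sum>v\<in>pverts G. (S v)\<^sup>2)"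
    using N by simp
  also have "\<dots> = (\<Sum>v\<in>pverts G. (sop \<sigma> (parcs G) ^^ 2 ^ j) z v * S v)"
    by (simp add: S_def power2_eq_square)
  also have "\<dots> = (\<Sum>v\<in>pverts G. z v * (sop \<sigma> (parcs G) ^^ 2 ^ j) S v)"
    by (rule sop_pow_self_adjoint[OF \<sigma>, symmetric])
  also have "(sop \<sigma> (parcs G) ^^ 2 ^ j) S = (sop \<sigma> (parcs G) ^^ 2 ^ Suc j) z"
    by (simp add: S_def mult_2 funpow_add)
  also have "?a\<^sup>2 = \<mu> ^ 2 ^ Suc j" by (simp add: power_mult[symmetric] mult.commute)
  finally show ?case .
qed

text \<open>After division by \<open>\<mu>\<close> the matrix has spectral radius below 1, so its
  powers are uniformly bounded; \<open>sop_pow_matrix\<close> reads this off as a growth rate of the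
  iterates.\<close>

lemma sop_pow_bounded:
  assumes "pverts G \<noteq> {}" "rad \<sigma> G < \<mu>"
  obtains C where "\<And>k v. v \<in> pverts G \<Longrightarrow> \<bar>(sop \<sigma> (parcs G) ^^ k) z v\<bar> \<le> C * \<mu> ^ k"
proof -
  let ?n = "card (pverts G)" and ?A = "signed_laplacian \<sigma> G"
  have n: "0 < ?n" using assms finite_pverts by (simp add: card_gt_0_iff)
  define B where "B = complex_of_real (1 / \<mu>) \<cdot>\<^sub>m ?A"
  have A: "?A \<in> carrier_mat ?n ?n" by (rule signed_laplacian_carrier)
  then have B: "B \<in> carrier_mat ?n ?n" by (simp add: B_def)
  have "0 \<le> rad \<sigma> G" by (rule rad_eigenfunction_complex[OF assms(1), of \<sigma>]) (metis norm_ge_zero)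
  then have \<mu>: "0 < \<mu>" using assms(2) by simp
  have "spectral_radius B < 1"
  proof -
    have "spectral_radius B \<in> norm ` spectrum B" by (rule spectral_radius_mem_max(1)[OF B n])
    then obtain l x where l: "spectral_radius B = cmod l"
      and x: "x \<in> carrier_vec ?n" "x \<noteq> 0\<^sub>v ?n" "B *\<^sub>v x = l \<cdot>\<^sub>v x"
      using B by (auto simp: spectrum_def eigenvalue_def eigenvector_def)
    have "?A = of_real \<mu> \<cdot>\<^sub>m B" using A \<mu> by (intro eq_matI) (auto simp: B_def)
    then have "?A *\<^sub>v x = of_real \<mu> \<cdot>\<^sub>v (B *\<^sub>v x)"
      using B x(1) by auto
    also have "\<dots> = (of_real \<mu> * l) \<cdot>\<^sub>v x" unfolding x(3) by (simp add: smult_smult_assoc)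
    finally have "eigenvector ?A x (of_real \<mu> * l)" using A x by (auto simp: eigenvector_def)
    then have "cmod (of_real \<mu> * l) \<in> norm ` spectrum ?A"
      unfolding spectrum_def eigenvalue_def by blast
    then have "cmod (of_real \<mu> * l) \<le> rad \<sigma> G"
      unfolding rad_def by (rule spectral_radius_mem_max(2)[OF A n])
    then have "\<mu> * spectral_radius B \<le> rad \<sigma> G" using \<mu> l by (simp add: norm_mult)
    then have "\<mu> * spectral_radius B < \<mu> * 1" using assms(2) by linarith
    then show ?thesis by (simp only: mult_less_cancel_left_pos[OF \<mu>])
  qed
  then obtain c where c: "\<And>k. norm_bound (B ^\<^sub>m k) c"
    using spectral_radius_jnf_norm_bound_less_1_upper_triangular[OF B] by blast
  define C where "C = (\<Sum>j<?n. c * \<bar>z (vertex_list G ! j)\<bar>)"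
  show thesis
  proof (rule that[of C])
    fix k v assume v: "v \<in> pverts G"
    obtain i where i: "i < ?n" "v = vertex_list G ! i" using vertex_index[OF v] by metis
    define x where "x = vec ?n (\<lambda>j. complex_of_real (z (vertex_list G ! j)))"
    have Bk: "B ^\<^sub>m k \<in> carrier_mat ?n ?n" using B by (rule pow_carrier_mat)
    have "(M *\<^sub>v x) $ i = (\<Sum>j<?n. M $$ (i, j) * z (vertex_list G ! j))"
      if "M \<in> carrier_mat ?n ?n" for M
      using i that by (auto simp: x_def scalar_prod_def atLeast0LessThan intro!: sum.cong)
    from this[OF Bk] have "cmod (((B ^\<^sub>m k) *\<^sub>v x) $ i) \<le> (\<Sum>j<?n. cmod ((B ^\<^sub>m k) $$ (i, j) * z (vertex_list G ! j)))"
      by (simp add: norm_sum)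
    also have "\<dots> \<le> C"
      unfolding C_def
    proof (intro sum_mono)
      fix j assume "j \<in> {..<?n}"
      then have "norm ((B ^\<^sub>m k) $$ (i, j)) \<le> c"
        using c[of k] i B by (auto simp: norm_bound_def)
      then show "cmod ((B ^\<^sub>m k) $$ (i, j) * z (vertex_list G ! j)) \<le> c * \<bar>z (vertex_list G ! j)\<bar>"
        by (simp add: norm_mult mult_right_mono)
    qed
    finally have "cmod (of_real ((sop \<sigma> (parcs G) ^^ k) z v / \<mu> ^ k)) \<le> C"
      using sop_pow_matrix[OF i(1), of \<mu> \<sigma> k z] \<mu> unfolding x_def B_def i(2) by simp
    then show "\<bar>(sop \<sigma> (parcs G) ^^ k) z v\<bar> \<le> C * \<mu> ^ k"
      using \<mu> by (simp add: norm_divide norm_power field_simps)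
  qed
qed

text \<open>If the quotient \<open>\<mu>\<close> exceeded the radius, the iterates would grow at
  most like powers of some \<open>m\<close> strictly in between, although the form of the iterates
  of order \<open>2 ^ j\<close> grows at least like \<open>\<mu> ^ 2 ^ j\<close>.\<close>

lemma rad_ge_of_form:
  assumes \<sigma>: "\<sigma> \<in> {-1, 1}" and z: "\<exists>v\<in>pverts G. z v \<noteq> 0"
    and form: "\<mu> * (\<Sum>v\<in>pverts G. (z v)\<^sup>2) \<le> (\<Sum>v\<in>pverts G. z v * sop \<sigma> (parcs G) z v)"
  shows "\<mu> \<le> rad \<sigma> G"
proof (rule ccontr)
  assume "\<not> \<mu> \<le> rad \<sigma> G"
  define N where "N = (\<Sum>v\<in>pverts G. (z v)\<^sup>2)"
  have N: "0 < N"
  proof -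
    obtain v where "v \<in> pverts G" "z v \<noteq> 0" using z by auto
    then show ?thesis unfolding N_def using finite_pverts by (intro sum_pos2[of _ v]) auto
  qed
  have ne: "pverts G \<noteq> {}" using z by auto
  have "0 \<le> rad \<sigma> G" by (rule rad_eigenfunction_complex[OF ne, of \<sigma>]) (metis norm_ge_zero)
  define m where "m = (rad \<sigma> G + \<mu>) / 2"
  have m: "rad \<sigma> G < m" "m < \<mu>" "0 < m"
    using \<open>0 \<le> rad \<sigma> G\<close> \<open>\<not> \<mu> \<le> rad \<sigma> G\<close> by (simp_all add: m_def)
  obtain C where C: "\<And>k v. v \<in> pverts G \<Longrightarrow> \<bar>(sop \<sigma> (parcs G) ^^ k) z v\<bar> \<le> C * m ^ k"
    using sop_pow_bounded[OF ne m(1), of z] by blast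
  define D where "D = (\<Sum>v\<in>pverts G. \<bar>z v\<bar> * C)"
  have le: "(\<mu> / m) ^ 2 ^ j * N \<le> D" for j
  proof -
    have "\<mu> ^ 2 ^ j * N \<le> (\<Sum>v\<in>pverts G. z v * (sop \<sigma> (parcs G) ^^ 2 ^ j) z v)"
      unfolding N_def using \<sigma> m N form by (intro sop_pow_form_ge) (auto simp: N_def)
    also have "\<dots> \<le> (\<Sum>v\<in>pverts G. \<bar>z v\<bar> * (C * m ^ 2 ^ j))"
    proof (intro sum_mono)
      fix v assume v: "v \<in> pverts G"
      have "z v * (sop \<sigma> (parcs G) ^^ 2 ^ j) z v \<le> \<bar>z v\<bar> * \<bar>(sop \<sigma> (parcs G) ^^ 2 ^ j) z v\<bar>"
        by (metis abs_ge_self abs_mult)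
      also have "\<dots> \<le> \<bar>z v\<bar> * (C * m ^ 2 ^ j)" by (intro mult_left_mono C v) auto
      finally show "z v * (sop \<sigma> (parcs G) ^^ 2 ^ j) z v \<le> \<bar>z v\<bar> * (C * m ^ 2 ^ j)" .
    qed
    also have "\<dots> = D * m ^ 2 ^ j" by (simp only: D_def sum_distrib_right mult.assoc)
    finally show ?thesis using m by (simp add: power_divide field_simps)
  qed
  have "1 < \<mu> / m" using m by simp
  then obtain j where j: "D / N < (\<mu> / m) ^ j" using real_arch_pow by blast
  also have "\<dots> \<le> (\<mu> / m) ^ 2 ^ j"
    using \<open>1 < \<mu> / m\<close> by (intro power_increasing) (auto intro: less_imp_le)
  finally show False using le[of j] N by (simp add: field_simps)
qed

end

section \<open>The numbers \<open>\<xi>\<^sub>n\<close>\<close>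

text \<open>With \<open>x = s\<^sup>2\<close> the equation defining \<open>\<vartheta>\<^sub>n\<close> becomes \<open>psi n s = 1\<close>.\<close>

definition psi :: "nat \<Rightarrow> real \<Rightarrow> real" where
  "psi n s = (1 + s)\<^sup>2 * (\<Sum>k = 1..n. s ^ (2 * k))"

definition sroot :: "nat \<Rightarrow> real" where
  "sroot n = sqrt (vartheta n)"

lemma powr_half_odd:
  assumes "0 < s" "i \<le> n"
  shows "(s\<^sup>2) powr (real n - real i + 1 / 2) = s ^ (2 * (n - i) + 1)"
proof -
  have "(s\<^sup>2) powr (real n - real i + 1 / 2) = (s powr 2) powr (real n - real i + 1 / 2)"
    using assms by simp
  also have "\<dots> = s powr (real (2 * (n - i) + 1))"
    unfolding powr_powr using assms by (simp add: algebra_simps of_nat_diff)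
  finally show ?thesis using assms by (simp only: powr_realpow)
qed

lemma psi_Suc: "psi (Suc n) s = psi n s + (1 + s)\<^sup>2 * s ^ (2 * Suc n)"
  by (simp add: psi_def algebra_simps)

text \<open>The odd powers of \<open>s\<close> supply the middle term of
  \<open>(1 + s)\<^sup>2 = 1 + 2 * s + s\<^sup>2\<close>. The even powers, with
  \<open>s\<^sup>2\<close> and the top power occurring once and all others twice, are the sum in
  \<open>psi\<close> plus its shift by \<open>s\<^sup>2\<close>.\<close>

lemma phi_eq_psi:
  assumes "0 < s" "2 \<le> n"
  shows "phi n (s\<^sup>2) = psi n s - 1"
proof -
  have 1: "(\<Sum>i = 0..n - 1. (s\<^sup>2) powr (real n - real i + 1 / 2)) = (\<Sum>k = 1..n. s ^ (2 * k + 1))"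
    by (rule sum.reindex_bij_witness[of _ "\<lambda>k. n - k" "\<lambda>i. n - i"])
      (use assms in \<open>auto simp: powr_half_odd\<close>)
  have 2: "(\<Sum>i = 0..n - 2. (s\<^sup>2) ^ (i + 2)) = (\<Sum>k = 2..n. s ^ (2 * k))"
    unfolding power_mult[symmetric]
    by (rule sum.reindex_bij_witness[of _ "\<lambda>k. k - 2" "\<lambda>i. i + 2"]) (use assms in auto)
  have 3: "(\<Sum>k = 1..n. s ^ (2 * k)) = s\<^sup>2 + (\<Sum>k = 2..n. s ^ (2 * k))"
    using assms by (simp add: sum.atLeast_Suc_atMost numeral_2_eq_2)
  have "(\<Sum>k = 1..n. q ^ k) + q ^ (n + 1) = q + q * (\<Sum>k = 1..n. q ^ k)" for q :: real
  proof (induction n)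
    case (Suc n)
    let ?S = "\<Sum>k = 1..n. q ^ k"
    have "(\<Sum>k = 1..Suc n. q ^ k) + q ^ (Suc n + 1) = (?S + q ^ (n + 1)) + q * q ^ (n + 1)" by simp
    also have "\<dots> = q + q * ?S + q * q ^ (n + 1)" by (simp only: Suc.IH)
    also have "\<dots> = q + q * (?S + q ^ (n + 1))" by (simp only: distrib_left add.assoc)
    also have "\<dots> = q + q * (\<Sum>k = 1..Suc n. q ^ k)" by simp
    finally show ?case .
  qed simp
  from this[of "s\<^sup>2"]
  have 4: "s\<^sup>2 + (\<Sum>k = 2..n. s ^ (2 * k)) + (s\<^sup>2) ^ (n + 1) = s\<^sup>2 + s\<^sup>2 * (\<Sum>k = 1..n. s ^ (2 * k))"
    using 3 by (simp only: power_mult)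
  have "(\<Sum>k = 1..n. s ^ (2 * k + 1)) = s * (\<Sum>k = 1..n. s ^ (2 * k))"
    by (simp add: sum_distrib_left)
  with 1 have 1: "(\<Sum>i = 0..n - 1. (s\<^sup>2) powr (real n - real i + 1 / 2)) = s * (\<Sum>k = 1..n. s ^ (2 * k))"
    by simp
  show ?thesis
    unfolding phi_def 1 2 psi_def using 3 4
    by (simp add: power2_eq_square algebra_simps)
qed

lemma phi1_eq_psi:
  assumes "0 < s"
  shows "phi1 (s\<^sup>2) = psi 1 s - 1"
proof -
  have "(s\<^sup>2) powr (3 / 2) = s ^ 3"
    using powr_half_odd[of s 0 1] assms by (simp add: numeral_3_eq_3)
  then show ?thesis by (simp add: phi1_def psi_def power2_eq_square power3_eq_cube algebra_simps)
qed

lemma sroot_0: "sroot 0 = 1"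
  by (simp add: sroot_def vartheta_def)

lemma sroot_props:
  assumes "1 \<le> n"
  shows "0 < sroot n" "psi n (sroot n) = 1"
proof -
  have v: "0 < vartheta n"
    using vartheta_1(1) vartheta_ge_2(1)[of n] assms by (cases "n = 1") auto
  then show p: "0 < sroot n" by (simp add: sroot_def)
  have sq: "(sroot n)\<^sup>2 = vartheta n" using v by (simp add: sroot_def)
  show "psi n (sroot n) = 1"
  proof (cases "n = 1")
    case True
    then show ?thesis using phi1_eq_psi[OF p] vartheta_1(2) sq by simp
  next
    case False
    then show ?thesis using phi_eq_psi[OF p, of n] vartheta_ge_2(2)[of n] sq assms by simp
  qed
qed

lemma sroot_pos: "0 < sroot n"
  using sroot_0 sroot_props(1)[of n] by (cases "n = 0") auto

definition mu :: "real \<Rightarrow> real" where "mu s = 2 + s + 1 / s"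

lemma xi_eq_mu: "xi n = mu (sroot n)"
proof -
  have v: "0 < vartheta n" using sroot_pos[of n] by (simp add: sroot_def)
  have "vartheta n powr (1 / 2) = sroot n" using v by (simp add: sroot_def powr_half_sqrt)
  moreover have "vartheta n powr (- 1 / 2) = 1 / sroot n"
    using v by (simp add: sroot_def powr_minus_divide powr_half_sqrt)
  ultimately show ?thesis by (simp add: xi_def mu_def)
qed

lemma mu_strict_antimono: "0 < s \<Longrightarrow> s < t \<Longrightarrow> t \<le> 1 \<Longrightarrow> mu t < mu s"
proof -
  assume st: "0 < s" "s < t" "t \<le> 1"
  have "s * t \<le> s * 1" using st by (intro mult_left_mono) auto
  then have "s * t < 1" using st by linarith
  then have "0 < (t - s) * (1 - s * t)" using st by (intro mult_pos_pos) auto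
  then have "0 < (t - s) * (1 - s * t) / (s * t)" using st by (intro divide_pos_pos) auto
  also have "\<dots> = mu s - mu t" using st by (simp add: mu_def field_simps)
  finally show ?thesis by simp
qed

lemma psi_strict_mono: "0 < s \<Longrightarrow> s < t \<Longrightarrow> 1 \<le> n \<Longrightarrow> psi n s < psi n t"
  unfolding psi_def
  by (intro mult_strict_mono sum_strict_mono power_strict_mono sum_pos sum_nonneg) auto

lemma psi_mono: "0 \<le> s \<Longrightarrow> m \<le> n \<Longrightarrow> psi m s \<le> psi n s"
  unfolding psi_def by (intro mult_left_mono sum_mono2) auto

text \<open>The geometric sum with ratio \<open>s\<^sup>2\<close>; one factor \<open>1 + s\<close>
  of \<open>1 - s\<^sup>2\<close> cancels.\<close>

lemma psi_closed: "(1 - s) * psi n s = (1 + s) * s\<^sup>2 * (1 - s ^ (2 * n))"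
proof (induction n)
  case 0
  then show ?case by (simp add: psi_def)
next
  case (Suc n)
  then show ?case by (simp add: psi_Suc power2_eq_square algebra_simps)
qed

lemma sroot_less_iff:
  assumes "1 \<le> n" "0 < s"
  shows "psi n s < 1 \<longleftrightarrow> s < sroot n"
  using psi_strict_mono[of s "sroot n" n] psi_strict_mono[of "sroot n" s n] sroot_props[OF assms(1)] assms
  by (cases s "sroot n" rule: linorder_cases) auto

lemma sroot_less_1: "1 \<le> n \<Longrightarrow> sroot n < 1"
proof -
  assume n: "1 \<le> n"
  have "psi n 1 = 4 * n" by (simp add: psi_def)
  then have "\<not> psi n 1 \<le> 1" using n by simp
  then show ?thesis
    using sroot_less_iff[OF n, of 1] sroot_props[OF n] by (cases "sroot n" "1::real" rule: linorder_cases) auto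
qed

lemma sroot_le_1: "sroot n \<le> 1"
  using sroot_less_1[of n] sroot_0 by (cases "n = 0") auto

lemma sroot_Suc_less: "sroot (Suc n) < sroot n"
proof (cases "n = 0")
  case True
  then show ?thesis using sroot_less_1[of 1] sroot_0 by simp
next
  case False
  then have n: "1 \<le> n" by simp
  have "psi n (sroot (Suc n)) < psi (Suc n) (sroot (Suc n))"
    using sroot_pos[of "Suc n"] unfolding psi_Suc by simp
  then show ?thesis using sroot_less_iff[OF n] sroot_props[of "Suc n"] by simp
qed

lemma strict_mono_xi: "strict_mono xi"
  unfolding strict_mono_Suc_iff xi_eq_mu
  using mu_strict_antimono sroot_pos sroot_Suc_less sroot_le_1 by blast

section \<open>The limit of the numbers \<open>xi n\<close>\<close>

definition tau :: real where
  "tau = (SOME s. 0 < s \<and> s < 1 \<and> s ^ 3 + s\<^sup>2 + s = 1)"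

text \<open>Letting \<open>n\<close> tend to infinity in \<open>psi n s = 1\<close> turns
  \<open>psi_closed\<close> into \<open>(1 + s) * s\<^sup>2 = 1 - s\<close>, which is this
  cubic.\<close>

lemma tau: "0 < tau" "tau < 1" "tau ^ 3 + tau\<^sup>2 + tau = 1"
proof -
  have "\<exists>s\<ge>0. s \<le> 1 \<and> s ^ 3 + s\<^sup>2 + s = (1::real)"
  proof -
    have "continuous_on {0..1} (\<lambda>s::real. s ^ 3 + s\<^sup>2 + s)" by (intro continuous_intros)
    then show ?thesis using IVT'[of "\<lambda>s::real. s ^ 3 + s\<^sup>2 + s" 0 1 1] by auto
  qed
  then obtain s :: real where s: "0 \<le> s" "s \<le> 1" "s ^ 3 + s\<^sup>2 + s = 1" by auto
  then have "s \<noteq> 0" "s \<noteq> 1" by auto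
  with s have "\<exists>s::real. 0 < s \<and> s < 1 \<and> s ^ 3 + s\<^sup>2 + s = 1" by (intro exI[of _ s]) auto
  from someI_ex[OF this] show "0 < tau" "tau < 1" "tau ^ 3 + tau\<^sup>2 + tau = 1"
    unfolding tau_def by auto
qed

text \<open>Cardano's formula: the two radicands have product \<open>12 ^ 3\<close>, so
  \<open>a * b = 12\<close>, and expanding the cube of \<open>a + b\<close> gives the
  equation.\<close>

lemma epsilon_cubic: "0 < epsilon" "epsilon ^ 3 = 4 * epsilon + 4"
proof -
  define a b where "a = (54 - 6 * sqrt 33) powr (1 / 3 :: real)" and "b = (54 + 6 * sqrt 33) powr (1 / 3 :: real)"
  have "sqrt 33 < 9" by (rule real_less_lsqrt) auto
  then have p: "0 < 54 - 6 * sqrt 33" "0 < 54 + 6 * sqrt 33" by (auto intro: add_pos_nonneg)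
  have ab: "0 < a" "0 < b" using p by (auto simp: a_def b_def)
  have cube: "(x powr (1 / 3)) ^ 3 = x" if "0 < x" for x :: real
    using that by (simp add: powr_realpow[symmetric] powr_powr)
  have a3: "a ^ 3 = 54 - 6 * sqrt 33" and b3: "b ^ 3 = 54 + 6 * sqrt 33"
    using p by (simp_all add: a_def b_def cube)
  have "(a * b) ^ 3 = 12 ^ 3"
  proof -
    have "(54 - 6 * x) * (54 + 6 * x) = 2916 - 36 * x\<^sup>2" for x :: real
      by (simp add: power2_eq_square algebra_simps)
    from this[of "sqrt 33"] show ?thesis unfolding power_mult_distrib a3 b3 by simp
  qed
  then have 12: "a * b = 12" using power_eq_imp_eq_base[of "a * b" 3 12] ab by simp
  have e: "epsilon = (a + b) / 3" by (simp add: epsilon_def a_def b_def)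
  show "0 < epsilon" using ab e by simp
  have "(a + b) ^ 3 = a ^ 3 + b ^ 3 + 3 * (a * b) * (a + b)"
    by (simp add: power3_eq_cube algebra_simps)
  then have "(a + b) ^ 3 = 108 + 36 * (a + b)" unfolding a3 b3 12 by simp
  then show "epsilon ^ 3 = 4 * epsilon + 4" unfolding e by (simp add: power_divide)
qed

text \<open>The cubic of \<open>tau\<close> gives \<open>1 / tau = tau\<^sup>2 + tau + 1\<close>,
  hence \<open>r = (1 + tau)\<^sup>2\<close>, and a polynomial identity shows that \<open>r\<close>
  satisfies the cubic of \<open>epsilon\<close>. The two positive roots coincide because
  \<open>2 < r\<close> makes the quadratic cofactor of \<open>r - epsilon\<close> positive.\<close>

lemma epsilon_eq: "2 + epsilon = mu tau"
proof -
  define r where "r = tau + 1 / tau"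
  have "1 / tau = tau\<^sup>2 + tau + 1"
    using tau by (simp add: field_simps power2_eq_square power3_eq_cube)
  then have "r = (1 + tau)\<^sup>2" by (simp add: r_def power2_eq_square algebra_simps)
  moreover have "((1 + x)\<^sup>2) ^ 3 - (4 * (1 + x)\<^sup>2 + 4) = (x ^ 3 + x\<^sup>2 + x - 1) * (x ^ 3 + 5 * x\<^sup>2 + 9 * x + 7)"
    for x :: real by (simp add: power2_eq_square power3_eq_cube algebra_simps)
  ultimately have "r ^ 3 - (4 * r + 4) = (tau ^ 3 + tau\<^sup>2 + tau - 1) * (tau ^ 3 + 5 * tau\<^sup>2 + 9 * tau + 7)"
    by simp
  then have r3: "r ^ 3 = 4 * r + 4" using tau(3) by simp
  have pos: "0 < r" using tau by (simp add: r_def add_pos_pos)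
  have big: "2 < x" if "0 < x" "x ^ 3 = 4 * x + 4" for x :: real
  proof (rule ccontr)
    assume "\<not> 2 < x"
    then have "x * x \<le> 2 * 2" using that by (intro mult_mono) auto
    then have "x * (x * x) \<le> x * 4" using that by (intro mult_left_mono) auto
    moreover have "x ^ 3 = x * (x * x)" by (simp add: power3_eq_cube)
    ultimately show False using that by linarith
  qed
  have "(r - epsilon) * (r\<^sup>2 + r * epsilon + epsilon\<^sup>2 - 4) = (r ^ 3 - 4 * r) - (epsilon ^ 3 - 4 * epsilon)"
    by (simp add: power2_eq_square power3_eq_cube algebra_simps)
  then have "(r - epsilon) * (r\<^sup>2 + r * epsilon + epsilon\<^sup>2 - 4) = 0"
    using r3 epsilon_cubic by simp
  moreover have "2\<^sup>2 < r\<^sup>2" using big[OF pos r3] by (intro power_strict_mono) auto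
  moreover have "0 \<le> r * epsilon + epsilon\<^sup>2" using pos epsilon_cubic by simp
  ultimately have "r = epsilon" by auto
  then show ?thesis by (simp add: mu_def r_def)
qed

text \<open>The value is about 4.38298. The constant separates it from the Rayleigh quotients of the
  forbidden subgraphs, the closest of which is 588/134, about 4.388.\<close>

lemma two_plus_epsilon_less: "2 + epsilon < 4384 / 1000"
proof (rule ccontr)
  assume "\<not> ?thesis"
  then have e: "2384 / 1000 \<le> epsilon" by simp
  then have "(2384 / 1000)\<^sup>2 \<le> epsilon\<^sup>2" by (intro power_mono) auto
  then have "epsilon * ((2384 / 1000)\<^sup>2 - 4) \<le> epsilon * (epsilon\<^sup>2 - 4)" using e by (intro mult_left_mono) auto
  also have "\<dots> = 4" using epsilon_cubic(2) by (simp add: power2_eq_square power3_eq_cube algebra_simps)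
  finally have "epsilon * ((2384 / 1000)\<^sup>2 - 4) \<le> 4" .
  moreover have "2384 / 1000 * ((2384 / 1000)\<^sup>2 - 4) \<le> epsilon * ((2384 / 1000)\<^sup>2 - 4)"
    using e by (intro mult_right_mono) (auto simp: power2_eq_square)
  ultimately show False by (simp add: power2_eq_square)
qed

text \<open>At \<open>tau\<close> the closed form collapses to
  \<open>psi n tau = 1 - tau ^ (2 * n)\<close>, just below 1.\<close>

lemma tau_less_sroot: "tau < sroot n"
proof (cases "n = 0")
  case True
  then show ?thesis using sroot_0 tau by simp
next
  case False
  have "(1 + tau) * tau\<^sup>2 = 1 - tau" using tau(3) by (simp add: power2_eq_square power3_eq_cube algebra_simps)
  then have "(1 - tau) * psi n tau = (1 - tau) * (1 - tau ^ (2 * n))" using psi_closed by metis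
  then have "psi n tau < 1" using tau by simp
  then show ?thesis using sroot_less_iff[of n tau] False tau(1) by simp
qed

lemma psi_exceeds_1:
  assumes "tau < s" "s < 1"
  shows "eventually (\<lambda>n. 1 < psi n s) sequentially"
proof -
  have s: "0 < s" using assms tau by simp
  have "tau ^ 3 < s ^ 3" "tau\<^sup>2 < s\<^sup>2" using assms tau by (auto intro!: power_strict_mono)
  then have "1 < s ^ 3 + s\<^sup>2 + s" using tau assms(1) by linarith
  then have lt: "1 - s < (1 + s) * s\<^sup>2" by (simp add: power2_eq_square power3_eq_cube algebra_simps)
  have "(\<lambda>n. (s\<^sup>2) ^ n) \<longlonglongrightarrow> 0"
    using s assms(2) by (intro LIMSEQ_power_zero) (simp add: power_less_one_iff)
  then have "(\<lambda>n. (1 + s) * s\<^sup>2 * (1 - s ^ (2 * n))) \<longlonglongrightarrow> (1 + s) * s\<^sup>2 * (1 - 0)"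
    by (intro tendsto_intros) (simp add: power_mult)
  then have "eventually (\<lambda>n. 1 - s < (1 + s) * s\<^sup>2 * (1 - s ^ (2 * n))) sequentially"
    using lt by (intro order_tendstoD) auto
  then show ?thesis
  proof eventually_elim
    case (elim n)
    then have "(1 - s) * 1 < (1 - s) * psi n s" by (simp add: psi_closed)
    then show ?case using assms by (simp only: mult_less_cancel_left_pos)
  qed
qed

lemma sroot_tendsto: "sroot \<longlonglongrightarrow> tau"
proof (rule order_tendstoI)
  fix a assume "a < tau"
  then show "eventually (\<lambda>n. a < sroot n) sequentially"
    using tau_less_sroot less_trans by (intro always_eventually allI) blast
next
  fix a assume a: "tau < a"
  \<comment> \<open>Capped below 1, where the geometric series behind \<open>psi\<close>
    converges.\<close>
  define s where "s = min a ((1 + tau) / 2)"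
  have s: "tau < s" "s < 1" "s \<le> a" using a tau(1,2) by (auto simp: s_def min_less_iff_disj field_simps)
  from psi_exceeds_1[OF s(1,2)] eventually_ge_at_top[of 1]
  show "eventually (\<lambda>n. sroot n < a) sequentially"
  proof eventually_elim
    case (elim n)
    have "sroot n < s"
      using elim psi_strict_mono[of s "sroot n" n] sroot_props[of n] s tau by (cases "sroot n" s rule: linorder_cases) auto
    then show ?case using s by simp
  qed
qed

lemma mu_continuous: "0 < s \<Longrightarrow> isCont mu s"
  unfolding mu_def by (intro continuous_intros) auto

lemma xi_tendsto: "xi \<longlonglongrightarrow> 2 + epsilon"
  unfolding epsilon_eq xi_eq_mu
  using isCont_tendsto_compose[OF mu_continuous[OF tau(1)] sroot_tendsto] .

lemma xi_less: "xi n < 2 + epsilon"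
  unfolding epsilon_eq xi_eq_mu using mu_strict_antimono tau tau_less_sroot sroot_le_1 by blast

lemma xi_0: "xi 0 = 4"
  by (simp add: xi_eq_mu sroot_0 mu_def)

section \<open>Lower bounds from subgraphs\<close>

text \<open>Edges left out contribute nonnegative squares, so the form may be evaluated on any
  subgraph, induced or not. \<open>A\<close> contains every chosen edge in one direction
  only.\<close>

lemma rad_ge_of_edges:
  assumes G: "pair_graph G" and \<sigma>: "\<sigma> \<in> {-1, 1}" and A: "A \<subseteq> parcs G" "A \<inter> A\<inverse> = {}"
    and S: "S \<subseteq> pverts G" "\<exists>v\<in>S. z v \<noteq> 0" "\<And>v. v \<notin> S \<Longrightarrow> z v = 0"
    and le: "\<mu> * (\<Sum>v\<in>S. (z v)\<^sup>2) \<le> (\<Sum>(u, v)\<in>A. (z u + \<sigma> * z v)\<^sup>2)"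
  shows "\<mu> \<le> rad \<sigma> G"
proof (rule rad_ge_of_form[OF G \<sigma>])
  have \<sigma>2: "\<sigma>\<^sup>2 = 1" using \<sigma> by auto
  have finA: "finite A" using A(1) finite_parcs[OF G] finite_subset by blast
  let ?f = "\<lambda>(u, v). (z u + \<sigma> * z v)\<^sup>2"
  have sw: "(a + \<sigma> * b)\<^sup>2 = (b + \<sigma> * a)\<^sup>2" for a b
    using \<sigma> by (auto simp: power2_eq_square algebra_simps)
  have "sum ?f (A\<inverse>) = sum ?f A"
    by (rule sum.reindex_bij_witness[of _ prod.swap prod.swap]) (auto simp: sw)
  then have "2 * sum ?f A = sum ?f (A \<union> A\<inverse>)"
    using finA A(2) by (subst sum.union_disjoint) auto
  also have "\<dots> \<le> sum ?f (parcs G)"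
    using A(1) finite_parcs[OF G] arc_sym[OF G] by (intro sum_mono2) auto
  also have "\<dots> = 2 * (\<Sum>v\<in>pverts G. z v * sop \<sigma> (parcs G) z v)"
    unfolding sum_sop_bilinear[OF G \<sigma>2] by (simp add: power2_eq_square)
  finally have "sum ?f A \<le> (\<Sum>v\<in>pverts G. z v * sop \<sigma> (parcs G) z v)" by simp
  moreover have "(\<Sum>v\<in>pverts G. (z v)\<^sup>2) = (\<Sum>v\<in>S. (z v)\<^sup>2)"
    using S finite_pverts[OF G] by (intro sum.mono_neutral_right) auto
  ultimately show "\<mu> * (\<Sum>v\<in>pverts G. (z v)\<^sup>2) \<le> (\<Sum>v\<in>pverts G. z v * sop \<sigma> (parcs G) z v)"
    using le by simp
  show "\<exists>v\<in>pverts G. z v \<noteq> 0" using S by auto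
qed

text \<open>Extend an eigenfunction of \<open>H\<close> by zero; the additional edges of
  \<open>G\<close> only add squares.\<close>

lemma rad_mono:
  assumes G: "pair_graph G" and H: "pair_graph H" and \<sigma>: "\<sigma> \<in> {-1, 1}"
    and sub: "pverts H \<subseteq> pverts G" "parcs H \<subseteq> parcs G" and ne: "pverts H \<noteq> {}"
  shows "rad \<sigma> H \<le> rad \<sigma> G"
proof -
  have \<sigma>2: "\<sigma>\<^sup>2 = 1" using \<sigma> by auto
  obtain x where x: "\<exists>v\<in>pverts H. x v \<noteq> 0"
    "\<And>v. v \<in> pverts H \<Longrightarrow> sop \<sigma> (parcs H) x v = rad \<sigma> H * x v"
    using rad_eigenfunction[OF H \<sigma> ne] by metis
  define z where "z v = (if v \<in> pverts H then x v else 0)" for v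
  have "sop \<sigma> (parcs H) z v = sop \<sigma> (parcs H) x v" if "v \<in> pverts H" for v
    unfolding sop_def using that neighbours_subset[OF H, of v] by (intro sum.cong) (auto simp: z_def)
  then have z: "z v * sop \<sigma> (parcs H) z v = rad \<sigma> H * (z v)\<^sup>2" if "v \<in> pverts H" for v
    using that x(2) by (simp add: z_def power2_eq_square)
  have "2 * (rad \<sigma> H * (\<Sum>v\<in>pverts G. (z v)\<^sup>2)) = 2 * (\<Sum>v\<in>pverts H. rad \<sigma> H * (z v)\<^sup>2)"
    unfolding sum_distrib_left
    using sub(1) finite_pverts[OF G] by (intro sum.mono_neutral_right) (auto simp: z_def)
  also have "\<dots> = 2 * (\<Sum>v\<in>pverts H. z v * sop \<sigma> (parcs H) z v)"
    using z by simp
  also have "\<dots> = (\<Sum>(u, v)\<in>parcs H. (z u + \<sigma> * z v) * (z u + \<sigma> * z v))"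
    by (rule sum_sop_bilinear[OF H \<sigma>2])
  also have "\<dots> \<le> (\<Sum>(u, v)\<in>parcs G. (z u + \<sigma> * z v) * (z u + \<sigma> * z v))"
    using sub(2) finite_parcs[OF G] by (intro sum_mono2) auto
  also have "\<dots> = 2 * (\<Sum>v\<in>pverts G. z v * sop \<sigma> (parcs G) z v)"
    by (rule sum_sop_bilinear[OF G \<sigma>2, symmetric])
  finally have "rad \<sigma> H * (\<Sum>v\<in>pverts G. (z v)\<^sup>2) \<le> (\<Sum>v\<in>pverts G. z v * sop \<sigma> (parcs G) z v)"
    by simp
  moreover have "\<exists>v\<in>pverts G. z v \<noteq> 0" using x(1) sub(1) by (auto simp: z_def)
  ultimately show ?thesis by (intro rad_ge_of_form[OF G \<sigma>])
qed

text \<open>\<open>w k\<close> is the pendant vertex at \<open>p k\<close>. Further edges among all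
  these vertices are allowed, since they can only enlarge the form.\<close>

definition caterpillar_in :: "nat rel \<Rightarrow> nat \<Rightarrow> (nat \<Rightarrow> nat) \<Rightarrow> nat set \<Rightarrow> (nat \<Rightarrow> nat) \<Rightarrow> bool" where
  "caterpillar_in E m p S w \<longleftrightarrow> inj_on p {..m} \<and> (\<forall>k<m. (p k, p (Suc k)) \<in> E) \<and> S \<subseteq> {..m} \<and>
     inj_on w S \<and> (\<forall>k\<in>S. (p k, w k) \<in> E \<and> w k \<notin> p ` {..m})"

text \<open>The value on a pendant vertex that maximizes the contribution of its edge is
  \<open>1 / (\<mu> - 1)\<close> times the value on the path; the signs alternate along the tree.\<close>

lemma rad_ge_caterpillar:
  assumes G: "pair_graph G" and \<sigma>: "\<sigma> \<in> {-1, 1}" and cat: "caterpillar_in (parcs G) m p S w"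
    and "1 \<le> m" and \<mu>: "1 < \<mu>" and z: "\<exists>k\<le>m. z k \<noteq> 0"
    and le: "\<mu> * (\<Sum>k\<le>m. (z k)\<^sup>2) \<le> (\<Sum>k<m. (z k + z (Suc k))\<^sup>2) + (1 + 1 / (\<mu> - 1)) * (\<Sum>k\<in>S. (z k)\<^sup>2)"
  shows "\<mu> \<le> rad \<sigma> G"
proof -
  have p: "inj_on p {..m}" and pE: "\<And>k. k < m \<Longrightarrow> (p k, p (Suc k)) \<in> parcs G"
    and S: "S \<subseteq> {..m}" "inj_on w S" and w: "\<And>k. k \<in> S \<Longrightarrow> (p k, w k) \<in> parcs G"
    "\<And>k. k \<in> S \<Longrightarrow> w k \<notin> p ` {..m}"
    using cat by (auto simp: caterpillar_in_def)
  have finS: "finite S" using S(1) finite_subset by blast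
  define \<beta> where "\<beta> = 1 / (\<mu> - 1)"
  define x where "x v = (if v \<in> p ` {..m} then \<sigma> ^ the_inv_into {..m} p v * z (the_inv_into {..m} p v)
    else if v \<in> w ` S then \<sigma> ^ Suc (the_inv_into S w v) * \<beta> * z (the_inv_into S w v) else 0)" for v
  have xp: "x (p k) = \<sigma> ^ k * z k" if "k \<le> m" for k
    using that p by (simp add: x_def the_inv_into_f_f)
  have xw: "x (w k) = \<sigma> ^ Suc k * \<beta> * z k" if "k \<in> S" for k
    using that w(2) S(2) by (simp add: x_def the_inv_into_f_f)
  have \<sigma>k: "(\<sigma> ^ k)\<^sup>2 = 1" for k using \<sigma> by (auto simp: power_mult[symmetric] power_even_eq)
  have \<sigma>e: "(\<sigma> ^ k * a + \<sigma> * (\<sigma> ^ Suc k * b))\<^sup>2 = (a + b)\<^sup>2" for k a b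
  proof -
    have "\<sigma> ^ k * a + \<sigma> * (\<sigma> ^ Suc k * b) = \<sigma> ^ k * (a + b)"
      using \<sigma> by (auto simp: algebra_simps)
    then show ?thesis by (simp add: power_mult_distrib \<sigma>k)
  qed
  let ?A1 = "(\<lambda>k. (p k, p (Suc k))) ` {..<m}" and ?A2 = "(\<lambda>k. (p k, w k)) ` S"
  have pim: "p k \<in> p ` {..m}" if "k \<le> m" for k using that by auto
  have peq: "p k = p l \<longleftrightarrow> k = l" if "k \<le> m" "l \<le> m" for k l
    using p that by (auto simp: inj_on_def)
  have Sm: "k \<le> m" if "k \<in> S" for k using S that by auto
  show ?thesis
  proof (rule rad_ge_of_edges[OF G \<sigma>, where A = "?A1 \<union> ?A2" and S = "p ` {..m} \<union> w ` S" and z = x])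
    show "?A1 \<union> ?A2 \<subseteq> parcs G" using pE w by auto
    show "(?A1 \<union> ?A2) \<inter> (?A1 \<union> ?A2)\<inverse> = {}"
    proof (rule ccontr)
      assume "\<not> ?thesis"
      then obtain a b where ab: "(a, b) \<in> ?A1 \<union> ?A2" "(b, a) \<in> ?A1 \<union> ?A2" by auto
      have a: "a \<in> p ` {..m}" "b \<in> p ` {..m}" using ab Sm by auto
      moreover have "v \<notin> p ` {..m}" if "(u, v) \<in> ?A2" for u v
        using that by (rule imageE) (simp only: prod.inject w(2) not_False_eq_True)
      ultimately have "(a, b) \<notin> ?A2" "(b, a) \<notin> ?A2" by blast+
      then obtain k l where "k < m" "l < m" "a = p k" "b = p (Suc k)" "b = p l" "a = p (Suc l)"
        using ab by auto
      then show False using peq[of k "Suc l"] peq[of "Suc k" l] by auto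
    qed
    have vE: "p k \<in> pverts G" if "k \<le> m" for k
    proof (cases "k < m")
      case True
      then show ?thesis using arc_fst[OF G pE] by blast
    next
      case False
      then have "k = Suc (m - 1)" "m - 1 < m" using that \<open>1 \<le> m\<close> by auto
      then show ?thesis using arc_snd[OF G pE] by metis
    qed
    show "p ` {..m} \<union> w ` S \<subseteq> pverts G" using vE arc_snd[OF G w(1)] by blast
    show "\<exists>v\<in>p ` {..m} \<union> w ` S. x v \<noteq> 0"
    proof -
      obtain k where "k \<le> m" "z k \<noteq> 0" using z by blast
      then have "x (p k) \<noteq> 0" "p k \<in> p ` {..m}" using xp \<sigma> by auto
      then show ?thesis by blast
    qed
    show "x v = 0" if "v \<notin> p ` {..m} \<union> w ` S" for v using that by (auto simp: x_def)
    have "(\<Sum>v\<in>p ` {..m} \<union> w ` S. (x v)\<^sup>2) = (\<Sum>v\<in>p ` {..m}. (x v)\<^sup>2) + (\<Sum>v\<in>w ` S. (x v)\<^sup>2)"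
    proof (rule sum.union_disjoint)
      have "v \<notin> p ` {..m}" if "v \<in> w ` S" for v
        using that by (rule imageE) (simp only: w(2) not_False_eq_True)
      then show "p ` {..m} \<inter> w ` S = {}" by blast
    qed (use finS in auto)
    also have "(\<Sum>v\<in>p ` {..m}. (x v)\<^sup>2) = (\<Sum>k\<le>m. (z k)\<^sup>2)"
      using xp \<sigma>k by (subst sum.reindex[OF p]) (simp add: power_mult_distrib)
    also have "(\<Sum>v\<in>w ` S. (x v)\<^sup>2) = \<beta>\<^sup>2 * (\<Sum>k\<in>S. (z k)\<^sup>2)"
      unfolding sum_distrib_left using xw \<sigma>k
      by (subst sum.reindex[OF S(2)], intro sum.cong refl)
        (simp only: o_apply power_mult_distrib mult_1)
    finally have 1: "(\<Sum>v\<in>p ` {..m} \<union> w ` S. (x v)\<^sup>2) = (\<Sum>k\<le>m. (z k)\<^sup>2) + \<beta>\<^sup>2 * (\<Sum>k\<in>S. (z k)\<^sup>2)" .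
    have i1: "inj_on (\<lambda>k. (p k, p (Suc k))) {..<m}" and i2: "inj_on (\<lambda>k. (p k, w k)) S"
      using peq Sm by (auto simp: inj_on_def)
    have disj: "?A1 \<inter> ?A2 = {}"
    proof -
      have "b \<in> p ` {..m}" if "(a, b) \<in> ?A1" for a b using that by auto
      moreover have "b \<notin> p ` {..m}" if "(a, b) \<in> ?A2" for a b
        using that by (rule imageE) (simp only: prod.inject w(2) not_False_eq_True)
      ultimately show ?thesis by fast
    qed
    have "(\<Sum>(u, v)\<in>?A1 \<union> ?A2. (x u + \<sigma> * x v)\<^sup>2)
        = (\<Sum>(u, v)\<in>?A1. (x u + \<sigma> * x v)\<^sup>2) + (\<Sum>(u, v)\<in>?A2. (x u + \<sigma> * x v)\<^sup>2)"
      using finS disj by (intro sum.union_disjoint) auto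
    also have "(\<Sum>(u, v)\<in>?A1. (x u + \<sigma> * x v)\<^sup>2) = (\<Sum>k<m. (z k + z (Suc k))\<^sup>2)"
      by (subst sum.reindex[OF i1], intro sum.cong refl)
        (simp only: o_apply prod.case lessThan_iff xp less_imp_le Suc_leI \<sigma>e)
    also have "(\<Sum>(u, v)\<in>?A2. (x u + \<sigma> * x v)\<^sup>2) = (1 + \<beta>)\<^sup>2 * (\<Sum>k\<in>S. (z k)\<^sup>2)"
      unfolding sum_distrib_left
    proof (subst sum.reindex[OF i2], intro sum.cong refl)
      fix k assume k: "k \<in> S"
      have "(x (p k) + \<sigma> * x (w k))\<^sup>2 = (z k + \<beta> * z k)\<^sup>2"
        using \<sigma>e[of k "z k" "\<beta> * z k"] by (simp only: xp[OF Sm[OF k]] xw[OF k] mult.assoc)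
      then show "((\<lambda>(u, v). (x u + \<sigma> * x v)\<^sup>2) \<circ> (\<lambda>k. (p k, w k))) k = (1 + \<beta>)\<^sup>2 * (z k)\<^sup>2"
        by (simp add: power_mult_distrib[symmetric] distrib_right)
    qed
    finally have 2: "(\<Sum>(u, v)\<in>?A1 \<union> ?A2. (x u + \<sigma> * x v)\<^sup>2)
        = (\<Sum>k<m. (z k + z (Suc k))\<^sup>2) + (1 + \<beta>)\<^sup>2 * (\<Sum>k\<in>S. (z k)\<^sup>2)" .
    \<comment> \<open>Since \<open>\<mu> * \<beta> = 1 + \<beta>\<close>, the norm of the pendant
      vertices absorbs everything beyond the factor \<open>1 + \<beta>\<close>.\<close>
    have "(1 + \<beta>)\<^sup>2 = (1 + \<beta>) + \<mu> * \<beta>\<^sup>2"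
      using \<mu> by (simp add: \<beta>_def power2_eq_square divide_simps) (simp add: algebra_simps)
    then show "\<mu> * (\<Sum>v\<in>p ` {..m} \<union> w ` S. (x v)\<^sup>2) \<le> (\<Sum>(u, v)\<in>?A1 \<union> ?A2. (x u + \<sigma> * x v)\<^sup>2)"
      unfolding 1 2 using le unfolding \<beta>_def[symmetric] by (simp add: algebra_simps)
  qed
qed

text \<open>Reduces a fixed forbidden subgraph to arithmetic: \<open>xs\<close> lists its vertices,
  \<open>cs\<close> the test values, and \<open>es\<close> the edges as pairs of positions, each in
  one direction.\<close>

lemma rad_ge_pattern:
  assumes G: "pair_graph G" and \<sigma>: "\<sigma> \<in> {-1, 1}"
    and xs: "distinct xs" "length cs = length xs" "\<exists>c\<in>set cs. c \<noteq> 0"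
    and es: "distinct es" "\<forall>(i, j)\<in>set es. i < length xs \<and> j < length xs \<and> (j, i) \<notin> set es \<and> (xs ! i, xs ! j) \<in> parcs G"
    and V: "set xs \<subseteq> pverts G"
    and le: "\<mu> * (\<Sum>c\<leftarrow>cs. c\<^sup>2) \<le> (\<Sum>(i, j)\<leftarrow>es. (cs ! i + \<sigma> * cs ! j)\<^sup>2)"
  shows "\<mu> \<le> rad \<sigma> G"
proof -
  let ?n = "length xs" and ?f = "\<lambda>i. xs ! i"
  have inj: "inj_on ?f {..<?n}" using xs(1) by (auto simp: inj_on_def nth_eq_iff_index_eq)
  have S: "?f ` {..<?n} = set xs" by (auto simp: set_conv_nth)
  define z where "z v = (if v \<in> set xs then cs ! the_inv_into {..<?n} ?f v else 0)" for v
  have z: "z (xs ! i) = cs ! i" if "i < ?n" for i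
    using the_inv_into_f_f[OF inj, of i] that by (simp add: z_def)
  let ?g = "\<lambda>(i, j). (xs ! i, xs ! j)"
  have injg: "inj_on ?g (set es)"
  proof (rule inj_onI, clarify)
    fix i j k l assume "(i, j) \<in> set es" "(k, l) \<in> set es" "xs ! i = xs ! k" "xs ! j = xs ! l"
    moreover from this es(2) have "i < ?n" "j < ?n" "k < ?n" "l < ?n" by auto
    ultimately show "i = k \<and> j = l" using nth_eq_iff_index_eq[OF xs(1)] by metis
  qed
  show ?thesis
  proof (rule rad_ge_of_edges[OF G \<sigma>, where A = "?g ` set es" and S = "set xs" and z = z])
    show "?g ` set es \<subseteq> parcs G" using es(2) by auto
    show "?g ` set es \<inter> (?g ` set es)\<inverse> = {}"
    proof -
      have False if "(i, j) \<in> set es" "(k, l) \<in> set es" "xs ! i = xs ! l" "xs ! j = xs ! k" for i j k l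
      proof -
        have "i < ?n" "j < ?n" "k < ?n" "l < ?n" "(j, i) \<notin> set es" using es(2) that by auto
        then have "i = l" "j = k" using that xs(1) by (simp_all add: nth_eq_iff_index_eq)
        then show False using that \<open>(j, i) \<notin> set es\<close> by simp
      qed
      then show ?thesis by fastforce
    qed
    show "set xs \<subseteq> pverts G" by (rule V)
    obtain i where "i < ?n" "cs ! i \<noteq> 0" using xs(2,3) by (auto simp: in_set_conv_nth)
    then show "\<exists>v\<in>set xs. z v \<noteq> 0" using z nth_mem by metis
    show "z v = 0" if "v \<notin> set xs" for v using that by (simp add: z_def)
    have "(\<Sum>v\<in>set xs. (z v)\<^sup>2) = (\<Sum>i<?n. (cs ! i)\<^sup>2)"
      unfolding S[symmetric] by (subst sum.reindex[OF inj]) (simp add: z)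
    also have "\<dots> = (\<Sum>c\<leftarrow>cs. c\<^sup>2)"
      using xs(2) by (simp add: sum_list_sum_nth atLeast0LessThan)
    finally have 1: "(\<Sum>v\<in>set xs. (z v)\<^sup>2) = (\<Sum>c\<leftarrow>cs. c\<^sup>2)" .
    have "(\<Sum>(u, v)\<in>?g ` set es. (z u + \<sigma> * z v)\<^sup>2) = (\<Sum>(i, j)\<in>set es. (cs ! i + \<sigma> * cs ! j)\<^sup>2)"
      using es(2) by (subst sum.reindex[OF injg]) (auto simp: z intro!: sum.cong)
    also have "\<dots> = (\<Sum>(i, j)\<leftarrow>es. (cs ! i + \<sigma> * cs ! j)\<^sup>2)"
      by (rule sum.distinct_set_conv_list[OF es(1)])
    finally show "\<mu> * (\<Sum>v\<in>set xs. (z v)\<^sup>2) \<le> (\<Sum>(u, v)\<in>?g ` set es. (z u + \<sigma> * z v)\<^sup>2)"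
      using le 1 by simp
  qed
qed

section \<open>Small forbidden subgraphs\<close>

lemma rad_star4:
  assumes G: "pair_graph G" and \<sigma>: "\<sigma> \<in> {-1, 1}"
    and E: "(c, a1) \<in> parcs G" "(c, a2) \<in> parcs G" "(c, a3) \<in> parcs G" "(c, a4) \<in> parcs G"
    and d: "distinct [c, a1, a2, a3, a4]"
  shows "5 \<le> rad \<sigma> G"
  by (rule rad_ge_pattern[OF G, where xs = "[c, a1, a2, a3, a4]" and cs = "[4, \<sigma>, \<sigma>, \<sigma>, \<sigma>]"
      and es = "[(0, 1), (0, 2), (0, 3), (0, 4)]"])
    (use E d \<sigma> arc_fst[OF G] arc_snd[OF G] in \<open>auto simp: power2_eq_square\<close>)

text \<open>The spider itself has radius \<open>3 + sqrt 2\<close>; the integers approximate its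
  eigenvector. The factor \<open>\<sigma>\<close> sits on one side of the bipartition, so that one
  vector serves both operators.\<close>

lemma rad_spider222:
  assumes G: "pair_graph G" and \<sigma>: "\<sigma> \<in> {-1, 1}"
    and E: "(c, a1) \<in> parcs G" "(c, a2) \<in> parcs G" "(c, a3) \<in> parcs G" "(a1, b1) \<in> parcs G" "(a2, b2) \<in> parcs G" "(a3, b3) \<in> parcs G"
    and d: "distinct [c, a1, a2, a3, b1, b2, b3]"
  shows "4384 / 1000 \<le> rad \<sigma> G"
  by (rule rad_ge_pattern[OF G, where xs = "[c, a1, a2, a3, b1, b2, b3]" and cs = "[36, 17 * \<sigma>, 17 * \<sigma>, 17 * \<sigma>, 5, 5, 5]"
      and es = "[(0, 1), (0, 2), (0, 3), (1, 4), (2, 5), (3, 6)]"])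
    (use E d \<sigma> arc_fst[OF G] arc_snd[OF G] in \<open>auto simp: power2_eq_square\<close>)

lemma rad_banner:
  assumes G: "pair_graph G" and \<sigma>: "\<sigma> \<in> {-1, 1}"
    and E: "(a, b) \<in> parcs G" "(b, c) \<in> parcs G" "(c, d) \<in> parcs G" "(d, a) \<in> parcs G" "(a, e) \<in> parcs G"
    and d: "distinct [a, b, c, d, e]"
  shows "4384 / 1000 \<le> rad \<sigma> G"
  by (rule rad_ge_pattern[OF G, where xs = "[a, b, c, d, e]" and cs = "[5, 3 * \<sigma>, 2, 3 * \<sigma>, \<sigma>]"
      and es = "[(0, 1), (1, 2), (2, 3), (3, 0), (0, 4)]"])
    (use E d \<sigma> arc_fst[OF G] arc_snd[OF G] in \<open>auto simp: power2_eq_square\<close>)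

text \<open>Restricted to the signless Laplacian: the Laplacian radius of the paw is only 4.\<close>

lemma rad_paw:
  assumes G: "pair_graph G"
    and E: "(a, b) \<in> parcs G" "(b, c) \<in> parcs G" "(c, a) \<in> parcs G" "(a, e) \<in> parcs G"
    and d: "distinct [a, b, c, e]"
  shows "4384 / 1000 \<le> rad 1 G"
  by (rule rad_ge_pattern[OF G, where xs = "[a, b, c, e]" and cs = "[5, 3, 3, 1]"
      and es = "[(0, 1), (1, 2), (2, 0), (0, 3)]"])
    (use E d  arc_fst[OF G] arc_snd[OF G] in \<open>auto simp: power2_eq_square\<close>)

text \<open>The Laplacian substitute for the paw: a triangle with a pendant vertex at
  \<open>u\<close> and a path of length two at \<open>v\<close>. The quotient 588/134 is the
  tightest among the forbidden subgraphs.\<close>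

lemma rad_long_bull:
  assumes G: "pair_graph G"
    and E: "(u, v) \<in> parcs G" "(v, w) \<in> parcs G" "(w, u) \<in> parcs G" "(u, z) \<in> parcs G" "(v, a) \<in> parcs G" "(a, b) \<in> parcs G"
    and d: "distinct [u, v, w, z, a, b]"
  shows "4384 / 1000 \<le> rad (-1) G"
  by (rule rad_ge_pattern[OF G, where xs = "[u, v, w, z, a, b]" and cs = "[7, - 8, 0, - 2, 4, - 1]"
      and es = "[(0, 1), (1, 2), (2, 0), (0, 3), (1, 4), (4, 5)]"])
    (use E d  arc_fst[OF G] arc_snd[OF G] in \<open>auto simp: power2_eq_square\<close>)

section \<open>Test functions on caterpillars\<close>

definition cat_form :: "real \<Rightarrow> nat \<Rightarrow> nat set \<Rightarrow> (nat \<Rightarrow> real) \<Rightarrow> real" where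
  "cat_form \<mu> m S z = (\<Sum>k<m. (z k + z (Suc k))\<^sup>2) + (1 + 1 / (\<mu> - 1)) * (\<Sum>k\<in>S. (z k)\<^sup>2) - \<mu> * (\<Sum>k\<le>m. (z k)\<^sup>2)"

text \<open>\<open>cat_form\<close> is the form minus \<open>\<mu>\<close> times the norm, with the
  pendant vertices eliminated. Lowering \<open>\<mu>\<close> by \<open>\<delta>\<close> gains
  \<open>\<delta>\<close> times the norm on the path and only increases the pendant weight
  \<open>1 / (\<mu> - 1)\<close>, so a defect of that size costs at most
  \<open>\<delta>\<close>.\<close>

lemma rad_ge_cat_form:
  assumes G: "pair_graph G" and \<sigma>: "\<sigma> \<in> {-1, 1}" and cat: "caterpillar_in (parcs G) m p S w"
    and "1 \<le> m" and \<mu>: "1 < \<mu> - \<delta>" "0 \<le> \<delta>" and z: "\<exists>k\<le>m. z k \<noteq> 0"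
    and le: "- \<delta> * (\<Sum>k\<le>m. (z k)\<^sup>2) \<le> cat_form \<mu> m S z"
  shows "\<mu> - \<delta> \<le> rad \<sigma> G"
proof (rule rad_ge_caterpillar[OF G \<sigma> cat \<open>1 \<le> m\<close> \<mu>(1) z])
  have "1 / (\<mu> - 1) \<le> 1 / (\<mu> - \<delta> - 1)" using \<mu> by (intro divide_left_mono mult_pos_pos) auto
  then have "(1 + 1 / (\<mu> - 1)) * (\<Sum>k\<in>S. (z k)\<^sup>2) \<le> (1 + 1 / (\<mu> - \<delta> - 1)) * (\<Sum>k\<in>S. (z k)\<^sup>2)"
    by (intro mult_right_mono sum_nonneg) auto
  then show "(\<mu> - \<delta>) * (\<Sum>k\<le>m. (z k)\<^sup>2)
      \<le> (\<Sum>k<m. (z k + z (Suc k))\<^sup>2) + (1 + 1 / (\<mu> - \<delta> - 1)) * (\<Sum>k\<in>S. (z k)\<^sup>2)"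
    using le unfolding cat_form_def by (simp add: left_diff_distrib)
qed

text \<open>A positive surplus leaves room to raise \<open>\<mu>\<close> by some
  \<open>\<eta>\<close>; for \<open>2 \<le> \<mu>\<close> the pendant weight then drops by at most
  \<open>\<eta>\<close>.\<close>

lemma rad_gt_cat_form:
  assumes G: "pair_graph G" and \<sigma>: "\<sigma> \<in> {-1, 1}" and cat: "caterpillar_in (parcs G) m p S w"
    and "1 \<le> m" and \<mu>: "2 \<le> \<mu>" and z: "\<exists>k\<le>m. z k \<noteq> 0"
    and pos: "0 < cat_form \<mu> m S z"
  shows "\<mu> < rad \<sigma> G"
proof -
  define N P where "N = (\<Sum>k\<le>m. (z k)\<^sup>2)" and "P = (\<Sum>k\<in>S. (z k)\<^sup>2)"
  have "0 < N"
  proof -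
    obtain k where "k \<le> m" "z k \<noteq> 0" using z by blast
    then show ?thesis unfolding N_def by (intro sum_pos2[of _ k]) auto
  qed
  have "0 \<le> P" unfolding P_def by (intro sum_nonneg) auto
  \<comment> \<open>Chosen so that the larger multiple of the norm and the smaller pendant weight
    together use up the surplus.\<close>
  define \<eta> where "\<eta> = cat_form \<mu> m S z / (N + P)"
  have \<eta>: "0 < \<eta>" "\<eta> * N + \<eta> * P = cat_form \<mu> m S z"
  proof -
    have "0 < N + P" using \<open>0 < N\<close> \<open>0 \<le> P\<close> by simp
    then show "0 < \<eta>" using pos by (simp add: \<eta>_def)
    have "\<eta> * (N + P) = cat_form \<mu> m S z" using \<open>0 < N + P\<close> by (simp add: \<eta>_def)
    then show "\<eta> * N + \<eta> * P = cat_form \<mu> m S z" by (simp only: distrib_left)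
  qed
  have "\<mu> + \<eta> \<le> rad \<sigma> G"
  proof (rule rad_ge_caterpillar[OF G \<sigma> cat \<open>1 \<le> m\<close> _ z])
    show "1 < \<mu> + \<eta>" using \<mu> \<eta> by simp
    have "1 / (\<mu> - 1) - 1 / (\<mu> + \<eta> - 1) = \<eta> / ((\<mu> - 1) * (\<mu> + \<eta> - 1))"
      using \<mu> \<eta> by (simp add: divide_simps)
    also have "\<dots> \<le> \<eta> / (1 * 1)"
      using \<mu> \<eta> by (intro divide_left_mono mult_mono mult_pos_pos) auto
    finally have "1 / (\<mu> - 1) - \<eta> \<le> 1 / (\<mu> + \<eta> - 1)" by simp
    then have "(1 / (\<mu> - 1) - \<eta>) * P \<le> 1 / (\<mu> + \<eta> - 1) * P" using \<open>0 \<le> P\<close> by (rule mult_right_mono)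
    then show "(\<mu> + \<eta>) * (\<Sum>k\<le>m. (z k)\<^sup>2)
      \<le> (\<Sum>k<m. (z k + z (Suc k))\<^sup>2) + (1 + 1 / (\<mu> + \<eta> - 1)) * (\<Sum>k\<in>S. (z k)\<^sup>2)"
      using \<eta>(2) unfolding cat_form_def N_def[symmetric] P_def[symmetric]
      by (simp add: distrib_right left_diff_distrib)
  qed
  then show ?thesis using \<eta> by simp
qed

text \<open>Summation by parts: for a solution of the recurrence the interior contributions cancel
  and only the two boundary terms survive.\<close>

lemma path_form_telescope:
  fixes z :: "nat \<Rightarrow> real"
  assumes rec: "\<And>k. z k + z (Suc (Suc k)) = T * z (Suc k)"
  shows "(\<Sum>k<n. (z k + z (Suc k))\<^sup>2) - (2 + T) * (\<Sum>k\<le>n. (z k)\<^sup>2)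
    = z 0 * (z 0 + z 1) - (2 + T) * (z 0)\<^sup>2 - z n * (z n + z (Suc n))"
proof (induction n)
  case 0
  then show ?case by (simp add: algebra_simps)
next
  case (Suc n)
  have eq: "z (Suc (Suc n)) = T * z (Suc n) - z n" using rec[of n] by simp
  have "(\<Sum>k<Suc n. (z k + z (Suc k))\<^sup>2) - (2 + T) * (\<Sum>k\<le>Suc n. (z k)\<^sup>2)
    = z 0 * (z 0 + z 1) - (2 + T) * (z 0)\<^sup>2 - z n * (z n + z (Suc n))
      + (z n + z (Suc n))\<^sup>2 - (2 + T) * (z (Suc n))\<^sup>2"
    using Suc.IH by (simp add: distrib_left)
  moreover have "- z n * (z n + z (Suc n)) + (z n + z (Suc n))\<^sup>2 - (2 + T) * (z (Suc n))\<^sup>2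
    = - z (Suc n) * (z (Suc n) + z (Suc (Suc n)))"
    unfolding eq by (simp add: power2_eq_square algebra_simps)
  ultimately show ?case by linarith
qed

lemma geometric_form:
  assumes "0 < s"
  shows "(\<Sum>k<n. (s ^ k + s ^ Suc k)\<^sup>2) - mu s * (\<Sum>k\<le>n. (s ^ k)\<^sup>2)
    = - (1 + 1 / s) - (1 + s) * s ^ (2 * n)"
proof -
  have "s ^ k + s ^ Suc (Suc k) = (s + 1 / s) * s ^ Suc k" for k
    using assms by (simp add: field_simps)
  from path_form_telescope[of "\<lambda>k. s ^ k", OF this, of n]
  have "(\<Sum>k<n. (s ^ k + s ^ Suc k)\<^sup>2) - mu s * (\<Sum>k\<le>n. (s ^ k)\<^sup>2)
    = 1 + s - mu s - s ^ n * (s ^ n + s ^ Suc n)"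
    by (simp add: mu_def add.assoc)
  also have "s ^ n * (s ^ n + s ^ Suc n) = (1 + s) * s ^ (2 * n)"
    unfolding mult_2 power_add by (simp add: algebra_simps)
  finally show ?thesis by (simp add: mu_def)
qed

text \<open>The solution of \<open>z (k - 1) + z (k + 1) = (s + 1/s) z k\<close> matching the equation of the signless
  Laplacian at an end vertex of degree one, which amounts to the virtual value \<open>z (-1) = - z 0\<close>.\<close>

definition hyp :: "real \<Rightarrow> nat \<Rightarrow> real" where
  "hyp s k = (1 / s) ^ k - s ^ Suc k"

lemma hyp_rec: "0 < s \<Longrightarrow> hyp s k + hyp s (Suc (Suc k)) = (s + 1 / s) * hyp s (Suc k)"
  by (simp add: hyp_def field_simps)

lemma hyp_0: "0 < s \<Longrightarrow> hyp s 0 + hyp s 1 = mu s * hyp s 0"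
  by (simp add: hyp_def mu_def field_simps)

lemma hyp_pos: "0 < s \<Longrightarrow> s < 1 \<Longrightarrow> 0 < hyp s k"
proof -
  assume s: "0 < s" "s < 1"
  have "s ^ Suc k < 1" using s by (intro power_Suc_less_one) auto
  also have "1 \<le> (1 / s) ^ k" using s by (intro one_le_power) simp
  finally show ?thesis by (simp add: hyp_def)
qed

lemma mu_minus_1:
  assumes "0 < s"
  shows "1 / (mu s - 1) = s / (1 + s + s\<^sup>2)" "mu s - 1 > 0"
proof -
  have "mu s - 1 = (1 + s + s\<^sup>2) / s" using assms by (simp add: mu_def field_simps power2_eq_square)
  then show "1 / (mu s - 1) = s / (1 + s + s\<^sup>2)" by simp
  show "mu s - 1 > 0" using assms by (simp add: mu_def add_pos_pos)
qed

text \<open>The first factor is the amount by which the equation at position \<open>l\<close> fails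
  when a pendant vertex is attached there and the path continues with decay \<open>s\<close>. It
  vanishes for \<open>psi l s = 1\<close>, which yields the eigenfunction \<open>xi_vec\<close>, and
  for \<open>s < 1\<close> it is positive when \<open>psi l s < 1\<close>, which yields
  supersolutions.\<close>

lemma hyp_psi:
  assumes s: "0 < s"
  shows "(hyp s (Suc l) - hyp s l * (1 + s + 1 / (mu s - 1))) * ((1 + s + s\<^sup>2) * s ^ Suc l) = (1 - s\<^sup>2) * (1 - psi l s)"
proof -
  define u where "u = s ^ l"
  have u: "u > 0" using s by (simp add: u_def)
  have q: "1 + s + s\<^sup>2 > 0" using s by (simp add: add_pos_pos)
  have h: "hyp s (Suc l) = 1 / (u * s) - u * s\<^sup>2" "hyp s l = 1 / u - u * s"
    using s by (simp_all add: hyp_def u_def power2_eq_square power_one_over)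
  have ps: "(1 - s) * psi l s = (1 + s) * s\<^sup>2 * (1 - u\<^sup>2)"
    unfolding psi_closed u_def by (simp add: power_mult[symmetric] mult.commute)
  have "(hyp s (Suc l) - hyp s l * (1 + s + 1 / (mu s - 1))) * ((1 + s + s\<^sup>2) * s ^ Suc l)
      = (hyp s (Suc l) * (1 + s + s\<^sup>2) - hyp s l * ((1 + s) * (1 + s + s\<^sup>2) + s)) * (u * s)"
    unfolding mu_minus_1(1)[OF s] using q by (simp add: u_def field_simps)
  also have "\<dots> = (1 - u\<^sup>2 * s ^ 3) * (1 + s + s\<^sup>2) - (1 - u\<^sup>2 * s) * s * ((1 + s) * (1 + s + s\<^sup>2) + s)"
  proof -
    have a: "hyp s (Suc l) * (u * s) = 1 - u\<^sup>2 * s ^ 3" "hyp s l * (u * s) = (1 - u\<^sup>2 * s) * s"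
      unfolding h using u s by (simp_all add: field_simps power2_eq_square power3_eq_cube)
    have "(x * c - y * d) * e = (x * e) * c - (y * e) * d" for x y c d e :: real by (simp add: algebra_simps)
    then show ?thesis unfolding a[symmetric] by simp
  qed
  also have "\<dots> = (1 + s) * ((1 - s) - (1 + s) * s\<^sup>2 * (1 - u\<^sup>2))"
    by (simp add: power2_eq_square power3_eq_cube algebra_simps)
  also have "\<dots> = (1 + s) * ((1 - s) - (1 - s) * psi l s)" unfolding ps ..
  also have "\<dots> = (1 - s\<^sup>2) * (1 - psi l s)" by (simp add: power2_eq_square algebra_simps)
  finally show ?thesis .
qed

text \<open>Eigenfunction of the infinite tree: a path with one end, and a pendant vertex at position \<open>n\<close>.\<close>

definition xi_vec :: "nat \<Rightarrow> nat \<Rightarrow> real" where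
  "xi_vec n k = (if k \<le> n then hyp (sroot n) k else hyp (sroot n) n * sroot n ^ (k - n))"

lemma xi_vec_pos: "1 \<le> n \<Longrightarrow> 0 < xi_vec n k"
  using hyp_pos[OF sroot_pos sroot_less_1] sroot_pos by (simp add: xi_vec_def)

text \<open>All equations of the infinite tree hold exactly, so cutting the path at
  \<open>n + r\<close> leaves only the boundary term at the cut.\<close>

lemma xi_vec_form:
  assumes n: "1 \<le> n"
  shows "cat_form (xi n) (n + r) {n} (xi_vec n) = - ((1 + sroot n) * sroot n ^ (2 * r) * (xi_vec n n)\<^sup>2)"
proof -
  define s where "s = sroot n"
  have s: "0 < s" "s < 1" using sroot_pos sroot_less_1[OF n] by (auto simp: s_def)
  let ?z = "xi_vec n"
  have zl: "?z k = hyp s k" if "k \<le> n" for k using that by (simp add: xi_vec_def s_def)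
  have zr: "?z (n + j) = hyp s n * s ^ j" for j by (simp add: xi_vec_def s_def)
  \<comment> \<open>The equation at the branching vertex, where the solution changes from
    \<open>hyp\<close> to pure decay.\<close>
  have center: "hyp s (Suc n) = hyp s n * (1 + s + 1 / (mu s - 1))"
  proof -
    have "(1 + s + s\<^sup>2) * s ^ Suc n > 0" using s by (intro mult_pos_pos add_pos_pos) auto
    then have nz: "(1 + s + s\<^sup>2) * s ^ Suc n \<noteq> 0" by (metis less_irrefl)
    have "psi n s = 1" unfolding s_def by (rule sroot_props(2)[OF n])
    then have "(hyp s (Suc n) - hyp s n * (1 + s + 1 / (mu s - 1))) * ((1 + s + s\<^sup>2) * s ^ Suc n) = 0"
      by (simp only: hyp_psi[OF s(1)] diff_self mult_zero_right)
    from mult_eq_0_iff[THEN iffD1, OF this] nz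
    have "hyp s (Suc n) - hyp s n * (1 + s + 1 / (mu s - 1)) = 0" by blast
    then show ?thesis by simp
  qed
  have split1: "(\<Sum>k<n + r. (?z k + ?z (Suc k))\<^sup>2)
      = (\<Sum>k<n. (hyp s k + hyp s (Suc k))\<^sup>2) + (hyp s n)\<^sup>2 * (\<Sum>j<r. (s ^ j + s ^ Suc j)\<^sup>2)"
  proof -
    have "(\<Sum>k<n + r. (?z k + ?z (Suc k))\<^sup>2)
        = (\<Sum>k<n. (?z k + ?z (Suc k))\<^sup>2) + (\<Sum>j<r. (?z (n + j) + ?z (n + Suc j))\<^sup>2)"
      by (induction r) (simp_all add: add.assoc)
    also have "(\<Sum>j<r. (?z (n + j) + ?z (n + Suc j))\<^sup>2) = (hyp s n)\<^sup>2 * (\<Sum>j<r. (s ^ j + s ^ Suc j)\<^sup>2)"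
      unfolding sum_distrib_left power_mult_distrib[symmetric] zr by (simp only: distrib_left)
    also have "(\<Sum>k<n. (?z k + ?z (Suc k))\<^sup>2) = (\<Sum>k<n. (hyp s k + hyp s (Suc k))\<^sup>2)"
      by (intro sum.cong) (auto simp: zl)
    finally show ?thesis .
  qed
  have split2: "(\<Sum>k\<le>n + r. (?z k)\<^sup>2)
      = (\<Sum>k\<le>n. (hyp s k)\<^sup>2) + (hyp s n)\<^sup>2 * (\<Sum>j\<le>r. (s ^ j)\<^sup>2) - (hyp s n)\<^sup>2"
  proof -
    have "(\<Sum>k\<le>n + r. (?z k)\<^sup>2) = (\<Sum>k\<le>n. (?z k)\<^sup>2) + (\<Sum>j\<le>r. (?z (n + j))\<^sup>2) - (?z n)\<^sup>2"
      by (induction r) simp_all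
    also have "(\<Sum>j\<le>r. (?z (n + j))\<^sup>2) = (hyp s n)\<^sup>2 * (\<Sum>j\<le>r. (s ^ j)\<^sup>2)"
      unfolding sum_distrib_left zr by (simp only: power_mult_distrib)
    also have "(\<Sum>k\<le>n. (?z k)\<^sup>2) = (\<Sum>k\<le>n. (hyp s k)\<^sup>2)"
      by (intro sum.cong) (auto simp: zl)
    finally show ?thesis using zl[of n] by simp
  qed
  have left: "(\<Sum>k<n. (hyp s k + hyp s (Suc k))\<^sup>2) - mu s * (\<Sum>k\<le>n. (hyp s k)\<^sup>2)
      = - hyp s n * (hyp s n + hyp s (Suc n))"
    using path_form_telescope[of "hyp s", OF hyp_rec[OF s(1)], of n] hyp_0[OF s(1)]
    by (simp add: mu_def add.assoc power2_eq_square)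
  have "cat_form (mu s) (n + r) {n} ?z
      = ((\<Sum>k<n. (hyp s k + hyp s (Suc k))\<^sup>2) - mu s * (\<Sum>k\<le>n. (hyp s k)\<^sup>2))
        + (hyp s n)\<^sup>2 * ((\<Sum>j<r. (s ^ j + s ^ Suc j)\<^sup>2) - mu s * (\<Sum>j\<le>r. (s ^ j)\<^sup>2))
        + (1 + 1 / (mu s - 1) + mu s) * (hyp s n)\<^sup>2"
    unfolding cat_form_def split1 split2 using zl[of n] by (simp add: algebra_simps)
  also have "\<dots> = - ((1 + s) * s ^ (2 * r) * (hyp s n)\<^sup>2)
      + hyp s n * (hyp s n * (- 1 - (1 + s + 1 / (mu s - 1)) - (1 + 1 / s) + (1 + 1 / (mu s - 1) + mu s)))"
    unfolding left geometric_form[OF s(1)] center by (simp add: power2_eq_square algebra_simps)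
  also have "- 1 - (1 + s + 1 / (mu s - 1)) - (1 + 1 / s) + (1 + 1 / (mu s - 1) + mu s) = 0"
    by (simp add: mu_def)
  finally show ?thesis using zl[of n] by (simp add: xi_eq_mu s_def)
qed

text \<open>Already the first term of \<open>psi n\<close> is at most 1, and this term is a
  square.\<close>

lemma sroot_small:
  assumes "1 \<le> n"
  shows "(1 + sroot n) * sroot n \<le> 1"
proof -
  have "psi 1 (sroot n) \<le> 1"
    using psi_mono[of "sroot n" 1 n] sroot_props[OF assms] assms by simp
  then have "((1 + sroot n) * sroot n)\<^sup>2 \<le> 1\<^sup>2" by (simp add: psi_def power_mult_distrib)
  then show ?thesis by (rule power2_le_imp_le) simp
qed

lemma xi_ge_4: "4 \<le> xi n"
  using strict_mono_less_eq[OF strict_mono_xi, of 0 n] xi_0 by simp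

lemma caterpillar_in_subset:
  assumes "caterpillar_in E m p T w" "S \<subseteq> T"
  shows "caterpillar_in E m p S w"
  using assms inj_on_subset by (auto simp: caterpillar_in_def)

text \<open>The loss at the cut is at most \<open>2 * sroot n ^ (2 * r)\<close> times the norm,
  because the value at \<open>n\<close> occurs in the norm.\<close>

lemma rad_ge_xi:
  assumes G: "pair_graph G" and \<sigma>: "\<sigma> \<in> {-1, 1}" and cat: "caterpillar_in (parcs G) (n + r) p S w"
    and n: "1 \<le> n" and "n \<in> S" "1 \<le> r"
  shows "xi n - 2 * sroot n ^ (2 * r) \<le> rad \<sigma> G"
proof (rule rad_ge_cat_form[OF G \<sigma> caterpillar_in_subset[OF cat, of "{n}"], where z = "xi_vec n"])
  let ?s = "sroot n"
  have s: "0 < ?s" "?s < 1" using sroot_pos sroot_less_1[OF n] by auto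
  have "?s ^ (2 * r) \<le> 1" using s by (intro power_le_one) auto
  then show "1 < xi n - 2 * ?s ^ (2 * r)" using xi_ge_4[of n] by simp
  show "0 \<le> 2 * ?s ^ (2 * r)" using s by simp
  have "(1 + ?s) * ?s ^ (2 * r) * (xi_vec n n)\<^sup>2 \<le> 2 * ?s ^ (2 * r) * (\<Sum>k\<le>n + r. (xi_vec n k)\<^sup>2)"
    using s by (intro mult_mono member_le_sum) auto
  then show "- (2 * ?s ^ (2 * r)) * (\<Sum>k\<le>n + r. (xi_vec n k)\<^sup>2) \<le> cat_form (xi n) (n + r) {n} (xi_vec n)"
    unfolding xi_vec_form[OF n] by simp
  show "\<exists>k\<le>n + r. xi_vec n k \<noteq> 0" using xi_vec_pos[OF n, of 0] by (intro exI[of _ 0]) auto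
qed (use assms in auto)

text \<open>A second pendant vertex at distance \<open>n\<close> from the other end more than pays
  for the truncation. The strict inequality keeps the approximating radii away from their
  limit.\<close>

lemma rad_gt_xi:
  assumes G: "pair_graph G" and \<sigma>: "\<sigma> \<in> {-1, 1}" and cat: "caterpillar_in (parcs G) (n + r) p {n, r} w"
    and n: "1 \<le> n" and "n < r"
  shows "xi n < rad \<sigma> G"
proof (rule rad_gt_cat_form[OF G \<sigma> cat, where z = "xi_vec n"])
  let ?s = "sroot n"
  have s: "0 < ?s" "?s < 1" using sroot_pos sroot_less_1[OF n] by auto
  have mu: "1 < xi n" using xi_ge_4[of n] by simp
  \<comment> \<open>Loss at the cut against gain at \<open>r\<close>: since
    \<open>(1 + s) * s \<le> 1\<close>, the loss has exponent at least \<open>2 * r - 1\<close>,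
    which exceeds \<open>2 * (r - n)\<close> because \<open>1 \<le> n\<close>.\<close>
  have "(1 + ?s) * ?s ^ (2 * r) = ((1 + ?s) * ?s) * ?s ^ (2 * r - 1)"
    using \<open>n < r\<close> by (simp add: power_eq_if)
  also have "\<dots> \<le> 1 * ?s ^ (2 * r - 1)" using s sroot_small[OF n] by (intro mult_right_mono) auto
  also have "\<dots> < ?s ^ (2 * (r - n))"
    using s n \<open>n < r\<close> by (simp add: power_strict_decreasing)
  finally have lt: "(1 + ?s) * ?s ^ (2 * r) < ?s ^ (2 * (r - n))" .
  have xr: "xi_vec n r = xi_vec n n * ?s ^ (r - n)" using \<open>n < r\<close> by (simp add: xi_vec_def)
  have "0 < (?s ^ (2 * (r - n)) - (1 + ?s) * ?s ^ (2 * r)) * (xi_vec n n)\<^sup>2"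
    using lt xi_vec_pos[OF n, of n] by simp
  also have "\<dots> = cat_form (xi n) (n + r) {n} (xi_vec n) + (xi_vec n r)\<^sup>2"
    unfolding xi_vec_form[OF n] xr by (simp add: power_mult_distrib power_mult[symmetric] algebra_simps)
  also have "\<dots> \<le> cat_form (xi n) (n + r) {n} (xi_vec n) + (1 + 1 / (xi n - 1)) * (xi_vec n r)\<^sup>2"
    using mu by (simp add: mult_le_cancel_right1)
  also have "\<dots> = cat_form (xi n) (n + r) {n, r} (xi_vec n)"
    using \<open>n < r\<close> by (simp add: cat_form_def algebra_simps)
  finally show "0 < cat_form (xi n) (n + r) {n, r} (xi_vec n)" .
  show "\<exists>k\<le>n + r. xi_vec n k \<noteq> 0" using xi_vec_pos[OF n, of 0] by (intro exI[of _ 0]) auto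
qed (use assms xi_ge_4[of n] in auto)

text \<open>The pendant weight is \<open>s / (1 + s + s\<^sup>2)\<close> in general, and the cubic
  makes the denominator \<open>1 / tau\<close>.\<close>

lemma tau_pendant: "1 / (mu tau - 1) = tau\<^sup>2"
proof -
  have "tau * (1 + tau + tau\<^sup>2) = 1" using tau(3) by (simp add: power2_eq_square power3_eq_cube algebra_simps)
  then have "tau / (1 + tau + tau\<^sup>2) = tau * (tau * (1 + tau + tau\<^sup>2)) / (1 + tau + tau\<^sup>2)" by simp
  also have "\<dots> = tau\<^sup>2"
  proof -
    have "1 + tau + tau\<^sup>2 > 0" using tau(1) by (simp add: add_pos_pos)
    then show ?thesis by (simp add: power2_eq_square)
  qed
  finally show ?thesis using mu_minus_1(1)[OF tau(1)] by simp
qed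

text \<open>On the doubly infinite path with one pendant vertex the eigenfunction decays symmetrically.\<close>

definition tau_vec :: "nat \<Rightarrow> nat \<Rightarrow> real" where
  "tau_vec c k = tau ^ (if k \<le> c then c - k else k - c)"

text \<open>Two geometric halves glued at \<open>c\<close>: the equation at \<open>c\<close> is the
  cubic of \<open>tau\<close>, and each cut contributes one boundary term.\<close>

lemma tau_vec_form:
  "cat_form (2 + epsilon) (c + r) {c} (tau_vec c) = - ((1 + tau) * (tau ^ (2 * c) + tau ^ (2 * r)))"
proof -
  let ?z = "tau_vec c" and ?s = tau
  have zl: "?z (c - k) = ?s ^ k" if "k \<le> c" for k using that by (simp add: tau_vec_def)
  have zr: "?z (c + j) = ?s ^ j" for j by (simp add: tau_vec_def)
  have "(\<Sum>k<c + r. (?z k + ?z (Suc k))\<^sup>2)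
      = (\<Sum>k<c. (?z k + ?z (Suc k))\<^sup>2) + (\<Sum>j<r. (?z (c + j) + ?z (c + Suc j))\<^sup>2)"
    by (induction r) (simp_all add: add.assoc)
  also have "(\<Sum>k<c. (?z k + ?z (Suc k))\<^sup>2) = (\<Sum>k<c. (?s ^ k + ?s ^ Suc k)\<^sup>2)"
    by (rule sum.reindex_bij_witness[of _ "\<lambda>k. c - Suc k" "\<lambda>k. c - Suc k"])
      (auto simp: tau_vec_def Suc_diff_Suc add.commute)
  finally have 1: "(\<Sum>k<c + r. (?z k + ?z (Suc k))\<^sup>2)
      = (\<Sum>k<c. (?s ^ k + ?s ^ Suc k)\<^sup>2) + (\<Sum>j<r. (?s ^ j + ?s ^ Suc j)\<^sup>2)"
    unfolding zr .
  have "(\<Sum>k\<le>c + r. (?z k)\<^sup>2) = (\<Sum>k\<le>c. (?z k)\<^sup>2) + (\<Sum>j\<le>r. (?z (c + j))\<^sup>2) - (?z c)\<^sup>2"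
    by (induction r) simp_all
  also have "(\<Sum>k\<le>c. (?z k)\<^sup>2) = (\<Sum>k\<le>c. (?s ^ k)\<^sup>2)"
    by (rule sum.reindex_bij_witness[of _ "\<lambda>k. c - k" "\<lambda>k. c - k"]) (auto simp: tau_vec_def)
  finally have 2: "(\<Sum>k\<le>c + r. (?z k)\<^sup>2) = (\<Sum>k\<le>c. (?s ^ k)\<^sup>2) + (\<Sum>j\<le>r. (?s ^ j)\<^sup>2) - 1"
    unfolding zr by (simp add: tau_vec_def)
  have "cat_form (mu ?s) (c + r) {c} ?z
      = ((\<Sum>k<c. (?s ^ k + ?s ^ Suc k)\<^sup>2) - mu ?s * (\<Sum>k\<le>c. (?s ^ k)\<^sup>2))
      + ((\<Sum>k<r. (?s ^ k + ?s ^ Suc k)\<^sup>2) - mu ?s * (\<Sum>k\<le>r. (?s ^ k)\<^sup>2)) + mu ?s + 1 + tau\<^sup>2"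
    unfolding cat_form_def 1 2 tau_pendant by (simp add: tau_vec_def algebra_simps)
  also have "\<dots> = - ((1 + tau) * (tau ^ (2 * c) + tau ^ (2 * r))) + (tau - 1 / tau + 1 + tau\<^sup>2)"
    unfolding geometric_form[OF tau(1)] by (simp add: mu_def algebra_simps)
  also have "tau - 1 / tau + 1 + tau\<^sup>2 = (tau ^ 3 + tau\<^sup>2 + tau - 1) / tau"
    using tau(1) by (simp add: field_simps power2_eq_square power3_eq_cube)
  finally show ?thesis using tau(3) by (simp add: epsilon_eq)
qed

lemma tau_vec_sum_ge_1: "1 \<le> (\<Sum>k\<le>c + r. (tau_vec c k)\<^sup>2)"
proof -
  have "(tau_vec c c)\<^sup>2 \<le> (\<Sum>k\<le>c + r. (tau_vec c k)\<^sup>2)" by (intro member_le_sum) auto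
  then show ?thesis by (simp add: tau_vec_def)
qed

lemma tau_power_le: "1 \<le> r \<Longrightarrow> (1 + tau) * tau ^ (2 * r) \<le> 1"
proof -
  assume "1 \<le> r"
  then have "tau ^ (2 * r) \<le> tau ^ 2" using tau by (intro power_decreasing) auto
  then have "(1 + tau) * tau ^ (2 * r) \<le> (1 + tau) * tau\<^sup>2" using tau by (intro mult_left_mono) auto
  also have "\<dots> = 1 - tau" using tau(3) by (simp add: power2_eq_square power3_eq_cube algebra_simps)
  finally show ?thesis using tau by simp
qed

lemma two_plus_epsilon_ge_4: "4 < 2 + epsilon"
  using xi_less[of 0] xi_0 by simp

lemma rad_ge_pendant_in_middle:
  assumes G: "pair_graph G" and \<sigma>: "\<sigma> \<in> {-1, 1}" and cat: "caterpillar_in (parcs G) (c + r) p S w"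
    and "c \<in> S" "1 \<le> c" "1 \<le> r"
  shows "2 + epsilon - 2 * (tau ^ (2 * c) + tau ^ (2 * r)) \<le> rad \<sigma> G"
proof (rule order_trans)
  let ?d = "(1 + tau) * (tau ^ (2 * c) + tau ^ (2 * r))"
  show "2 + epsilon - 2 * (tau ^ (2 * c) + tau ^ (2 * r)) \<le> 2 + epsilon - ?d"
    using tau by (intro diff_left_mono mult_right_mono) auto
  show "2 + epsilon - ?d \<le> rad \<sigma> G"
  proof (rule rad_ge_cat_form[OF G \<sigma> caterpillar_in_subset[OF cat, of "{c}"], where z = "tau_vec c"])
    show "1 < 2 + epsilon - ?d"
      using tau_power_le[OF \<open>1 \<le> c\<close>] tau_power_le[OF \<open>1 \<le> r\<close>] two_plus_epsilon_ge_4
      by (simp add: distrib_left)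
    show d: "0 \<le> ?d" using tau by simp
    show "- ?d * (\<Sum>k\<le>c + r. (tau_vec c k)\<^sup>2) \<le> cat_form (2 + epsilon) (c + r) {c} (tau_vec c)"
      unfolding tau_vec_form using mult_left_mono[OF tau_vec_sum_ge_1 d, of c r] by simp
    show "\<exists>k\<le>c + r. tau_vec c k \<noteq> 0" by (intro exI[of _ c]) (simp add: tau_vec_def)
  qed (use assms in auto)
qed

text \<open>However near \<open>c\<close> is to the end at 0, the pendant vertex at \<open>q\<close>
  pays for the boundary term there. Only the distance \<open>r\<close> to the other end remains in
  the bound.\<close>

lemma rad_ge_two_pendants:
  assumes G: "pair_graph G" and \<sigma>: "\<sigma> \<in> {-1, 1}" and cat: "caterpillar_in (parcs G) (c + r) p {q, c} w"
    and "1 \<le> q" "q < c" "1 \<le> r"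
  shows "2 + epsilon - 2 * tau ^ (2 * r) \<le> rad \<sigma> G"
proof (rule order_trans)
  let ?d = "(1 + tau) * tau ^ (2 * r)"
  show "2 + epsilon - 2 * tau ^ (2 * r) \<le> 2 + epsilon - ?d"
    using tau by (intro diff_left_mono mult_right_mono) auto
  show "2 + epsilon - ?d \<le> rad \<sigma> G"
  proof (rule rad_ge_cat_form[OF G \<sigma> cat, where z = "tau_vec c"])
    show "1 < 2 + epsilon - ?d"
      using tau_power_le[OF \<open>1 \<le> r\<close>] two_plus_epsilon_ge_4 by simp
    show d: "0 \<le> ?d" using tau by simp
    have "(1 + tau) * tau ^ (2 * c) = tau ^ (2 * (c - q)) * ((1 + tau) * tau ^ (2 * q))"
    proof -
      have "2 * c = 2 * (c - q) + 2 * q" using \<open>q < c\<close> by simp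
      then have "tau ^ (2 * c) = tau ^ (2 * (c - q)) * tau ^ (2 * q)" by (metis power_add)
      then show ?thesis by simp
    qed
    also have "\<dots> \<le> tau ^ (2 * (c - q)) * 1"
      using tau tau_power_le[OF \<open>1 \<le> q\<close>] by (intro mult_left_mono) auto
    also have "\<dots> = (tau_vec c q)\<^sup>2" using \<open>q < c\<close> by (simp add: tau_vec_def power_mult[symmetric] mult.commute)
    also have "\<dots> \<le> (1 + 1 / (2 + epsilon - 1)) * (tau_vec c q)\<^sup>2"
      using epsilon_cubic(1) by (simp add: mult_le_cancel_right1)
    finally have "(1 + tau) * tau ^ (2 * c) \<le> (1 + 1 / (2 + epsilon - 1)) * (tau_vec c q)\<^sup>2" .
    moreover have "cat_form (2 + epsilon) (c + r) {q, c} (tau_vec c)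
        = cat_form (2 + epsilon) (c + r) {c} (tau_vec c) + (1 + 1 / (2 + epsilon - 1)) * (tau_vec c q)\<^sup>2"
      using \<open>q < c\<close> by (simp add: cat_form_def algebra_simps)
    ultimately have "- ?d \<le> cat_form (2 + epsilon) (c + r) {q, c} (tau_vec c)"
      unfolding tau_vec_form by (simp add: distrib_left)
    then show "- ?d * (\<Sum>k\<le>c + r. (tau_vec c k)\<^sup>2) \<le> cat_form (2 + epsilon) (c + r) {q, c} (tau_vec c)"
      using mult_left_mono[OF tau_vec_sum_ge_1 d, of c r] by simp
    show "\<exists>k\<le>c + r. tau_vec c k \<noteq> 0" by (intro exI[of _ c]) (simp add: tau_vec_def)
  qed (use assms in auto)
qed

text \<open>The constant function has Rayleigh quotient \<open>4 * m / (m + 1)\<close>.\<close>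

lemma rad_ge_path:
  assumes G: "pair_graph G" and \<sigma>: "\<sigma> \<in> {-1, 1}" and cat: "caterpillar_in (parcs G) m p {} w" and "1 \<le> m"
  shows "4 - 4 / (real m + 1) \<le> rad \<sigma> G"
proof (rule rad_ge_cat_form[OF G \<sigma> cat \<open>1 \<le> m\<close>, where z = "\<lambda>_. 1"])
  have "4 / (real m + 1) \<le> 4 / 2" using \<open>1 \<le> m\<close> by (intro divide_left_mono) auto
  then show "1 < 4 - 4 / (real m + 1)" by simp
  show "- (4 / (real m + 1)) * (\<Sum>k\<le>m. 1\<^sup>2) \<le> cat_form 4 m {} (\<lambda>_. 1)"
    by (simp add: cat_form_def divide_simps)
qed auto

section \<open>Upper bounds for caterpillars\<close>

text \<open>Unlike \<open>caterpillar_in\<close>, this describes the whole graph, not a subgraph.\<close>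

definition caterpillar :: "nat pair_pre_digraph \<Rightarrow> nat \<Rightarrow> (nat \<Rightarrow> nat) \<Rightarrow> nat set \<Rightarrow> bool" where
  "caterpillar G m p S \<longleftrightarrow> inj_on p {..m} \<and> p ` {..m} \<subseteq> pverts G \<and>
     (\<forall>k<m. (p k, p (Suc k)) \<in> parcs G) \<and>
     (\<forall>k\<le>m. \<forall>l\<le>m. (p k, p l) \<in> parcs G \<longrightarrow> l = Suc k \<or> k = Suc l) \<and>
     (\<forall>w\<in>pverts G - p ` {..m}. \<exists>k\<in>S. parcs G `` {w} = {p k}) \<and>
     (\<forall>k\<le>m. card (parcs G `` {p k} - p ` {..m}) \<le> 1) \<and>
     S = {k. k \<le> m \<and> parcs G `` {p k} - p ` {..m} \<noteq> {}}"

lemma caterpillarD: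
  assumes "caterpillar G m p S"
  shows "inj_on p {..m}" "p ` {..m} \<subseteq> pverts G" "\<forall>k<m. (p k, p (Suc k)) \<in> parcs G"
    "\<forall>k\<le>m. \<forall>l\<le>m. (p k, p l) \<in> parcs G \<longrightarrow> l = Suc k \<or> k = Suc l"
    "\<forall>w\<in>pverts G - p ` {..m}. \<exists>k\<in>S. parcs G `` {w} = {p k}"
    "\<forall>k\<le>m. card (parcs G `` {p k} - p ` {..m}) \<le> 1"
    "S = {k. k \<le> m \<and> parcs G `` {p k} - p ` {..m} \<noteq> {}}"
  using assms unfolding caterpillar_def by - (elim conjE, assumption)+

lemma image_reverse: "(\<lambda>k. p (m - k)) ` {..m::nat} = p ` {..m}"
proof -
  have "(\<lambda>k. m - k) ` {..m} = {..m}"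
  proof safe
    fix k assume "k \<le> m"
    then show "k \<in> (\<lambda>k. m - k) ` {..m}" by (intro image_eqI[of _ _ "m - k"]) auto
  qed auto
  then show ?thesis by (metis image_image)
qed

lemma inj_on_reverse: "inj_on p {..m::nat} \<Longrightarrow> inj_on (\<lambda>k. p (m - k)) {..m}"
  unfolding inj_on_def by (metis atMost_iff diff_diff_cancel diff_le_self)

lemma caterpillar_reverse:
  assumes G: "pair_graph G" and cat: "caterpillar G m p S"
  shows "caterpillar G m (\<lambda>k. p (m - k)) ((-) m ` S)"
proof -
  note p = caterpillarD(1,2)[OF cat] and S = caterpillarD(7)[OF cat]
  have e: "\<And>k. k < m \<Longrightarrow> (p k, p (Suc k)) \<in> parcs G"
    and nc: "\<And>k l. k \<le> m \<Longrightarrow> l \<le> m \<Longrightarrow> (p k, p l) \<in> parcs G \<Longrightarrow> l = Suc k \<or> k = Suc l"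
    and w: "\<And>w. w \<in> pverts G - p ` {..m} \<Longrightarrow> \<exists>k\<in>S. parcs G `` {w} = {p k}"
    and c: "\<And>k. k \<le> m \<Longrightarrow> card (parcs G `` {p k} - p ` {..m}) \<le> 1"
    using caterpillarD(3-6)[OF cat] by simp_all
  have 1: "(p (m - k), p (m - Suc k)) \<in> parcs G" if "k < m" for k
    using arc_sym[OF G e[of "m - Suc k"]] that by (simp add: Suc_diff_Suc)
  have 2: "l = Suc k \<or> k = Suc l" if "k \<le> m" "l \<le> m" "(p (m - k), p (m - l)) \<in> parcs G" for k l
    using nc[of "m - k" "m - l"] that by auto
  have 3: "\<exists>k\<in>(-) m ` S. parcs G `` {v} = {p (m - k)}" if v: "v \<in> pverts G - p ` {..m}" for v
  proof -
    obtain k where k: "k \<in> S" "parcs G `` {v} = {p k}" using w[OF v] by blast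
    then have "m - (m - k) = k" using S by auto
    then show ?thesis using k by (intro bexI[of _ "m - k"]) auto
  qed
  have 4: "(-) m ` S = {k. k \<le> m \<and> parcs G `` {p (m - k)} - p ` {..m} \<noteq> {}}"
  proof (rule subset_antisym; rule subsetI)
    fix k assume "k \<in> (-) m ` S"
    then show "k \<in> {k. k \<le> m \<and> parcs G `` {p (m - k)} - p ` {..m} \<noteq> {}}" using S by auto
  next
    fix k assume k: "k \<in> {k. k \<le> m \<and> parcs G `` {p (m - k)} - p ` {..m} \<noteq> {}}"
    then have "m - k \<in> S" using S by auto
    then show "k \<in> (-) m ` S" using k by (intro image_eqI[of _ _ "m - k"]) auto
  qed
  have "inj_on (\<lambda>k. p (m - k)) {..m}" by (rule inj_on_reverse[OF p(1)])
  moreover have "\<forall>k<m. (p (m - k), p (m - Suc k)) \<in> parcs G" using 1 by blast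
  moreover have "\<forall>k\<le>m. \<forall>l\<le>m. (p (m - k), p (m - l)) \<in> parcs G \<longrightarrow> l = Suc k \<or> k = Suc l"
    using 2 by blast
  moreover have "\<forall>v\<in>pverts G - p ` {..m}. \<exists>k\<in>(-) m ` S. parcs G `` {v} = {p (m - k)}"
    using 3 by blast
  moreover have "\<forall>k\<le>m. card (parcs G `` {p (m - k)} - p ` {..m}) \<le> 1"
    using c[OF diff_le_self] by blast
  ultimately show ?thesis
    using p(2) 4 unfolding caterpillar_def image_reverse by (intro conjI) assumption+
qed

lemma sum_path_neighbours_le:
  assumes G: "pair_graph G" and cat: "caterpillar G m p S" and k: "k \<le> m"
    and pos: "\<And>v. v \<in> pverts G \<Longrightarrow> 0 < (y v :: real)"
  shows "(\<Sum>u\<in>parcs G `` {p k} \<inter> p ` {..m}. y (p k) + y u)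
    \<le> (if 0 < k then y (p k) + y (p (k - 1)) else 0) + (if k < m then y (p k) + y (p (Suc k)) else 0)"
proof -
  let ?N = "parcs G `` {p k}" and ?P = "p ` {..m}" and ?f = "\<lambda>u. y (p k) + y u"
  define L where "L = {l. l \<le> m \<and> (l = Suc k \<or> k = Suc l)}"
  have L: "L \<subseteq> {..m}" "finite L" by (auto simp: L_def)
  have PV: "?P \<subseteq> pverts G" by (rule caterpillarD(2)[OF cat])
  have "?N \<inter> ?P \<subseteq> p ` L"
  proof
    fix u assume u: "u \<in> ?N \<inter> ?P"
    then obtain l where l: "l \<le> m" "u = p l" by blast
    then have "l = Suc k \<or> k = Suc l" using caterpillarD(4)[OF cat] k u by blast
    then show "u \<in> p ` L" using l by (auto simp: L_def)
  qed
  then have "sum ?f (?N \<inter> ?P) \<le> sum ?f (p ` L)"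
  proof (intro sum_mono2)
    show "0 \<le> ?f b" if "b \<in> p ` L - ?N \<inter> ?P" for b
    proof -
      have "b \<in> pverts G" "p k \<in> pverts G" using that L k PV by auto
      then show ?thesis using pos by (simp add: add_nonneg_nonneg less_imp_le)
    qed
  qed (use L in auto)
  also have "sum ?f (p ` L) = (\<Sum>l\<in>L. y (p k) + y (p l))"
    by (simp only: sum.reindex[OF inj_on_subset[OF caterpillarD(1)[OF cat] L(1)]] o_def)
  also have "L = (if 0 < k then {k - 1} else {}) \<union> (if k < m then {Suc k} else {})"
    using k by (auto simp: L_def)
  also have "(\<Sum>l\<in>\<dots>. y (p k) + y (p l))
      = (if 0 < k then y (p k) + y (p (k - 1)) else 0) + (if k < m then y (p k) + y (p (Suc k)) else 0)"
    by (cases "0 < k"; cases "k < m") simp_all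
  finally show ?thesis .
qed

section \<open>Supersolutions glued from a middle and two caps\<close>

definition mid_vec :: "real \<Rightarrow> nat \<Rightarrow> nat \<Rightarrow> real" where
  "mid_vec s m k = s ^ k + s ^ (m - k)"

text \<open>\<open>mid_vec\<close> solves the path recurrence and is symmetric, so caps at both ends
  fit the same middle. The cap is \<open>hyp\<close>, which satisfies the end equation, rescaled to
  agree with the middle at the pendant position \<open>i\<close>.\<close>

definition cap_vec :: "real \<Rightarrow> nat \<Rightarrow> nat \<Rightarrow> nat \<Rightarrow> real" where
  "cap_vec s m i k = (if k \<le> i then mid_vec s m i * (hyp s k / hyp s i) else mid_vec s m k)"

text \<open>\<open>s + s ^ (m - 2 * i - 1)\<close> bounds the ratio of \<open>mid_vec\<close> at
  \<open>i + 1\<close> to its value at \<open>i\<close>; the inequality is then the supersolution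
  condition at the gluing point with a pendant vertex attached.\<close>

definition cap_ok :: "real \<Rightarrow> nat \<Rightarrow> nat \<Rightarrow> bool" where
  "cap_ok s m i \<longleftrightarrow> 1 \<le> i \<and> 2 * i + 2 \<le> m \<and>
     s + s ^ (m - 2 * i - 1) \<le> hyp s (Suc i) / hyp s i - 1 - 1 / (mu s - 1)"

context
  fixes s :: real and m :: nat
  assumes s: "0 < s" "s < 1"
begin

lemma mid_vec_pos: "0 < mid_vec s m k"
  using s by (simp add: mid_vec_def add_pos_pos)

lemma mid_vec_reverse: "k \<le> m \<Longrightarrow> mid_vec s m (m - k) = mid_vec s m k"
  by (simp add: mid_vec_def)

lemma mid_vec_rec:
  assumes "Suc (Suc k) \<le> m"
  shows "mid_vec s m k + mid_vec s m (Suc (Suc k)) = (s + 1 / s) * mid_vec s m (Suc k)"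
proof -
  define r where "r = m - Suc (Suc k)"
  have "m - Suc k = Suc r" "m - k = Suc (Suc r)" using assms by (auto simp: r_def)
  then show ?thesis using s unfolding mid_vec_def r_def[symmetric] by (simp add: field_simps)
qed

lemma cap_vec_pos: "0 < cap_vec s m i k"
  using mid_vec_pos hyp_pos[OF s] by (simp add: cap_vec_def)

lemma cap_vec_mid: "i \<le> k \<Longrightarrow> cap_vec s m i k = mid_vec s m k"
  using hyp_pos[OF s, of i] by (auto simp: cap_vec_def)

text \<open>Equality holds at every position except \<open>i\<close>, where two solutions meet and
  \<open>cap_ok\<close> covers the defect.\<close>

lemma cap_vec_super:
  assumes ok: "cap_ok s m i" and "k < m"
  shows "(if 0 < k then cap_vec s m i k + cap_vec s m i (k - 1) else 0)
      + (cap_vec s m i k + cap_vec s m i (Suc k))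
      + (if k = i then (1 + 1 / (mu s - 1)) * cap_vec s m i k else 0) \<le> mu s * cap_vec s m i k"
proof -
  let ?y = "cap_vec s m i" and ?M = "mid_vec s m i"
  have h: "0 < hyp s i" by (rule hyp_pos[OF s])
  consider "k = 0" | l where "k = Suc l" "k < i" | "k = i" "0 < i" | "i < k"
    using ok by (cases k) (auto simp: cap_ok_def intro: linorder_cases[of k i])
  then show ?thesis
  proof cases
    case 1
    then have "?y k = ?M / hyp s i * hyp s 0" "?y (Suc k) = ?M / hyp s i * hyp s 1"
      using ok by (auto simp: cap_vec_def cap_ok_def)
    moreover have "?M / hyp s i * hyp s 0 + ?M / hyp s i * hyp s 1 = mu s * (?M / hyp s i * hyp s 0)"
      using hyp_0[OF s(1)] by (metis distrib_left mult.left_commute)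
    ultimately show ?thesis using 1 ok by (simp add: cap_ok_def)
  next
    case (2 l)
    then have y: "?y l = ?M / hyp s i * hyp s l" "?y (Suc l) = ?M / hyp s i * hyp s (Suc l)"
      "?y (Suc (Suc l)) = ?M / hyp s i * hyp s (Suc (Suc l))"
      by (auto simp: cap_vec_def)
    have "?y l + ?y (Suc (Suc l)) = (s + 1 / s) * ?y (Suc l)"
      unfolding y using hyp_rec[OF s(1), of l] by (metis distrib_left mult.left_commute)
    moreover have "mu s * ?y (Suc l) = 2 * ?y (Suc l) + (s + 1 / s) * ?y (Suc l)"
      by (simp add: mu_def algebra_simps)
    ultimately show ?thesis using 2 by simp
  next
    case 3
    then obtain l where l: "i = Suc l" by (cases i) auto
    have yi: "?y i = ?M" using h by (simp add: cap_vec_def)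
    have yl: "?y l = ?M * (hyp s l / hyp s i)" using l by (simp add: cap_vec_def)
    define r where "r = m - 2 * i - 1"
    have r: "m - Suc i = r + i" using ok by (auto simp: r_def cap_ok_def)
    have "?y (Suc i) = s * s ^ i + s ^ r * s ^ i"
      by (simp add: cap_vec_def mid_vec_def r power_add)
    also have "\<dots> = (s + s ^ r) * s ^ i" by (simp add: distrib_right)
    also have "\<dots> \<le> (s + s ^ r) * ?M"
      using s by (intro mult_left_mono) (auto simp: mid_vec_def)
    also have "\<dots> \<le> (hyp s (Suc i) / hyp s i - 1 - 1 / (mu s - 1)) * ?M"
      using ok mid_vec_pos[of i] unfolding r_def cap_ok_def by (intro mult_right_mono) auto
    finally have up: "?y (Suc i) \<le> (hyp s (Suc i) / hyp s i - 1 - 1 / (mu s - 1)) * ?M" .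
    have "hyp s l / hyp s i + hyp s (Suc i) / hyp s i = s + 1 / s"
      using hyp_rec[OF s(1), of l] h unfolding l by (simp add: add_divide_distrib[symmetric])
    then have "mu s * ?M = (2 + (hyp s l / hyp s i + hyp s (Suc i) / hyp s i)) * ?M"
      by (simp add: mu_def)
    then show ?thesis using 3 up yi yl l by (simp add: algebra_simps)
  next
    case 4
    then obtain l where l: "k = Suc l" by (cases k) auto
    have "?y l + ?y (Suc (Suc l)) = (s + 1 / s) * ?y (Suc l)"
      using 4 l \<open>k < m\<close> mid_vec_rec[of l] by (simp add: cap_vec_mid)
    moreover have "mu s * ?y (Suc l) = 2 * ?y (Suc l) + (s + 1 / s) * ?y (Suc l)"
      by (simp add: mu_def algebra_simps)
    ultimately show ?thesis using 4 l by simp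
  qed
qed

end

text \<open>Treats one half of the path. The values of \<open>y\<close> are prescribed up to
  \<open>2 * k \<le> m + 2\<close> because the equation at the middle still reads the next
  position.\<close>

lemma cap_supersolution:
  assumes s: "0 < s" "s < 1" and G: "pair_graph G" and cat: "caterpillar G m p S" and ok: "cap_ok s m i"
    and y: "\<And>k. k \<le> m \<Longrightarrow> 2 * k \<le> m + 2 \<Longrightarrow> y (p k) = cap_vec s m i k"
    and pos: "\<And>v. v \<in> pverts G \<Longrightarrow> 0 < y v"
    and yw: "\<And>k w. k \<le> m \<Longrightarrow> w \<notin> p ` {..m} \<Longrightarrow> (p k, w) \<in> parcs G \<Longrightarrow> y w = 1 / (mu s - 1) * y (p k)"
    and k: "2 * k \<le> m" "k \<in> S \<Longrightarrow> k = i"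
  shows "sop 1 (parcs G) y (p k) \<le> mu s * y (p k)"
proof -
  let ?N = "parcs G `` {p k}" and ?P = "p ` {..m}" and ?f = "\<lambda>u. y (p k) + 1 * y u"
  have m: "4 \<le> m" using ok by (auto simp: cap_ok_def)
  note p = caterpillarD(1,2)[OF cat] and S = caterpillarD(7)[OF cat]
  have c: "\<And>k. k \<le> m \<Longrightarrow> card (parcs G `` {p k} - ?P) \<le> 1"
    using caterpillarD(6)[OF cat] by simp
  have km: "k < m" using k m by simp
  have fin: "finite ?N" by (rule finite_neighbours[OF G])
  have "sum ?f (?N \<inter> ?P) = (\<Sum>u\<in>?N \<inter> ?P. y (p k) + y u)" by (simp only: mult_1)
  also have "\<dots> \<le> (if 0 < k then y (p k) + y (p (k - 1)) else 0) + (if k < m then y (p k) + y (p (Suc k)) else 0)"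
    by (rule sum_path_neighbours_le[OF G cat less_imp_le[OF km] pos])
  also have "\<dots> = (if 0 < k then cap_vec s m i k + cap_vec s m i (k - 1) else 0)
      + (cap_vec s m i k + cap_vec s m i (Suc k))"
    using k km by (auto simp: y)
  finally have 1: "sum ?f (?N \<inter> ?P) \<le> (if 0 < k then cap_vec s m i k + cap_vec s m i (k - 1) else 0)
      + (cap_vec s m i k + cap_vec s m i (Suc k))" .
  have 2: "sum ?f (?N - ?P) \<le> (if k = i then (1 + 1 / (mu s - 1)) * cap_vec s m i k else 0)"
  proof (cases "?N - ?P = {}")
    case True
    have "0 \<le> (1 + 1 / (mu s - 1)) * cap_vec s m i k"
      using mu_minus_1(2)[OF s(1)] by (intro mult_nonneg_nonneg less_imp_le[OF cap_vec_pos[OF s]]) auto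
    then show ?thesis unfolding True by (cases "k = i") auto
  next
    case False
    then have "k = i" using k(2) S km by auto
    have "card (?N - ?P) = 1" using c[of k] km False fin by (simp add: card_eq_0_iff le_Suc_eq)
    then obtain w where w: "?N - ?P = {w}" by (auto simp: card_1_singleton_iff)
    then have "w \<in> ?N - ?P" by simp
    then have "w \<notin> ?P" "(p k, w) \<in> parcs G" by (simp_all only: Diff_iff Image_singleton_iff not_False_eq_True)
    then have "y w = 1 / (mu s - 1) * y (p k)" by (rule yw[OF less_imp_le[OF km]])
    then have "sum ?f (?N - ?P) = (1 + 1 / (mu s - 1)) * y (p k)"
      unfolding w by (simp add: distrib_right)
    then show ?thesis using \<open>k = i\<close> y[of k] k km by simp
  qed
  have "sop 1 (parcs G) y (p k) = sum ?f (?N \<inter> ?P) + sum ?f (?N - ?P)"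
    unfolding sop_def by (rule sum.Int_Diff[OF fin])
  then show ?thesis using 1 2 cap_vec_super[OF s ok km] y[of k] k km by simp
qed

text \<open>A cap at each end, joined in the symmetric middle; the right half is handled by
  reversing the path.\<close>

lemma rad_le_caterpillar:
  assumes s: "0 < s" "s < 1" and G: "pair_graph G" and \<sigma>: "\<sigma> \<in> {-1, 1}" and cat: "caterpillar G m p S"
    and S: "S \<subseteq> {i, m - j}" and ok: "cap_ok s m i" "cap_ok s m j"
  shows "rad \<sigma> G \<le> mu s"
proof -
  let ?P = "p ` {..m}"
  note p = caterpillarD(1,2)[OF cat]
  have w: "\<And>w. w \<in> pverts G - ?P \<Longrightarrow> \<exists>k\<in>S. parcs G `` {w} = {p k}"
    using caterpillarD(5)[OF cat] by blast
  have ij: "2 * i + 2 \<le> m" "2 * j + 2 \<le> m" using ok by (auto simp: cap_ok_def)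
  have Sm: "k \<le> m" if "k \<in> S" for k using that S ij by auto
  define Y where "Y k = (if 2 * k \<le> m then cap_vec s m i k else cap_vec s m j (m - k))" for k
  define ix where "ix = the_inv_into {..m} p"
  have ix: "ix (p k) = k" if "k \<le> m" for k using that p(1) by (simp add: ix_def the_inv_into_f_f)
  \<comment> \<open>The weight \<open>1 / (mu s - 1)\<close> makes the equation at a pendant vertex
    exact.\<close>
  define y where "y v = (if v \<in> ?P then Y (ix v) else 1 / (mu s - 1) * Y (ix (the_elem (parcs G `` {v}))))" for v
  have yp: "y (p k) = Y k" if "k \<le> m" for k using that ix by (simp add: y_def)
  \<comment> \<open>Just beyond the middle the formula of the other half takes over, but both caps
    already equal \<open>mid_vec\<close> there.\<close>
  have Y1: "Y k = cap_vec s m i k" if "k \<le> m" "2 * k \<le> m + 2" for k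
    using that ij by (auto simp: Y_def cap_vec_mid[OF s] mid_vec_reverse[OF s])
  have Y2: "Y (m - k) = cap_vec s m j k" if "k \<le> m" "2 * k \<le> m + 2" for k
    using that ij by (auto simp: Y_def cap_vec_mid[OF s] mid_vec_reverse[OF s])
  have Ypos: "0 < Y k" for k by (simp add: Y_def cap_vec_pos[OF s])
  have \<beta>: "0 < 1 / (mu s - 1)" using mu_minus_1(2)[OF s(1)] by simp
  have pos: "0 < y v" for v using Ypos \<beta> by (simp add: y_def)
  have pend: "parcs G `` {v} = {p k}" if "k \<le> m" "v \<notin> ?P" "(p k, v) \<in> parcs G" for k v
  proof -
    have "v \<in> pverts G - ?P" using that arc_snd[OF G] by blast
    then obtain l where "parcs G `` {v} = {p l}" using w by blast
    moreover have "p k \<in> parcs G `` {v}" using arc_sym[OF G that(3)] by simp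
    ultimately show ?thesis by simp
  qed
  have yw: "y v = 1 / (mu s - 1) * y (p k)" if "k \<le> m" "v \<notin> ?P" "(p k, v) \<in> parcs G" for k v
    using pend[OF that] that yp ix by (simp add: y_def)
  have left: "sop 1 (parcs G) y (p k) \<le> mu s * y (p k)" if "2 * k \<le> m" for k
    by (rule cap_supersolution[OF s G cat ok(1)]) (use that S ij pos yw in \<open>auto simp: yp Y1\<close>)
  have right: "sop 1 (parcs G) y (p (m - k)) \<le> mu s * y (p (m - k))" if "2 * k \<le> m" for k
  proof (rule cap_supersolution[OF s G caterpillar_reverse[OF G cat] ok(2)])
    show "y (p (m - l)) = cap_vec s m j l" if "l \<le> m" "2 * l \<le> m + 2" for l
      using that by (simp add: yp Y2)
    show "y v = 1 / (mu s - 1) * y (p (m - l))" if "l \<le> m" "v \<notin> (\<lambda>k. p (m - k)) ` {..m}" "(p (m - l), v) \<in> parcs G" for l v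
      using that yw[of "m - l" v] unfolding image_reverse by simp
    show "k = j" if "k \<in> (-) m ` S" using that S ij \<open>2 * k \<le> m\<close> by auto
  qed (use that pos in auto)
  show ?thesis
  proof (rule rad_le_of_supersolution[OF G \<sigma>, where y = y])
    show "pverts G \<noteq> {}" using p(2) by auto
    show "0 < y v" for v by (rule pos)
    fix v assume v: "v \<in> pverts G"
    show "sop 1 (parcs G) y v \<le> mu s * y v"
    proof (cases "v \<in> ?P")
      case True
      then obtain k where k: "k \<le> m" "v = p k" by auto
      show ?thesis
      proof (cases "2 * k \<le> m")
        case True
        then show ?thesis using left k by simp
      next
        case False
        then show ?thesis using right[of "m - k"] k by simp
      qed
    next
      case False
      then obtain k where k: "k \<in> S" "parcs G `` {v} = {p k}" using w v by blast
      then have "(p k, v) \<in> parcs G" using arc_sym[OF G] by blast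
      then have yv: "y v = 1 / (mu s - 1) * y (p k)" using yw Sm[OF k(1)] False by blast
      have "(mu s - 1) * y v = y (p k)" unfolding yv using mu_minus_1(2)[OF s(1)] by simp
      then show ?thesis unfolding sop_def k(2) by (simp add: algebra_simps)
    qed
  qed
qed

text \<open>For \<open>s < sroot n\<close> and \<open>i \<le> n\<close> one has
  \<open>psi i s < 1\<close>, so \<open>hyp_psi\<close> leaves a strict margin, and the correction
  \<open>s ^ (m - 2 * i - 1)\<close> tends to 0.\<close>

lemma cap_ok_eventually:
  assumes s: "0 < s" "s < sroot n" and i: "1 \<le> i" "i \<le> n"
  shows "eventually (\<lambda>m. cap_ok s m i) sequentially"
proof -
  have s1: "s < 1" using s sroot_le_1[of n] by simp
  have h: "0 < hyp s i" by (rule hyp_pos[OF s(1) s1])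
  have "psi i s \<le> psi n s" using s i by (intro psi_mono) auto
  also have "psi n s < 1" using sroot_less_iff[of n s] s i by simp
  finally have "0 < (1 - s\<^sup>2) * (1 - psi i s)" using s s1 by (simp add: power_less_one_iff)
  then have "0 < (hyp s (Suc i) - hyp s i * (1 + s + 1 / (mu s - 1))) * ((1 + s + s\<^sup>2) * s ^ Suc i)"
    unfolding hyp_psi[OF s(1)] .
  moreover have "0 < (1 + s + s\<^sup>2) * s ^ Suc i" using s by (intro mult_pos_pos add_pos_pos) auto
  ultimately have "0 < hyp s (Suc i) - hyp s i * (1 + s + 1 / (mu s - 1))"
    by (rule zero_less_mult_pos2)
  then have "1 + s + 1 / (mu s - 1) < hyp s (Suc i) / hyp s i"
    using h by (simp add: pos_less_divide_eq mult.commute)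
  then have lt: "0 < hyp s (Suc i) / hyp s i - 1 - 1 / (mu s - 1) - s" by simp
  have "(\<lambda>r. s ^ r) \<longlonglongrightarrow> 0" using s s1 by (intro LIMSEQ_power_zero) auto
  then have "eventually (\<lambda>r. s ^ r < hyp s (Suc i) / hyp s i - 1 - 1 / (mu s - 1) - s) sequentially"
    using lt by (rule order_tendstoD)
  then have "eventually (\<lambda>m. s ^ (m - (2 * i + 1)) < hyp s (Suc i) / hyp s i - 1 - 1 / (mu s - 1) - s) sequentially"
    using filterlim_minus_const_nat_at_top by (auto simp: filterlim_iff)
  with eventually_ge_at_top[of "2 * i + 2"] show ?thesis
    by eventually_elim (use i in \<open>auto simp: cap_ok_def\<close>)
qed

lemma exists_s_mu_less:
  assumes "0 < \<delta>"
  obtains s where "0 < s" "s < sroot n" "mu s < xi n + \<delta>"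
proof -
  have "(mu \<longlongrightarrow> mu (sroot n)) (at_left (sroot n))"
    using mu_continuous[OF sroot_pos] by (simp add: continuous_within isCont_def filterlim_at_split)
  then have "eventually (\<lambda>s. mu s < xi n + \<delta>) (at_left (sroot n))"
    using assms by (intro order_tendstoD) (auto simp: xi_eq_mu)
  moreover have "eventually (\<lambda>s. 0 < s) (at_left (sroot n))"
    using sroot_pos by (rule eventually_at_left_real[THEN eventually_mono]) auto
  moreover have "eventually (\<lambda>s. s < sroot n) (at_left (sroot n))"
    by (simp add: eventually_at_filter)
  ultimately have "eventually (\<lambda>s. 0 < s \<and> s < sroot n \<and> mu s < xi n + \<delta>) (at_left (sroot n))"
    by eventually_elim auto
  then show thesis using that eventually_happens'[OF trivial_limit_at_left_real] by blast
qed

text \<open>A single \<open>s\<close> slightly below \<open>sroot n\<close> serves all pendant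
  positions up to \<open>n\<close>, so the threshold for \<open>m\<close> is uniform over all graphs
  in question.\<close>

lemma rad_le_xi_eventually:
  assumes "1 \<le> n" "0 < \<delta>"
  shows "eventually (\<lambda>m. \<forall>G \<sigma> p S i j. pair_graph G \<longrightarrow> \<sigma> \<in> {-1, 1} \<longrightarrow> caterpillar G m p S \<longrightarrow>
    S \<subseteq> {i, m - j} \<longrightarrow> i \<in> {1..n} \<longrightarrow> j \<in> {1..n} \<longrightarrow> rad \<sigma> G \<le> xi n + \<delta>) sequentially"
proof -
  obtain s where s: "0 < s" "s < sroot n" "mu s < xi n + \<delta>" using exists_s_mu_less[OF assms(2)] .
  have s1: "s < 1" using s sroot_le_1[of n] by simp
  have "eventually (\<lambda>m. \<forall>i\<in>{1..n}. cap_ok s m i) sequentially"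
    using cap_ok_eventually[OF s(1,2)] by (intro eventually_ball_finite) auto
  then show ?thesis
  proof eventually_elim
    case (elim m)
    then show ?case
      using rad_le_caterpillar[OF s(1) s1] s(3) by (meson less_imp_le order_trans)
  qed
qed

lemma rad_le_4:
  assumes G: "pair_graph G" and \<sigma>: "\<sigma> \<in> {-1, 1}" and ne: "pverts G \<noteq> {}"
    and c: "\<And>v. v \<in> pverts G \<Longrightarrow> card (parcs G `` {v}) \<le> 2"
  shows "rad \<sigma> G \<le> 4"
proof (rule rad_le_of_supersolution[OF G \<sigma> ne, where y = "\<lambda>_. 1"])
  show "sop 1 (parcs G) (\<lambda>_. 1) v \<le> 4 * 1" if "v \<in> pverts G" for v
    using c[OF that] by (simp add: sop_def)
qed simp

text \<open>Strictness lets the paths approach 4 without attaining it.\<close>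

lemma rad_path_less_4:
  assumes G: "pair_graph G" and \<sigma>: "\<sigma> \<in> {-1, 1}" and cat: "caterpillar G m p {}" and m: "1 \<le> m"
  shows "rad \<sigma> G < 4"
proof -
  let ?P = "p ` {..m}"
  note p = caterpillarD(1,2)[OF cat]
  have nc: "\<And>k l. k \<le> m \<Longrightarrow> l \<le> m \<Longrightarrow> (p k, p l) \<in> parcs G \<Longrightarrow> l = Suc k \<or> k = Suc l"
    using caterpillarD(4)[OF cat] by blast
  have w: "\<And>w. w \<in> pverts G - ?P \<Longrightarrow> False"
    using caterpillarD(5)[OF cat] by blast
  have V: "pverts G = ?P" using p(2) w by blast
  define ix where "ix = the_inv_into {..m} p"
  have ix: "ix (p k) = k" if "k \<le> m" for k using that p(1) by (simp add: ix_def the_inv_into_f_f)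
  define M where "M = real m"
  have M: "1 \<le> M" using m by (simp add: M_def)
  \<comment> \<open>A concave parabola: its second difference \<open>-2\<close> beats the factor 4
    at inner vertices. The shift by \<open>M\<close> keeps it positive and leaves slack at the ends,
    and \<open>M + M * M\<close> bounds it from above, whence the choice of
    \<open>\<mu>\<close>.\<close>
  define Y where "Y k = M + k * (M - k)" for k :: real
  define \<mu> where "\<mu> = 4 - 2 / (M + M * M)"
  have MM: "2 \<le> M + M * M" using M mult_mono[of 1 M 1 M] by simp
  have \<mu>: "\<mu> < 4" "3 \<le> \<mu>" using MM by (auto simp: \<mu>_def)
  have Y: "M \<le> Y k" "Y k \<le> M + M * M" if "0 \<le> k" "k \<le> M" for k
  proof -
    show "M \<le> Y k" using that by (simp add: Y_def)
    show "Y k \<le> M + M * M" unfolding Y_def using that by (intro add_left_mono mult_mono) auto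
  qed
  have pos: "0 < Y (real (ix v))" if v: "v \<in> pverts G" for v
  proof -
    obtain k where "k \<le> m" "v = p k" using v V by auto
    then show ?thesis using Y(1)[of "real k"] ix M by (simp add: M_def)
  qed
  have "rad \<sigma> G \<le> \<mu>"
  proof (rule rad_le_of_supersolution[OF G \<sigma>, where y = "\<lambda>v. Y (real (ix v))"])
    show "pverts G \<noteq> {}" using V by auto
    show "0 < Y (real (ix v))" if "v \<in> pverts G" for v by (rule pos[OF that])
    fix v assume "v \<in> pverts G"
    then obtain k where k: "k \<le> m" "v = p k" using V by auto
    have "parcs G `` {v} = parcs G `` {v} \<inter> ?P" using neighbours_subset[OF G] V by blast
    then have "sop 1 (parcs G) (\<lambda>v. Y (real (ix v))) v
        = (\<Sum>u\<in>parcs G `` {p k} \<inter> ?P. Y (real (ix (p k))) + Y (real (ix u)))"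
      unfolding sop_def k(2) by simp
    also have "\<dots> \<le> (if 0 < k then Y (real (ix (p k))) + Y (real (ix (p (k - 1)))) else 0)
        + (if k < m then Y (real (ix (p k))) + Y (real (ix (p (Suc k)))) else 0)"
      by (rule sum_path_neighbours_le[OF G cat k(1), of "\<lambda>v. Y (real (ix v))", OF pos])
    also have "\<dots> = (if 0 < k then Y (real k) + Y (real (k - 1)) else 0) + (if k < m then Y (real k) + Y (real (Suc k)) else 0)"
      using k by (auto simp: ix)
    finally have sop_le: "sop 1 (parcs G) (\<lambda>v. Y (real (ix v))) v
      \<le> (if 0 < k then Y (real k) + Y (real (k - 1)) else 0) + (if k < m then Y (real k) + Y (real (Suc k)) else 0)" .
    have e: "M + Y 1 \<le> \<mu> * M"
    proof -
      have "M + Y 1 \<le> 3 * M" by (simp add: Y_def)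
      also have "\<dots> \<le> \<mu> * M" using \<mu> M by (intro mult_right_mono) auto
      finally show ?thesis .
    qed
    consider "k = 0" | "k = m" "0 < k" | "0 < k" "k < m" using k by linarith
    then show "sop 1 (parcs G) (\<lambda>v. Y (real (ix v))) v \<le> \<mu> * Y (real (ix v))"
    proof cases
      case 1
      then show ?thesis using sop_le e k ix m by (simp add: Y_def)
    next
      case 2
      moreover have "Y (real (m - 1)) = Y 1" using m by (simp add: Y_def M_def of_nat_diff algebra_simps)
      moreover have "Y (real m) = M" by (simp add: Y_def M_def)
      ultimately show ?thesis using sop_le e k ix by simp
    next
      case 3
      have "sop 1 (parcs G) (\<lambda>v. Y (real (ix v))) v \<le> 2 * Y (real k) + Y (real k - 1) + Y (real k + 1)"
        using sop_le 3 by (simp add: of_nat_diff add.commute)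
      also have "\<dots> = 4 * Y (real k) - 2" by (simp add: Y_def algebra_simps)
      also have "\<dots> \<le> \<mu> * Y (real k)"
      proof -
        have "2 / (M + M * M) * Y (real k) \<le> 2 / (M + M * M) * (M + M * M)"
          using Y(2)[of "real k"] k MM by (intro mult_left_mono) (auto simp: M_def)
        also have "\<dots> = 2"
        proof -
          have "2 / D * D = 2" if "2 \<le> D" for D :: real using that by simp
          then show ?thesis using MM by blast
        qed
        finally show ?thesis by (simp add: \<mu>_def left_diff_distrib)
      qed
      finally show ?thesis using k ix by simp
    qed
  qed
  then show ?thesis using \<mu> by simp
qed

section \<open>Graphs with a long longest path\<close>

abbreviation paw_free :: "nat rel \<Rightarrow> bool" where
  "paw_free E \<equiv> \<forall>a b c e. (a, b) \<in> E \<longrightarrow> (b, c) \<in> E \<longrightarrow> (c, a) \<in> E \<longrightarrow> (a, e) \<in> E \<longrightarrow>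
     \<not> distinct [a, b, c, e]"

text \<open>The forbidden graph is the bull with one horn extended by an edge.\<close>

abbreviation bull_free :: "nat rel \<Rightarrow> bool" where
  "bull_free E \<equiv> \<forall>u v w z a b. (u, v) \<in> E \<longrightarrow> (v, w) \<in> E \<longrightarrow> (w, u) \<in> E \<longrightarrow> (u, z) \<in> E \<longrightarrow> (v, a) \<in> E \<longrightarrow>
     (a, b) \<in> E \<longrightarrow> \<not> distinct [u, v, w, z, a, b]"

text \<open>The two alternatives in \<open>triangles\<close> are those of the signless Laplacian and of the Laplacian.\<close>

locale longest_path =
  fixes V :: "nat set" and E :: "nat rel" and N m :: nat and p :: "nat \<Rightarrow> nat"
  assumes E_sub: "\<And>u v. (u, v) \<in> E \<Longrightarrow> u \<in> V"
    and E_sym: "\<And>u v. (u, v) \<in> E \<Longrightarrow> (v, u) \<in> E"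
    and E_irr: "\<And>u. (u, u) \<notin> E"
    and V_reach: "\<And>u v. u \<in> V \<Longrightarrow> v \<in> V \<Longrightarrow> (u, v) \<in> E\<^sup>*"
    and no_star4: "\<And>c a1 a2 a3 a4. (c, a1) \<in> E \<Longrightarrow> (c, a2) \<in> E \<Longrightarrow> (c, a3) \<in> E \<Longrightarrow> (c, a4) \<in> E \<Longrightarrow>
      distinct [c, a1, a2, a3, a4] \<Longrightarrow> False"
    and no_spider: "\<And>c a1 a2 a3 b1 b2 b3. (c, a1) \<in> E \<Longrightarrow> (c, a2) \<in> E \<Longrightarrow> (c, a3) \<in> E \<Longrightarrow>
      (a1, b1) \<in> E \<Longrightarrow> (a2, b2) \<in> E \<Longrightarrow> (a3, b3) \<in> E \<Longrightarrow> distinct [c, a1, a2, a3, b1, b2, b3] \<Longrightarrow> False"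
    and no_banner: "\<And>a b c d e. (a, b) \<in> E \<Longrightarrow> (b, c) \<in> E \<Longrightarrow> (c, d) \<in> E \<Longrightarrow> (d, a) \<in> E \<Longrightarrow> (a, e) \<in> E \<Longrightarrow>
      distinct [a, b, c, d, e] \<Longrightarrow> False"
    and triangles: "paw_free E
      \<or> bull_free E
        \<and> (\<forall>u v w. E `` {u} = {v, w} \<longrightarrow> E `` {v} = {u, w} \<longrightarrow> False)"
    and no_middle: "\<And>c r q S w. caterpillar_in E (c + r) q S w \<Longrightarrow> c \<in> S \<Longrightarrow> N \<le> c \<Longrightarrow> N \<le> r \<Longrightarrow> False"
    and no_two: "\<And>c r q b w. caterpillar_in E (c + r) q {b, c} w \<Longrightarrow> 1 \<le> b \<Longrightarrow> b < c \<Longrightarrow> N \<le> r \<Longrightarrow> False"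
    and N: "2 \<le> N" "2 * N + 8 \<le> m"
    and inj: "inj_on p {..m}"
    and edge: "\<And>k. k < m \<Longrightarrow> (p k, p (Suc k)) \<in> E"
    and longest: "\<And>q l. inj_on q {..l} \<Longrightarrow> (\<And>k. k < l \<Longrightarrow> (q k, q (Suc k)) \<in> E) \<Longrightarrow> l \<le> m"
begin

lemma reverse: "longest_path V E N m (\<lambda>k. p (m - k))"
proof (rule longest_path.intro)
  show "inj_on (\<lambda>k. p (m - k)) {..m}" by (rule inj_on_reverse[OF inj])
  show "(p (m - k), p (m - Suc k)) \<in> E" if "k < m" for k
    using E_sym[OF edge[of "m - Suc k"]] that by (simp add: Suc_diff_Suc)
qed (fact E_sub E_sym E_irr V_reach no_star4 no_spider no_banner triangles no_middle no_two N longest)+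

section \<open>Cycles and chords\<close>

lemma near: "k \<le> m \<Longrightarrow> l \<le> m \<Longrightarrow> l = Suc k \<or> k = Suc l \<Longrightarrow> (p k, p l) \<in> E"
  using edge[of k] E_sym[OF edge[of l]] by auto

lemma p_eq: "k \<le> m \<Longrightarrow> l \<le> m \<Longrightarrow> p k = p l \<longleftrightarrow> k = l"
  using inj by (auto simp: inj_on_def)

lemma p_distinct: "distinct xs \<Longrightarrow> \<forall>x\<in>set xs. x \<le> m \<Longrightarrow> distinct (map p xs)"
  using inj by (auto simp: distinct_map intro: inj_on_subset)

lemma outside_neq: "w \<notin> p ` {..m} \<Longrightarrow> k \<le> m \<Longrightarrow> p k \<noteq> w \<and> w \<noteq> p k"
  by auto

text \<open>Otherwise \<open>w\<close> could be prepended, giving a longer path.\<close>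

lemma end_neighbour:
  assumes "(p 0, w) \<in> E"
  shows "w \<in> p ` {..m}"
proof (rule ccontr)
  assume w: "w \<notin> p ` {..m}"
  define q where "q k = (if k = 0 then w else p (k - 1))" for k
  have "Suc m \<le> m"
  proof (rule longest[of q])
    show "inj_on q {..Suc m}"
    proof (rule inj_onI)
      fix k l assume "k \<in> {..Suc m}" "l \<in> {..Suc m}" "q k = q l"
      moreover from this have "k - 1 \<le> m" "l - 1 \<le> m" by auto
      ultimately show "k = l"
        using outside_neq[OF w \<open>k - 1 \<le> m\<close>] outside_neq[OF w \<open>l - 1 \<le> m\<close>] p_eq[OF \<open>k - 1 \<le> m\<close> \<open>l - 1 \<le> m\<close>]
        by (cases "k = 0"; cases "l = 0") (simp_all add: q_def)
    qed
    show "(q k, q (Suc k)) \<in> E" if "k < Suc m" for k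
      using that E_sym[OF assms] edge[of "k - 1"] by (cases k) (auto simp: q_def)
  qed
  then show False by simp
qed

lemma other_end_neighbour: "(p m, w) \<in> E \<Longrightarrow> w \<in> p ` {..m}"
  using longest_path.end_neighbour[OF reverse, of w] by (simp add: image_reverse)

text \<open>Cut the cycle open far from \<open>g 0\<close>: the resulting path has
  \<open>g 0\<close> at position \<open>N\<close> and at least \<open>N\<close> further edges behind
  it, so its pendant vertex lies in the middle. This needs length \<open>2 * N + 1\<close>.\<close>

lemma no_cycle_with_pendant:
  assumes g: "inj_on g {..<L}" "\<And>k. Suc k < L \<Longrightarrow> (g k, g (Suc k)) \<in> E" "(g (L - 1), g 0) \<in> E"
    and w: "w \<notin> g ` {..<L}" "(g 0, w) \<in> E" and L: "2 * N + 1 \<le> L"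
  shows False
proof -
  define q where "q k = (if k < N then g (L - N + k) else g (k - N))" for k
  have qg: "\<exists>l<L. q k = g l \<and> l = (if k < N then L - N + k else k - N)" if "k < L" for k
    using that L N by (auto simp: q_def)
  have "caterpillar_in E (N + (L - 1 - N)) q {N} (\<lambda>_. w)"
    unfolding caterpillar_in_def
  proof (intro conjI)
    have m: "N + (L - 1 - N) = L - 1" using L by simp
    show "inj_on q {..N + (L - 1 - N)}"
      unfolding m
    proof (rule inj_onI)
      fix k l assume kl: "k \<in> {..L - 1}" "l \<in> {..L - 1}" "q k = q l"
      then have "k < L" "l < L" using L by auto
      then obtain k' l' where "k' < L" "l' < L" "q k = g k'" "q l = g l'"
        "k' = (if k < N then L - N + k else k - N)" "l' = (if l < N then L - N + l else l - N)"
        using qg by metis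
      moreover from this kl(3) have "k' = l'" using g(1) by (auto simp: inj_on_def)
      ultimately show "k = l" using \<open>k < L\<close> \<open>l < L\<close> by (auto split: if_splits)
    qed
    show "\<forall>k<N + (L - 1 - N). (q k, q (Suc k)) \<in> E"
      unfolding m
    proof (intro allI impI)
      fix k assume k: "k < L - 1"
      consider "Suc k < N" | "Suc k = N" | "N \<le> k" by linarith
      then show "(q k, q (Suc k)) \<in> E"
      proof cases
        case 1
        then show ?thesis using g(2)[of "L - N + k"] L by (simp add: q_def)
      next
        case 2
        then have "L - N + k = L - 1" using L by auto
        then show ?thesis using g(3) 2 by (simp add: q_def)
      next
        case 3
        then show ?thesis using g(2)[of "k - N"] k by (simp add: q_def Suc_diff_le)
      qed
    qed
    have "q ` {..N + (L - 1 - N)} \<subseteq> g ` {..<L}"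
    proof
      fix x assume "x \<in> q ` {..N + (L - 1 - N)}"
      then obtain k where "k \<le> L - 1" "x = q k" unfolding m by auto
      moreover from this have "k < L" using L by linarith
      ultimately have "k < L" "x = q k" by auto
      then show "x \<in> g ` {..<L}" using qg[of k] by auto
    qed
    then show "\<forall>k\<in>{N}. (q k, w) \<in> E \<and> w \<notin> q ` {..N + (L - 1 - N)}"
      using w by (auto simp: q_def)
  qed auto
  then show False by (rule no_middle) (use L in auto)
qed

lemma no_cycle_with_pendant_at:
  assumes g: "inj_on g {..<L}" "\<And>k. Suc k < L \<Longrightarrow> (g k, g (Suc k)) \<in> E" "(g (L - 1), g 0) \<in> E"
    and w: "w \<notin> g ` {..<L}" "(g a, w) \<in> E" "a < L" and L: "2 * N + 1 \<le> L"
  shows False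
proof -
  \<comment> \<open>The cycle rotated so as to start at \<open>g a\<close>.\<close>
  define h where "h k = (if k < L - a then g (a + k) else g (k - (L - a)))" for k
  have hg: "\<exists>l<L. h k = g l \<and> l = (if k < L - a then a + k else k - (L - a))" if "k < L" for k
    using that w(3) by (auto simp: h_def)
  show False
  proof (rule no_cycle_with_pendant[of h L w])
    show "inj_on h {..<L}"
    proof (rule inj_onI)
      fix k l assume kl: "k \<in> {..<L}" "l \<in> {..<L}" "h k = h l"
      then have "k < L" "l < L" by auto
      then obtain k' l' where "k' < L" "l' < L" "h k = g k'" "h l = g l'"
        "k' = (if k < L - a then a + k else k - (L - a))" "l' = (if l < L - a then a + l else l - (L - a))"
        using hg by metis
      moreover from this kl(3) have "k' = l'" using g(1) by (auto simp: inj_on_def)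
      ultimately show "k = l" using \<open>k < L\<close> \<open>l < L\<close> by (auto split: if_splits) arith
    qed
    show "(h k, h (Suc k)) \<in> E" if k: "Suc k < L" for k
    proof -
      consider "Suc k < L - a" | "Suc k = L - a" | "L - a \<le> k" by linarith
      then show ?thesis
      proof cases
        case 1
        then show ?thesis using g(2)[of "a + k"] by (simp add: h_def)
      next
        case 2
        then have "a + k = L - 1" by auto
        then show ?thesis using g(3) 2 by (simp add: h_def)
      next
        case 3
        then show ?thesis using g(2)[of "k - (L - a)"] k by (simp add: h_def Suc_diff_le)
      qed
    qed
    show "(h (L - 1), h 0) \<in> E"
    proof (cases "a = 0")
      case True
      then show ?thesis using g(3) L by (simp add: h_def)
    next
      case False
      then have "L - 1 - (L - a) = a - 1" "\<not> L - 1 < L - a" using w(3) by auto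
      then show ?thesis using g(2)[of "a - 1"] False w(3) by (simp add: h_def)
    qed
    have "h ` {..<L} \<subseteq> g ` {..<L}"
    proof
      fix x assume "x \<in> h ` {..<L}"
      then obtain k where "k < L" "x = h k" by auto
      then show "x \<in> g ` {..<L}" using hg[of k] by auto
    qed
    then show "w \<notin> h ` {..<L}" using w(1) by blast
    show "(h 0, w) \<in> E" using w by (simp add: h_def)
  qed (rule L)
qed

text \<open>\<open>p i\<close> becomes the centre of a spider with two legs along the path and one
  across the chord; distance three keeps the legs disjoint.\<close>

lemma no_chord_inner:
  assumes "2 \<le> i" "i + 3 \<le> j" "j < m" "(p i, p j) \<in> E"
  shows False
proof (rule no_spider[of "p i" "p (i - 1)" "p (i + 1)" "p j" "p (i - 2)" "p (i + 2)" "p (j + 1)"])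
  have "distinct (map p [i, i - 1, i + 1, j, i - 2, i + 2, j + 1])"
    using assms by (intro p_distinct) auto
  then show "distinct [p i, p (i - 1), p (i + 1), p j, p (i - 2), p (i + 2), p (j + 1)]" by simp
qed (use assms in \<open>auto intro!: near\<close>)

text \<open>For \<open>j = 3\<close> a four-cycle with pendant \<open>p 4\<close>; for
  \<open>j = m - 1\<close> a long cycle with pendant \<open>p m\<close>; in between a spider centred
  at \<open>p j\<close> with the leg \<open>p 0\<close>, \<open>p 1\<close>.\<close>

lemma no_chord_start:
  assumes "3 \<le> j" "j < m" "(p 0, p j) \<in> E"
  shows False
proof -
  have m: "12 \<le> m" using N by simp
  consider "j = 3" | "4 \<le> j" "j + 2 \<le> m" | "j = m - 1" using assms by linarith
  then show False
  proof cases
    case 1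
    have "distinct (map p [3, 2, 1, 0, 4])" using m by (intro p_distinct) auto
    then have "distinct [p 3, p 2, p 1, p 0, p 4]" by simp
    then show False using no_banner[of "p 3" "p 2" "p 1" "p 0" "p 4"] assms 1 m near by auto
  next
    case 2
    have "distinct (map p [j, j + 1, j - 1, 0, j + 2, j - 2, 1])"
      using 2 by (intro p_distinct) auto
    then have "distinct [p j, p (j + 1), p (j - 1), p 0, p (j + 2), p (j - 2), p 1]" by simp
    then show False
      by (rule no_spider[rotated -1]) (use 2 assms E_sym in \<open>auto intro!: near\<close>)
  next
    case 3
    show False
    proof (rule no_cycle_with_pendant[of "\<lambda>k. p (m - 1 - k)" m "p m"])
      show "inj_on (\<lambda>k. p (m - 1 - k)) {..<m}"
        using m by (auto simp: inj_on_def p_eq)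
      show "(p (m - 1 - k), p (m - 1 - Suc k)) \<in> E" if "Suc k < m" for k
        using that by (intro near) auto
      show "(p (m - 1 - (m - 1)), p (m - 1 - 0)) \<in> E" using assms 3 by simp
      show "p m \<notin> (\<lambda>k. p (m - 1 - k)) ` {..<m}"
      proof
        assume "p m \<in> (\<lambda>k. p (m - 1 - k)) ` {..<m}"
        then obtain k where "k < m" "p m = p (m - 1 - k)" by auto
        then show False using p_eq[of m "m - 1 - k"] m by simp
      qed
      show "(p (m - 1 - 0), p m) \<in> E" using m by (intro near) auto
    qed (use N in simp)
  qed
qed

lemma no_chord_1:
  assumes "(p 1, p (m - 1)) \<in> E"
  shows False
proof (rule no_cycle_with_pendant[of "\<lambda>k. p (Suc k)" "m - 1" "p 0"])
  have m: "12 \<le> m" using N by simp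
  show "inj_on (\<lambda>k. p (Suc k)) {..<m - 1}" by (auto simp: inj_on_def p_eq)
  show "(p (Suc k), p (Suc (Suc k))) \<in> E" if "Suc k < m - 1" for k
    using that by (intro near) auto
  show "(p (Suc (m - 1 - 1)), p (Suc 0)) \<in> E" using E_sym[OF assms] m by (simp add: Suc_diff_Suc numeral_2_eq_2)
  show "p 0 \<notin> (\<lambda>k. p (Suc k)) ` {..<m - 1}"
  proof
    assume "p 0 \<in> (\<lambda>k. p (Suc k)) ` {..<m - 1}"
    then obtain k where "k < m - 1" "p 0 = p (Suc k)" by auto
    then show False using p_eq[of 0 "Suc k"] by simp
  qed
  show "(p (Suc 0), p 0) \<in> E" using m by (intro near) auto
  show "2 * N + 1 \<le> m - 1" using N by simp
qed

lemma no_long_chord: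
  assumes "i + 3 \<le> j" "j \<le> m" "(i, j) \<noteq> (0, m)" "(p i, p j) \<in> E"
  shows False
proof -
  interpret r: longest_path V E N m "\<lambda>k. p (m - k)" by (rule reverse)
  have sym: "(p (m - (m - j)), p (m - (m - i))) \<in> E" using E_sym[OF assms(4)] assms by simp
  \<comment> \<open>Only the chord from \<open>p 1\<close> to \<open>p (m - 1)\<close> escapes both
    the inner and the end argument; it closes a long cycle with pendant \<open>p 0\<close>.\<close>
  consider "2 \<le> i" "j < m" | "1 \<le> i" "j + 2 \<le> m" | "i = 0" "j < m" | "1 \<le> i" "j = m" | "i = 1" "j = m - 1"
    using assms by fastforce
  then show False
  proof cases
    case 1
    then show False using no_chord_inner assms by blast
  next
    case 2
    then have "2 \<le> m - j" "m - j + 3 \<le> m - i" "m - i < m" using assms by linarith+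
    then show False using r.no_chord_inner sym by blast
  next
    case 3
    then show False using no_chord_start[of j] assms by simp
  next
    case 4
    then have "3 \<le> m - i" "m - i < m" using assms by linarith+
    then show False using r.no_chord_start[of "m - i"] sym 4 by simp
  next
    case 5
    then show False using no_chord_1 assms by simp
  qed
qed

lemma no_short_chord_if_inner:
  assumes bull: "bull_free E"
    and "1 \<le> i" "i + 4 \<le> m" "(p i, p (i + 2)) \<in> E"
  shows False
proof -
  have "distinct (map p [i, i + 2, i + 1, i - 1, i + 3, i + 4])" using assms by (intro p_distinct) auto
  then have "distinct [p i, p (i + 2), p (i + 1), p (i - 1), p (i + 3), p (i + 4)]" by simp
  moreover have "(p (i + 2), p (i + 1)) \<in> E" "(p (i + 1), p i) \<in> E" "(p i, p (i - 1)) \<in> E"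
    "(p (i + 2), p (i + 3)) \<in> E" "(p (i + 3), p (i + 4)) \<in> E"
    using assms by (auto intro!: near)
  ultimately show False using bull assms(4) by blast
qed

text \<open>\<open>p 0\<close> and \<open>p 1\<close> are not twins, so one of them has a further
  neighbour. For \<open>p 0\<close> it lies on the path and yields a long chord or a long cycle; for
  \<open>p 1\<close> it yields a chord or an extended bull.\<close>

lemma no_short_chord_start:
  assumes bull: "bull_free E"
    and twins: "\<forall>u v w. E `` {u} = {v, w} \<longrightarrow> E `` {v} = {u, w} \<longrightarrow> False"
    and chord: "(p 0, p 2) \<in> E"
  shows False
proof -
  have m: "12 \<le> m" using N by simp
  have e: "(p 0, p 1) \<in> E" "(p 1, p 0) \<in> E" "(p 1, p 2) \<in> E" "(p 2, p 0) \<in> E" "(p 2, p 3) \<in> E" "(p 3, p 4) \<in> E"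
    using m E_sym[OF chord] by (auto intro!: near)
  have sub: "{p 1, p 2} \<subseteq> E `` {p 0}" "{p 0, p 2} \<subseteq> E `` {p 1}" using e chord by auto
  have "E `` {p 0} \<noteq> {p 1, p 2} \<or> E `` {p 1} \<noteq> {p 0, p 2}"
    using twins[rule_format, of "p 0" "p 1" "p 2"] by metis
  then consider "\<not> E `` {p 0} \<subseteq> {p 1, p 2}" | "\<not> E `` {p 1} \<subseteq> {p 0, p 2}" using sub by (metis subset_antisym)
  then show False
  proof cases
    case not_sub: 1
    then obtain x where 1: "(p 0, x) \<in> E" "x \<noteq> p 1" "x \<noteq> p 2" by (auto simp: subset_iff)
    then obtain j where j: "j \<le> m" "x = p j" using end_neighbour[OF 1(1)] by auto
    have "j \<noteq> 0" "j \<noteq> 1" "j \<noteq> 2" using 1 j E_irr by metis+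
    show False
    proof (cases "j = m")
      case True
      \<comment> \<open>The short chord bypasses \<open>p 1\<close>: a cycle through all other path
        vertices, with \<open>p 1\<close> attached to it.\<close>
      define g where "g k = (if k = 0 then p 0 else p (Suc k))" for k
      have gk: "g k = p (if k = 0 then 0 else Suc k)" for k by (simp add: g_def)
      show False
      proof (rule no_cycle_with_pendant[of g m "p 1"])
        show "inj_on g {..<m}" by (auto simp: inj_on_def gk p_eq split: if_splits)
        show "(g k, g (Suc k)) \<in> E" if "Suc k < m" for k
          using that chord by (cases "k = 0") (auto simp: g_def numeral_2_eq_2 intro!: near)
        show "(g (m - 1), g 0) \<in> E" using E_sym[OF 1(1)] j True m by (simp add: g_def)
        show "p 1 \<notin> g ` {..<m}"
        proof
          assume "p 1 \<in> g ` {..<m}"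
          then obtain k where "k < m" "p 1 = p (if k = 0 then 0 else Suc k)" by (auto simp: gk)
          then show False using p_eq[of 1 0] p_eq[of 1 "Suc k"] m by (cases "k = 0") simp_all
        qed
        show "(g 0, p 1) \<in> E" using e by (simp add: g_def)
      qed (use N in simp)
    next
      case False
      then show False
        using no_long_chord[of 0 j] 1 j \<open>j \<noteq> 0\<close> \<open>j \<noteq> 1\<close> \<open>j \<noteq> 2\<close> by auto
    qed
  next
    case not_sub: 2
    then obtain x where 2: "(p 1, x) \<in> E" "x \<noteq> p 0" "x \<noteq> p 2" by (auto simp: subset_iff)
    show False
    proof (cases "x \<in> p ` {..m}")
      case True
      then obtain j where j: "j \<le> m" "x = p j" by auto
      have "j \<noteq> 0" "j \<noteq> 1" "j \<noteq> 2" using 2 j E_irr by metis+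
      then have "j = 3 \<or> 4 \<le> j" by linarith
      then show False
        using no_short_chord_if_inner[OF bull, of 1] no_long_chord[of 1 j] 2(1) j m
        by (auto simp: numeral_3_eq_3)
    next
      case False
      then have w: "x \<noteq> p k \<and> p k \<noteq> x" if "k \<le> m" for k using outside_neq that by blast
      have "distinct (map p [1, 2, 0, 3, 4])" using m by (intro p_distinct) auto
      then have "distinct [p 1, p 2, p 0, x, p 3, p 4]" using w m by simp
      then show False using bull e 2(1) by blast
    qed
  qed
qed

lemma no_short_chord:
  assumes "i + 2 \<le> m" "(p i, p (i + 2)) \<in> E"
  shows False
  using triangles
proof (elim disjE conjE)
  have m: "12 \<le> m" using N by simp
  assume paw: "paw_free E"
  show False
  proof (cases "i + 3 \<le> m")
    case True
    have "distinct (map p [i + 2, i, i + 1, i + 3])" using True by (intro p_distinct) auto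
    then have "distinct [p (i + 2), p i, p (i + 1), p (i + 3)]" by simp
    moreover have "(p i, p (i + 1)) \<in> E" "(p (i + 1), p (i + 2)) \<in> E" "(p (i + 2), p (i + 3)) \<in> E"
      using True by (auto intro!: near)
    ultimately show False using paw E_sym assms(2) by blast
  next
    case False
    then have i: "1 \<le> i" using m by simp
    have "distinct (map p [i, i + 2, i + 1, i - 1])" using assms i by (intro p_distinct) auto
    then have "distinct [p i, p (i + 2), p (i + 1), p (i - 1)]" by simp
    moreover have "(p (i + 2), p (i + 1)) \<in> E" "(p (i + 1), p i) \<in> E" "(p i, p (i - 1)) \<in> E"
      using assms i by (auto intro!: near)
    ultimately show False using paw assms(2) by blast
  qed
next
  have m: "12 \<le> m" using N by simp
  assume bull: "bull_free E"
    and twins: "\<forall>u v w. E `` {u} = {v, w} \<longrightarrow> E `` {v} = {u, w} \<longrightarrow> False"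
  interpret r: longest_path V E N m "\<lambda>k. p (m - k)" by (rule reverse)
  have "m - (m - (i + 2)) = i + 2" "m - (m - (i + 2) + 2) = i" using assms(1) by linarith+
  then have sym: "(p (m - (m - (i + 2))), p (m - (m - (i + 2) + 2))) \<in> E" using E_sym[OF assms(2)] by simp
  \<comment> \<open>An inner triangle has room for the longer horn on the right or, after reversal,
    on the left.\<close>
  consider "i = 0" | "i = m - 2" | "1 \<le> i" "i + 4 \<le> m" | "2 \<le> i" "i + 3 \<le> m" using assms m by linarith
  then show False
  proof cases
    case 1
    then show False using no_short_chord_start[OF bull twins] assms by (simp add: numeral_2_eq_2)
  next
    case 2
    then have "i + 2 = m" using m by simp
    then have "(p m, p (m - 2)) \<in> E" using E_sym[OF assms(2)] 2 by metis
    then show False using r.no_short_chord_start[OF bull twins] by simp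
  next
    case 3
    then show False using no_short_chord_if_inner[OF bull] assms by blast
  next
    case 4
    then have "1 \<le> m - (i + 2)" "m - (i + 2) + 4 \<le> m" by linarith+
    then show False using r.no_short_chord_if_inner[OF bull] sym by blast
  qed
qed

lemma chord_cases:
  assumes "k \<le> m" "l \<le> m" "(p k, p l) \<in> E"
  shows "l = Suc k \<or> k = Suc l \<or> {k, l} = {0, m}"
proof -
  have *: "j = Suc i \<or> (i, j) = (0, m)" if "i < j" "j \<le> m" "(p i, p j) \<in> E" for i j
  proof (rule ccontr)
    assume "\<not> ?thesis"
    then have "j = i + 2 \<or> i + 3 \<le> j" "(i, j) \<noteq> (0, m)" using that by auto
    then show False using no_short_chord[of i] no_long_chord[of i j] that by auto
  qed
  have "k \<noteq> l" using assms E_irr by auto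
  then show ?thesis using *[of k l] *[of l k] assms E_sym by (cases "k < l") auto
qed

lemma reachable_closed:
  assumes "u \<in> V" "u \<in> U" "\<And>x y. x \<in> U \<Longrightarrow> (x, y) \<in> E \<Longrightarrow> y \<in> U"
  shows "V \<subseteq> U"
proof
  fix v assume "v \<in> V"
  then have "(u, v) \<in> E\<^sup>*" using V_reach assms(1) by blast
  then show "v \<in> U" by (induction rule: rtrancl_induct) (use assms in auto)
qed

lemma p_in_V: "k \<le> m \<Longrightarrow> p k \<in> V"
  using near[of k "Suc k"] near[of k "k - 1"] E_sub N by (cases "k = m") auto

text \<open>The path closes up to a cycle. A neighbour outside would be a pendant vertex on a long
  cycle, so by connectedness there is nothing else, and the only chord is the closing edge.\<close>

lemma cycle_case:
  assumes "(p 0, p m) \<in> E" and v: "v \<in> V"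
  shows "card (E `` {v}) \<le> 2"
proof -
  have m: "12 \<le> m" using N by simp
  have out: False if "k \<le> m" "(p k, w) \<in> E" "w \<notin> p ` {..m}" for k w
  proof (rule no_cycle_with_pendant_at[of p "Suc m" w k])
    show "inj_on p {..<Suc m}" "w \<notin> p ` {..<Suc m}" using inj that by (simp_all add: lessThan_Suc_atMost)
    show "(p k, p (Suc k)) \<in> E" if "Suc k < Suc m" for k using that edge by simp
    show "(p (Suc m - 1), p 0) \<in> E" using E_sym[OF assms(1)] by simp
  qed (use that N in auto)
  have "V \<subseteq> p ` {..m}"
    by (rule reachable_closed[OF p_in_V[of 0]]) (use out in blast)+
  then obtain k where k: "k \<le> m" "v = p k" using v by auto
  have "E `` {v} \<subseteq> p ` (if k = 0 then {1, m} else if k = m then {0, m - 1} else {k - 1, Suc k})"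
  proof
    fix u assume u: "u \<in> E `` {v}"
    then have "u \<in> p ` {..m}" using out[of k u] k by blast
    then obtain l where l: "l \<le> m" "u = p l" by auto
    then have "l = Suc k \<or> k = Suc l \<or> {k, l} = {0, m}"
      using u k by (intro chord_cases) auto
    then have "l \<in> (if k = 0 then {1, m} else if k = m then {0, m - 1} else {k - 1, Suc k})"
      using k l m by (auto simp: doubleton_eq_iff)
    then show "u \<in> p ` (if k = 0 then {1, m} else if k = m then {0, m - 1} else {k - 1, Suc k})"
      using l by blast
  qed
  then have "card (E `` {v}) \<le> card (p ` (if k = 0 then {1, m} else if k = m then {0, m - 1} else {k - 1, Suc k}))"
    by (intro card_mono) auto
  also have "\<dots> \<le> card (if k = 0 then {1, m} else if k = m then {0, m - 1} else {k - 1, Suc k})"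
    by (intro card_image_le) auto
  also have "\<dots> \<le> 2" by (auto simp: card_insert_if)
  finally show ?thesis .
qed

section \<open>Neighbours outside the path\<close>

lemma no_insert:
  assumes "k < m" "w \<notin> p ` {..m}" "(p k, w) \<in> E" "(w, p (Suc k)) \<in> E"
  shows False
proof -
  define q where "q l = (if l \<le> k then p l else if l = Suc k then w else p (l - 1))" for l
  have "Suc m \<le> m"
  proof (rule longest[of q])
    show "inj_on q {..Suc m}"
    proof (rule inj_onI)
      fix a b assume ab: "a \<in> {..Suc m}" "b \<in> {..Suc m}" "q a = q b"
      have w: "w \<noteq> p l" "p l \<noteq> w" if "l \<le> m" for l using outside_neq assms(2) that by blast+
      define i where "i l = (if l \<le> k then l else l - 1)" for l :: nat
      have q: "q l = (if l = Suc k then w else p (i l))" for l by (auto simp: q_def i_def)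
      have i: "i a \<le> m" "i b \<le> m" using ab assms(1) by (auto simp: i_def)
      have "a = Suc k \<longleftrightarrow> b = Suc k" using ab(3) w i unfolding q by (auto split: if_splits)
      moreover have "i a = i b" if "a \<noteq> Suc k" "b \<noteq> Suc k"
        using ab(3) that i p_eq unfolding q by auto
      ultimately show "a = b" unfolding i_def by (auto split: if_splits)
    qed
    show "(q l, q (Suc l)) \<in> E" if "l < Suc m" for l
    proof -
      consider "l < k" | "l = k" | "l = Suc k" | "Suc k < l" by linarith
      then show ?thesis using assms that edge[of l] edge[of "l - 1"] by cases (auto simp: q_def)
    qed
  qed
  then show False by simp
qed

text \<open>By the distance of the two path vertices: 1 allows an insertion of \<open>w\<close>, 2
  gives a four-cycle with a pendant vertex, and 3 or more a spider at whichever of them has two path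
  vertices on both sides. The pair \<open>1\<close>, \<open>m - 1\<close> closes a long cycle
  through \<open>w\<close> with pendant \<open>p 0\<close>.\<close>

lemma no_common_outside:
  assumes "1 \<le> k" "k < j" "j < m" "(p k, w) \<in> E" "(p j, w) \<in> E" and w: "w \<notin> p ` {..m}"
  shows False
proof -
  have m: "12 \<le> m" using N by simp
  have neq: "p l \<noteq> w \<and> w \<noteq> p l" if "l \<le> m" for l using outside_neq[OF w that] .
  have wE: "(w, p k) \<in> E" "(w, p j) \<in> E" using assms E_sym by auto
  consider "j = Suc k" | "j = k + 2" | "k + 3 \<le> j" "j + 2 \<le> m" | "k + 3 \<le> j" "2 \<le> k" | "k = 1" "j = m - 1"
    using assms by linarith
  then show False
  proof cases
    case 1
    then show False using no_insert[of k w] assms wE by simp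
  next
    case 2
    have "distinct (map p [k, k + 1, k + 2, k - 1])" using 2 assms by (intro p_distinct) auto
    then have "distinct [p k, p (k + 1), p (k + 2), w, p (k - 1)]" using neq 2 assms by simp
    then show False
      by (rule no_banner[rotated -1]) (use 2 assms wE in \<open>auto intro!: near\<close>)
  next
    case 3
    have "distinct (map p [j, j + 1, j - 1, j + 2, j - 2, k])" using 3 assms by (intro p_distinct) auto
    then have "distinct [p j, p (j + 1), p (j - 1), w, p (j + 2), p (j - 2), p k]" using neq 3 assms by simp
    then show False
      by (rule no_spider[rotated -1]) (use 3 assms wE in \<open>auto intro!: near\<close>)
  next
    case 4
    have "distinct (map p [k, k + 1, k - 1, k + 2, k - 2, j])" using 4 assms by (intro p_distinct) auto
    then have "distinct [p k, p (k + 1), p (k - 1), w, p (k + 2), p (k - 2), p j]" using neq 4 assms by simp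
    then show False
      by (rule no_spider[rotated -1]) (use 4 assms wE in \<open>auto intro!: near\<close>)
  next
    case 5
    define g where "g l = (if l < m - 1 then p (Suc l) else w)" for l
    show False
    proof (rule no_cycle_with_pendant[of g m "p 0"])
      show "inj_on g {..<m}"
      proof (rule inj_onI)
        fix a b assume ab: "a \<in> {..<m}" "b \<in> {..<m}" "g a = g b"
        then have "Suc a \<le> m" "Suc b \<le> m" by auto
        then show "a = b" using ab neq[of "Suc a"] neq[of "Suc b"] p_eq[of "Suc a" "Suc b"]
          by (auto simp: g_def split: if_splits)
      qed
      show "(g l, g (Suc l)) \<in> E" if "Suc l < m" for l
      proof (cases "Suc l < m - 1")
        case True
        then show ?thesis using edge[of "Suc l"] by (simp add: g_def)
      next
        case False
        then have "Suc l = m - 1" using that by linarith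
        then show ?thesis using assms(5) 5 by (simp add: g_def)
      qed
      show "(g (m - 1), g 0) \<in> E" using wE 5 m by (simp add: g_def)
      show "p 0 \<notin> g ` {..<m}"
      proof
        assume "p 0 \<in> g ` {..<m}"
        then obtain l where "l < m" "p 0 = g l" by auto
        then show False using neq[of 0] p_eq[of 0 "Suc l"] by (auto simp: g_def split: if_splits)
      qed
      show "(g 0, p 0) \<in> E" using m near[of 1 0] by (simp add: g_def)
    qed (use N in simp)
  qed
qed

text \<open>Otherwise \<open>z\<close>, \<open>w\<close> could replace \<open>p 0\<close>, giving a
  longer path.\<close>

lemma no_two_step:
  assumes "(p 1, w) \<in> E" "(w, z) \<in> E" "w \<notin> p ` {..m}" "z \<notin> p ` {..m}"
  shows False
proof -
  define q where "q l = (if l = 0 then z else if l = 1 then w else p (l - 1))" for l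
  have wz: "w \<noteq> z" using assms(2) E_irr by auto
  have "Suc m \<le> m"
  proof (rule longest[of q])
    show "inj_on q {..Suc m}"
    proof (rule inj_onI)
      fix a b assume ab: "a \<in> {..Suc m}" "b \<in> {..Suc m}" "q a = q b"
      then have i: "a - 1 \<le> m" "b - 1 \<le> m" by auto
      show "a = b"
        using ab(3) wz outside_neq[OF assms(3) i(1)] outside_neq[OF assms(3) i(2)]
          outside_neq[OF assms(4) i(1)] outside_neq[OF assms(4) i(2)] p_eq[OF i]
        by (auto simp: q_def split: if_splits)
    qed
    show "(q l, q (Suc l)) \<in> E" if "l < Suc m" for l
    proof -
      consider "l = 0" | "l = 1" | "2 \<le> l" by linarith
      then show ?thesis using that E_sym[OF assms(1)] E_sym[OF assms(2)] edge[of "l - 1"]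
        by cases (auto simp: q_def)
    qed
  qed
  then show False by simp
qed

section \<open>The open path: leaves and their positions\<close>

context
  assumes open_path: "(p 0, p m) \<notin> E"
begin

lemma path_neighbour:
  assumes "k \<le> m" "l \<le> m" "(p k, p l) \<in> E"
  shows "l = Suc k \<or> k = Suc l"
  using chord_cases[OF assms] open_path E_sym assms by (auto simp: doubleton_eq_iff)

lemma outside_inner:
  assumes "k \<le> m" "(p k, w) \<in> E" "w \<notin> p ` {..m}"
  shows "1 \<le> k" "k < m"
  using assms end_neighbour[of w] other_end_neighbour[of w] by (cases "k = 0"; cases "k = m"; auto)+

text \<open>A second neighbour on the path is excluded by \<open>no_common_outside\<close>. One off
  the path gives a longer path if \<open>k\<close> is next to an end, and otherwise a spider whose
  third leg starts with \<open>w\<close>.\<close>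

lemma outside_leaf:
  assumes k: "k \<le> m" "(p k, w) \<in> E" and w: "w \<notin> p ` {..m}"
  shows "E `` {w} = {p k}"
proof -
  have km: "1 \<le> k" "k < m" using outside_inner[OF k w] .
  have "z = p k" if z: "(w, z) \<in> E" for z
  proof (rule ccontr)
    assume "z \<noteq> p k"
    show False
    proof (cases "z \<in> p ` {..m}")
      case True
      then obtain j where j: "j \<le> m" "z = p j" by auto
      then have "1 \<le> j" "j < m" using outside_inner[of j w] E_sym[OF z] w by auto
      moreover have "j \<noteq> k" using \<open>z \<noteq> p k\<close> j by auto
      ultimately show False
        using no_common_outside[of k j w] no_common_outside[of j k w] km k(2) E_sym[OF z] j w
        by (cases "k < j") auto
    next
      case False
      interpret r: longest_path V E N m "\<lambda>k. p (m - k)" by (rule reverse)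
      consider "k = 1" | "k = m - 1" | "2 \<le> k" "k + 2 \<le> m" using km by linarith
      then show False
      proof cases
        case 1
        then show False using no_two_step k z w False by simp
      next
        case 2
        then have "m - 1 = k" by simp
        then show False using r.no_two_step[of w z] k z w False by (simp add: image_reverse)
      next
        case 3
        have "distinct (map p [k, k - 1, k + 1, k - 2, k + 2])" using 3 by (intro p_distinct) auto
        moreover have "w \<noteq> z" using z E_irr by auto
        ultimately have "distinct [p k, p (k - 1), p (k + 1), w, p (k - 2), p (k + 2), z]"
          using outside_neq[OF w] outside_neq[OF False] 3 by simp
        then show False
          by (rule no_spider[rotated -1]) (use 3 k z in \<open>auto intro!: near\<close>)
      qed
    qed
  qed
  then show ?thesis using E_sym[OF k(2)] by blast
qed

definition attached :: "nat set" where
  "attached = {k. k \<le> m \<and> E `` {p k} - p ` {..m} \<noteq> {}}"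

lemma attached_pendant:
  assumes "k \<in> attached"
  obtains w where "1 \<le> k" "k < m" "(p k, w) \<in> E" "w \<notin> p ` {..m}" "E `` {w} = {p k}"
  using assms outside_inner outside_leaf unfolding attached_def by blast

lemma card_outside: "k \<le> m \<Longrightarrow> card (E `` {p k} - p ` {..m}) \<le> 1"
proof (rule ccontr)
  assume k: "k \<le> m" and "\<not> card (E `` {p k} - p ` {..m}) \<le> 1"
  then have "\<not> card (E `` {p k} - p ` {..m}) \<le> Suc 0" by simp
  \<comment> \<open>An infinite set would have cardinality 0, so the violated bound supplies
    finiteness.\<close>
  moreover from this have "finite (E `` {p k} - p ` {..m})" by (rule contrapos_np) simp
  ultimately have "\<not> (\<forall>a\<in>E `` {p k} - p ` {..m}. \<forall>b\<in>E `` {p k} - p ` {..m}. a = b)"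
    by (simp only: card_le_Suc0_iff_eq not_False_eq_True)
  then obtain w1 w2 where w: "(p k, w1) \<in> E" "(p k, w2) \<in> E" "w1 \<notin> p ` {..m}" "w2 \<notin> p ` {..m}" "w1 \<noteq> w2"
    by blast
  have km: "1 \<le> k" "k < m" using outside_inner[OF k w(1) w(3)] .
  have "distinct (map p [k, k - 1, k + 1])" using km by (intro p_distinct) auto
  then have "distinct [p k, p (k - 1), p (k + 1), w1, w2]"
    using outside_neq[OF w(3)] outside_neq[OF w(4)] w(5) km by simp
  then show False
    by (rule no_star4[rotated -1]) (use km w in \<open>auto intro!: near\<close>)
qed

lemma V_path: "w \<in> V - p ` {..m} \<Longrightarrow> \<exists>k\<in>attached. E `` {w} = {p k}"
proof -
  assume w: "w \<in> V - p ` {..m}"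
  define U where "U = p ` {..m} \<union> {w. \<exists>k\<le>m. (p k, w) \<in> E \<and> w \<notin> p ` {..m}}"
  have "V \<subseteq> U"
  proof (rule reachable_closed[OF p_in_V[of 0]])
    fix x y assume x: "x \<in> U" "(x, y) \<in> E"
    show "y \<in> U"
    proof (cases "x \<in> p ` {..m}")
      case True
      then show ?thesis using x by (auto simp: U_def)
    next
      case False
      then obtain k where "k \<le> m" "(p k, x) \<in> E" using x by (auto simp: U_def)
      then have "y = p k" using outside_leaf[of k x] False x(2) by blast
      then show ?thesis using \<open>k \<le> m\<close> by (auto simp: U_def)
    qed
  qed (auto simp: U_def)
  then obtain k where "k \<le> m" "(p k, w) \<in> E" using w by (auto simp: U_def)
  then show ?thesis using outside_leaf[of k w] w unfolding attached_def by blast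
qed

lemma attached_near_end:
  assumes "k \<in> attached"
  shows "k < N \<or> m - k < N"
proof (rule ccontr)
  assume far: "\<not> ?thesis"
  obtain w where w: "1 \<le> k" "k < m" "(p k, w) \<in> E" "w \<notin> p ` {..m}" "E `` {w} = {p k}"
    using attached_pendant[OF assms] .
  have "caterpillar_in E (k + (m - k)) p {k} (\<lambda>_. w)"
    using w inj edge by (auto simp: caterpillar_in_def)
  then show False by (rule no_middle) (use far in auto)
qed

lemma attached_two:
  assumes "k \<in> attached" "l \<in> attached" "k < l"
  shows "m - l < N"
proof (rule ccontr)
  assume far: "\<not> ?thesis"
  obtain w where w: "1 \<le> k" "k < m" "(p k, w) \<in> E" "w \<notin> p ` {..m}" "E `` {w} = {p k}"
    using attached_pendant[OF assms(1)] .
  obtain v where v: "1 \<le> l" "l < m" "(p l, v) \<in> E" "v \<notin> p ` {..m}" "E `` {v} = {p l}"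
    using attached_pendant[OF assms(2)] .
  have "w \<noteq> v" using w(5) v(5) p_eq[of k l] w(2) v(2) assms(3) by auto
  then have "caterpillar_in E (l + (m - l)) p {k, l} (\<lambda>x. if x = k then w else v)"
    using w v inj edge assms(3) by (auto simp: caterpillar_in_def)
  then show False by (rule no_two) (use far w assms(3) in auto)
qed

lemma card_le_2_if_unattached:
  assumes "attached = {}" "v \<in> V"
  shows "card (E `` {v}) \<le> 2"
proof -
  obtain k where k: "k \<le> m" "v = p k" using V_path[of v] assms by auto
  \<comment> \<open>For \<open>k = 0\<close> the truncated difference adds \<open>p 0\<close>
    itself, which is harmless for an upper bound.\<close>
  have "E `` {v} \<subseteq> p ` {k - 1, Suc k}"
  proof
    fix u assume u: "u \<in> E `` {v}"
    then have "u \<in> p ` {..m}" using assms(1) k unfolding attached_def by blast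
    then obtain l where l: "l \<le> m" "u = p l" by auto
    then have "l = Suc k \<or> k = Suc l" using u k path_neighbour[of k l] by simp
    then show "u \<in> p ` {k - 1, Suc k}" using l by auto
  qed
  then have "card (E `` {v}) \<le> card (p ` {k - 1, Suc k})" by (intro card_mono) auto
  also have "\<dots> \<le> card {k - 1, Suc k}" by (intro card_image_le) auto
  also have "\<dots> \<le> 2" by (auto simp: card_insert_if)
  finally show ?thesis .
qed

end

end

section \<open>Reduction to large connected graphs\<close>

text \<open>The radius depends only on the relation \<open>R\<close> induced on the positions of the
  vertices, and there are finitely many such relations for each order, whatever natural numbers
  label the vertices.\<close>

lemma finite_rad_values: "finite {rad \<sigma> G | G. pair_graph G \<and> card (pverts G) \<le> K}"
proof -
  define M where "M n R = map_mat complex_of_real (Matrix.mat n n (\<lambda>(i, j). if i = j then real (card (R `` {i})) else 0)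
    + \<sigma> \<cdot>\<^sub>m Matrix.mat n n (\<lambda>(i, j). if (i, j) \<in> R then 1 else 0))" for n :: nat and R
  have "rad \<sigma> G \<in> (\<Union>n\<le>K. (\<lambda>R. spectral_radius (M n R)) ` Pow ({..<n} \<times> {..<n}))"
    if G: "pair_graph G" "card (pverts G) \<le> K" for G
  proof -
    let ?n = "card (pverts G)" and ?v = "\<lambda>i. vertex_list G ! i"
    define R where "R = {(i, j). i < ?n \<and> j < ?n \<and> (?v i, ?v j) \<in> parcs G}"
    have inj: "inj_on ?v {..<?n}"
      using vertex_list_props[OF G(1)] by (auto simp: inj_on_def nth_eq_iff_index_eq)
    have deg: "out_degree (with_proj G) (?v i) = card (R `` {i})" if "i < ?n" for i
    proof -
      have "parcs G `` {?v i} = ?v ` (R `` {i})"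
      proof (rule subset_antisym; rule subsetI)
        fix u assume u: "u \<in> parcs G `` {?v i}"
        then have "u \<in> pverts G" using arc_snd[OF G(1)] by blast
        from vertex_index[OF G(1) this] obtain j where "j < ?n" "u = ?v j" .
        then show "u \<in> ?v ` (R `` {i})" using u that by (auto simp: R_def)
      qed (auto simp: R_def)
      moreover have "inj_on ?v (R `` {i})" by (rule inj_on_subset[OF inj]) (auto simp: R_def)
      ultimately show ?thesis by (simp add: out_degree_eq[OF G(1)] card_image)
    qed
    have "signed_laplacian \<sigma> G = M ?n R"
      unfolding signed_laplacian_def M_def degree_matrix_def adjacency_matrix_def
      by (intro arg_cong[of _ _ "map_mat complex_of_real"] eq_matI) (auto simp: R_def deg)
    then have eq: "rad \<sigma> G = spectral_radius (M ?n R)" by (simp add: rad_def)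
    have "R \<in> Pow ({..<?n} \<times> {..<?n})" by (auto simp: R_def)
    then show ?thesis using G(2) by (intro UN_I[of ?n] image_eqI[where x = R] eq) simp_all
  qed
  then have "{rad \<sigma> G | G. pair_graph G \<and> card (pverts G) \<le> K}
      \<subseteq> (\<Union>n\<le>K. (\<lambda>R. spectral_radius (M n R)) ` Pow ({..<n} \<times> {..<n}))" by blast
  then show ?thesis by (rule finite_subset) auto
qed

section \<open>Passing to connected graphs without twins\<close>

definition connected_graph :: "nat pair_pre_digraph \<Rightarrow> bool" where
  "connected_graph G \<longleftrightarrow> pair_graph G \<and> pverts G \<noteq> {} \<and> (\<forall>u\<in>pverts G. \<forall>v\<in>pverts G. (u, v) \<in> (parcs G)\<^sup>*)"

lemma pair_graphI:
  assumes "finite V" "\<And>u v. (u, v) \<in> E \<Longrightarrow> u \<in> V" "\<And>u v. (u, v) \<in> E \<Longrightarrow> (v, u) \<in> E" "\<And>u. (u, u) \<notin> E"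
  shows "pair_graph \<lparr>pverts = V, parcs = E\<rparr>"
proof -
  have "E \<subseteq> V \<times> V" using assms(2,3) by auto
  then have "finite E" using assms(1) finite_subset by blast
  moreover have "symmetric (with_proj \<lparr>pverts = V, parcs = E\<rparr>)"
    using assms(3) by (auto simp: symmetric_def sym_def)
  ultimately show ?thesis
    using assms by unfold_locales (auto, metis assms(4))
qed

lemma rad_ge_of_eigenfunction:
  assumes G: "pair_graph G" and \<sigma>: "\<sigma> \<in> {-1, 1}" and z: "\<exists>v\<in>pverts G. z v \<noteq> 0"
    and "\<And>v. v \<in> pverts G \<Longrightarrow> sop \<sigma> (parcs G) z v = \<mu> * z v"
  shows "\<mu> \<le> rad \<sigma> G"
proof (rule rad_ge_of_form[OF G \<sigma> z])
  have "(\<Sum>v\<in>pverts G. z v * sop \<sigma> (parcs G) z v) = (\<Sum>v\<in>pverts G. \<mu> * (z v)\<^sup>2)"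
    using assms(4) by (intro sum.cong) (simp_all add: power2_eq_square)
  then show "\<mu> * (\<Sum>v\<in>pverts G. (z v)\<^sup>2) \<le> (\<Sum>v\<in>pverts G. z v * sop \<sigma> (parcs G) z v)"
    by (simp add: sum_distrib_left)
qed

text \<open>Take the component of a vertex where an eigenfunction for \<open>rad\<close> is nonzero:
  the restriction remains an eigenfunction with the same eigenvalue.\<close>

lemma exists_connected_same_rad:
  assumes G: "pair_graph G" and \<sigma>: "\<sigma> \<in> {-1, 1}" and ne: "pverts G \<noteq> {}"
  obtains H where "connected_graph H" "rad \<sigma> H = rad \<sigma> G"
proof -
  obtain z where z: "\<exists>v\<in>pverts G. z v \<noteq> 0"
    "\<And>v. v \<in> pverts G \<Longrightarrow> sop \<sigma> (parcs G) z v = rad \<sigma> G * z v"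
    using rad_eigenfunction[OF G \<sigma> ne] by metis
  then obtain a where a: "a \<in> pverts G" "z a \<noteq> 0" by auto
  define C where "C = (parcs G)\<^sup>* `` {a}"
  define H where "H = \<lparr>pverts = C, parcs = parcs G \<inter> C \<times> C\<rparr>"
  have CV: "C \<subseteq> pverts G"
  proof
    fix v assume "v \<in> C"
    then have "(a, v) \<in> (parcs G)\<^sup>*" by (simp add: C_def)
    then show "v \<in> pverts G" by (induction rule: rtrancl_induct) (auto intro: a(1) arc_snd[OF G])
  qed
  have aC: "a \<in> C" by (simp add: C_def)
  have closed: "v \<in> C" if "u \<in> C" "(u, v) \<in> parcs G" for u v
    using that unfolding C_def by (auto intro: rtrancl_into_rtrancl)
  have H: "pair_graph H"
    unfolding H_def using finite_subset[OF CV finite_pverts[OF G]] arc_sym[OF G] no_loop[OF G]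
    by (intro pair_graphI) auto
  have reach: "(a, v) \<in> (parcs H)\<^sup>*" if "v \<in> C" for v
  proof -
    have "(a, v) \<in> (parcs G)\<^sup>*" using that by (simp add: C_def)
    then have "v \<in> C \<and> (a, v) \<in> (parcs H)\<^sup>*"
    proof (induction rule: rtrancl_induct)
      case base
      then show ?case using aC by simp
    next
      case (step u v)
      then have "v \<in> C" using closed by blast
      then have "(u, v) \<in> parcs H" using step by (simp add: H_def)
      then show ?case using step \<open>v \<in> C\<close> by (auto intro: rtrancl_into_rtrancl)
    qed
    then show ?thesis ..
  qed
  have symH: "sym ((parcs H)\<^sup>*)" using arc_sym[OF H] by (intro sym_rtrancl) (auto simp: sym_def)
  have "connected_graph H"
    unfolding connected_graph_def
  proof (intro conjI ballI)
    show "pverts H \<noteq> {}" using aC by (auto simp: H_def)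
    fix u v assume "u \<in> pverts H" "v \<in> pverts H"
    then have "(a, u) \<in> (parcs H)\<^sup>*" "(a, v) \<in> (parcs H)\<^sup>*" using reach by (simp_all add: H_def)
    then show "(u, v) \<in> (parcs H)\<^sup>*" using symH by (meson rtrancl_trans symD)
  qed (rule H)
  moreover have "rad \<sigma> H = rad \<sigma> G"
  proof (rule antisym)
    show "rad \<sigma> H \<le> rad \<sigma> G"
      by (rule rad_mono[OF G H \<sigma>]) (use CV aC in \<open>auto simp: H_def\<close>)
    show "rad \<sigma> G \<le> rad \<sigma> H"
    proof (rule rad_ge_of_eigenfunction[OF H \<sigma>])
      show "\<exists>v\<in>pverts H. z v \<noteq> 0" using a aC by (auto simp: H_def)
      fix v assume v: "v \<in> pverts H"
      then have "parcs H `` {v} = parcs G `` {v}" using closed by (auto simp: H_def)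
      then show "sop \<sigma> (parcs H) z v = rad \<sigma> G * z v"
        using z(2)[of v] v CV by (auto simp: sop_def H_def)
    qed
  qed
  ultimately show thesis by (rule that)
qed

text \<open>An eigenfunction takes the same value on both twins unless its eigenvalue is 3.\<close>

lemma rad_delete_twin_edge:
  assumes C: "connected_graph H" and \<rho>: "3 < rad (-1) H"
    and twins: "parcs H `` {u} = {v, w}" "parcs H `` {v} = {u, w}"
  obtains H' where "connected_graph H'" "rad (-1) H' = rad (-1) H" "card (parcs H') < card (parcs H)"
proof -
  have H: "pair_graph H" and ne: "pverts H \<noteq> {}" using C by (auto simp: connected_graph_def)
  define H' where "H' = \<lparr>pverts = pverts H, parcs = parcs H - {(u, v), (v, u)}\<rparr>"
  have uv: "(u, v) \<in> parcs H" "(v, u) \<in> parcs H" "(u, w) \<in> parcs H" "(v, w) \<in> parcs H" using twins by auto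
  then have neq: "u \<noteq> v" "u \<noteq> w" "v \<noteq> w" using no_loop[OF H] by auto
  have H': "pair_graph H'"
    unfolding H'_def using finite_pverts[OF H] arc_sym[OF H] no_loop[OF H] arc_fst[OF H] by (intro pair_graphI) auto
  have "(u, w) \<in> parcs H'" "(w, u) \<in> parcs H'" "(v, w) \<in> parcs H'" "(w, v) \<in> parcs H'"
    using uv arc_sym[OF H] neq by (auto simp: H'_def)
  then have "(u, v) \<in> (parcs H')\<^sup>*" "(v, u) \<in> (parcs H')\<^sup>*"
    by (meson converse_rtrancl_into_rtrancl r_into_rtrancl)+
  then have "parcs H \<subseteq> (parcs H')\<^sup>*" by (auto simp: H'_def)
  then have "(parcs H)\<^sup>* \<subseteq> (parcs H')\<^sup>*" by (rule rtrancl_subset_rtrancl)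
  then have C': "connected_graph H'"
    using C H' unfolding connected_graph_def by (auto simp: H'_def)
  obtain z where z: "\<exists>v\<in>pverts H. z v \<noteq> 0"
    "\<And>v. v \<in> pverts H \<Longrightarrow> sop (-1) (parcs H) z v = rad (-1) H * z v"
    using rad_eigenfunction[OF H _ ne, of "-1"] by auto
  have "u \<in> pverts H" "v \<in> pverts H" using uv arc_fst[OF H] by auto
  from z(2)[OF this(1)] z(2)[OF this(2)]
  have "(z u - z v) + (z u - z w) = rad (-1) H * z u" "(z v - z u) + (z v - z w) = rad (-1) H * z v"
    using neq by (simp_all add: sop_def twins)
  then have "(rad (-1) H - 3) * (z u - z v) = 0" by (simp add: algebra_simps)
  then have zuv: "z u = z v" using \<rho> by simp
  have "sop (-1) (parcs H') z x = sop (-1) (parcs H) z x" for x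
    unfolding sop_def
    by (rule sum.mono_neutral_left[OF finite_neighbours[OF H]]) (auto simp: H'_def zuv)
  then have "rad (-1) H \<le> rad (-1) H'"
    using z by (intro rad_ge_of_eigenfunction[OF H', of _ z]) (auto simp: H'_def)
  moreover have "rad (-1) H' \<le> rad (-1) H"
    using ne by (intro rad_mono[OF H H']) (auto simp: H'_def)
  moreover have "card (parcs H') < card (parcs H)"
    using uv finite_parcs[OF H] by (intro psubset_card_mono) (auto simp: H'_def)
  ultimately show thesis using C' by (intro that) auto
qed

definition twin_free :: "nat pair_pre_digraph \<Rightarrow> bool" where
  "twin_free G \<longleftrightarrow> (\<forall>u v w. parcs G `` {u} = {v, w} \<longrightarrow> parcs G `` {v} \<noteq> {u, w})"

text \<open>Among the connected graphs of the given radius choose one with the fewest arcs; deleting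
  a twin edge would contradict minimality.\<close>

lemma exists_twin_free_same_rad:
  assumes G: "pair_graph G" and \<sigma>: "\<sigma> \<in> {-1, 1}" and ne: "pverts G \<noteq> {}"
  obtains H where "connected_graph H" "rad \<sigma> H = rad \<sigma> G" "\<sigma> = -1 \<Longrightarrow> 3 < rad \<sigma> G \<Longrightarrow> twin_free H"
proof -
  obtain H0 where "connected_graph H0 \<and> rad \<sigma> H0 = rad \<sigma> G" using exists_connected_same_rad[OF assms] by metis
  from ex_has_least_nat[of "\<lambda>H. connected_graph H \<and> rad \<sigma> H = rad \<sigma> G", OF this, of "\<lambda>H. card (parcs H)"]
  obtain H where H: "connected_graph H" "rad \<sigma> H = rad \<sigma> G"
    "\<And>H'. connected_graph H' \<Longrightarrow> rad \<sigma> H' = rad \<sigma> G \<Longrightarrow> card (parcs H) \<le> card (parcs H')" by blast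
  have "twin_free H" if s: "\<sigma> = -1" and r: "3 < rad \<sigma> G"
    unfolding twin_free_def
  proof (intro allI impI notI)
    fix u v w assume twins: "parcs H `` {u} = {v, w}" "parcs H `` {v} = {u, w}"
    have "3 < rad (-1) H" using H(2) s r by simp
    then obtain H' where "connected_graph H'" "rad (-1) H' = rad (-1) H" "card (parcs H') < card (parcs H)"
      using rad_delete_twin_edge[OF H(1) _ twins] by blast
    then show False using H(2) H(3)[of H'] s by simp
  qed
  with H(1,2) show thesis by (intro that)
qed

text \<open>Shortest walks are injective.\<close>

lemma card_le_of_path_bound:
  assumes C: "connected_graph G" and deg: "\<And>v. card (parcs G `` {v}) \<le> 3"
    and paths: "\<And>q l. inj_on q {..l} \<Longrightarrow> (\<And>k. k < l \<Longrightarrow> (q k, q (Suc k)) \<in> parcs G) \<Longrightarrow> l \<le> m"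
  shows "card (pverts G) \<le> Suc m * 3 ^ m"
proof -
  have G: "pair_graph G" using C by (simp add: connected_graph_def)
  let ?E = "parcs G"
  obtain a where a: "a \<in> pverts G" using C by (auto simp: connected_graph_def)
  have B: "finite ((?E ^^ k) `` {a}) \<and> card ((?E ^^ k) `` {a}) \<le> 3 ^ k" for k
  proof (induction k)
    case (Suc k)
    have eq: "(?E ^^ Suc k) `` {a} = (\<Union>v\<in>(?E ^^ k) `` {a}. ?E `` {v})" by auto
    have "card ((?E ^^ Suc k) `` {a}) \<le> (\<Sum>v\<in>(?E ^^ k) `` {a}. card (?E `` {v}))"
      unfolding eq by (rule card_UN_le) (use Suc in blast)
    also have "\<dots> \<le> (\<Sum>v\<in>(?E ^^ k) `` {a}. 3)" by (intro sum_mono deg)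
    also have "\<dots> \<le> 3 ^ Suc k" using Suc by simp
    finally show ?case unfolding eq using Suc finite_neighbours[OF G] by auto
  qed simp
  have "pverts G \<subseteq> (\<Union>k\<le>m. (?E ^^ k) `` {a})"
  proof
    fix x assume "x \<in> pverts G"
    then have "(a, x) \<in> ?E\<^sup>*" using C a by (auto simp: connected_graph_def)
    then obtain k0 where "(a, x) \<in> ?E ^^ k0" using rtrancl_imp_relpow by blast
    define k where "k = (LEAST k. (a, x) \<in> ?E ^^ k)"
    have k: "(a, x) \<in> ?E ^^ k" unfolding k_def by (rule LeastI) fact
    have least: "k \<le> l" if "(a, x) \<in> ?E ^^ l" for l unfolding k_def by (rule Least_le) fact
    from k obtain f where f: "f 0 = a" "f k = x" "\<And>i. i < k \<Longrightarrow> (f i, f (Suc i)) \<in> ?E"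
      by (auto simp: relpow_fun_conv)
    have segment: "(f i, f (i + d)) \<in> ?E ^^ d" if "i + d \<le> k" for i d
      unfolding relpow_fun_conv
      by (rule exI[of _ "\<lambda>j. f (i + j)"]) (use that f(3) in auto)
    have "f i \<noteq> f j" if "i < j" "j \<le> k" for i j
    proof
      assume eq: "f i = f j"
      have "(a, f i) \<in> ?E ^^ i" using segment[of 0 i] that f(1) by simp
      moreover have "(f j, x) \<in> ?E ^^ (k - j)" using segment[of j "k - j"] that f(2) by simp
      ultimately have "(a, x) \<in> ?E ^^ (i + (k - j))" unfolding relpow_add eq by (rule relcompI)
      then show False using least[of "i + (k - j)"] that by simp
    qed
    then have "inj_on f {..k}" unfolding inj_on_def by (metis atMost_iff linorder_neqE_nat)
    then have "k \<le> m" using paths f(3) by blast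
    then show "x \<in> (\<Union>k\<le>m. (?E ^^ k) `` {a})" using k by blast
  qed
  then have "card (pverts G) \<le> card (\<Union>k\<le>m. (?E ^^ k) `` {a})"
    using B by (intro card_mono) auto
  also have "\<dots> \<le> (\<Sum>k\<le>m. card ((?E ^^ k) `` {a}))" by (rule card_UN_le) simp
  also have "\<dots> \<le> (\<Sum>k\<le>m. 3 ^ m)"
  proof (intro sum_mono)
    fix k assume "k \<in> {..m}"
    then have "(3::nat) ^ k \<le> 3 ^ m" by (intro power_increasing) auto
    then show "card ((?E ^^ k) `` {a}) \<le> 3 ^ m" using B[of k] by linarith
  qed
  finally show ?thesis by simp
qed

section \<open>From large order to a cycle, a path or a caterpillar\<close>

lemma exists_longest_path:
  fixes G :: "nat pair_pre_digraph"
  assumes G: "pair_graph G" and ne: "pverts G \<noteq> {}"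
  obtains m p where "inj_on p {..m}" "\<And>k. k < m \<Longrightarrow> (p k, p (Suc k)) \<in> parcs G"
    "\<And>q l. inj_on q {..l} \<Longrightarrow> (\<And>k. k < l \<Longrightarrow> (q k, q (Suc k)) \<in> parcs G) \<Longrightarrow> l \<le> m"
proof -
  define P where "P l \<longleftrightarrow> (\<exists>q. inj_on q {..l} \<and> (\<forall>k<l. (q k, q (Suc k)) \<in> parcs G))" for l :: nat
  have "P 0" by (auto simp: P_def)
  have bound: "l \<le> card (pverts G)" if Pl: "P l" for l
  proof (cases "l = 0")
    case False
    obtain q where q: "inj_on q {..l}" "\<forall>k<l. (q k, q (Suc k)) \<in> parcs G" using Pl by (auto simp: P_def)
    then have "q ` {..<l} \<subseteq> pverts G" using arc_fst[OF G] by blast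
    then have "card (q ` {..<l}) \<le> card (pverts G)" using finite_pverts[OF G] by (intro card_mono)
    moreover have "card (q ` {..<l}) = l" using inj_on_subset[OF q(1), of "{..<l}"] by (simp add: card_image subset_iff)
    ultimately show ?thesis by simp
  qed simp
  define m where "m = (GREATEST l. P l)"
  have "P m" unfolding m_def by (rule GreatestI_nat[where P = P, OF \<open>P 0\<close>]) (rule bound)
  moreover have "l \<le> m" if "P l" for l unfolding m_def by (rule Greatest_le_nat[where P = P, OF that]) (rule bound)
  ultimately show thesis using that unfolding P_def by blast
qed

text \<open>Of at most two positions, \<open>i\<close> is the larger distance from the respective
  end; the two alternatives differ by reversal of the path.\<close>

lemma near_ends_cases:
  fixes A :: "nat set"
  assumes A: "A \<noteq> {}" "\<And>k. k \<in> A \<Longrightarrow> 1 \<le> k \<and> k < m" and N: "2 * N \<le> m" "2 \<le> N"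
    and one: "\<And>k. k \<in> A \<Longrightarrow> k < N \<or> m - k < N"
    and two: "\<And>k l. k \<in> A \<Longrightarrow> l \<in> A \<Longrightarrow> k < l \<Longrightarrow> k < N \<and> m - l < N"
  obtains i j where "1 \<le> j" "j \<le> i" "i < N" "i \<in> A \<and> A \<subseteq> {i, m - j} \<or> m - i \<in> A \<and> A \<subseteq> {m - i, j}"
proof -
  have "A \<subseteq> {..m}" using A(2) by (meson atMost_iff less_imp_le subsetI)
  then have fin: "finite A" using finite_subset by blast
  define k l where "k = Min A" and "l = Max A"
  have kl: "k \<in> A" "l \<in> A" "\<And>x. x \<in> A \<Longrightarrow> k \<le> x \<and> x \<le> l"
    using fin A(1) by (auto simp: k_def l_def)
  have AE: "A = {k, l}"
  proof (rule subset_antisym; rule subsetI)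
    fix x assume x: "x \<in> A"
    show "x \<in> {k, l}"
    proof (rule ccontr)
      assume "x \<notin> {k, l}"
      then have "k < x" "x < l" using kl(3)[OF x] by auto
      \<comment> \<open>Paired with the minimum, \<open>x\<close> is near the right end; paired with
        the maximum, it is near the left one. The bound \<open>2 * N \<le> m\<close> forbids both at
        once.\<close>
      then have "m - x < N" "x < N" using two[of k x] two[of x l] x kl by auto
      then show False using N by linarith
    qed
  qed (use kl in auto)
  show thesis
  proof (cases "k = l")
    case True
    then have "A = {k}" using AE by simp
    \<comment> \<open>With a single position the inclusion leaves \<open>j\<close> free, and
      \<open>j = 1\<close> meets the bounds.\<close>
    then show thesis
      using one[of k] A(2)[of k] kl that[of 1 k] that[of 1 "m - k"] by auto
  next
    case False
    then have "k < l" using kl(3)[OF kl(2)] by simp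
    then have *: "k < N" "m - l < N" using two[OF kl(1,2)] by auto
    have b: "1 \<le> k" "l < m" using A(2) kl by auto
    show thesis
    proof (cases "m - l \<le> k")
      case True
      then show thesis using that[of "m - l" k] * b AE by auto
    next
      case False
      then show thesis using that[of k "m - l"] * b AE by auto
    qed
  qed
qed

lemma (in longest_path) attached_two':
  assumes "(p 0, p m) \<notin> E" "k \<in> attached" "l \<in> attached" "k < l"
  shows "k < N"
proof (rule ccontr)
  assume far: "\<not> ?thesis"
  obtain w where w: "1 \<le> k" "k < m" "(p k, w) \<in> E" "w \<notin> p ` {..m}" "E `` {w} = {p k}"
    using attached_pendant[OF assms(1,2)] .
  obtain v where v: "1 \<le> l" "l < m" "(p l, v) \<in> E" "v \<notin> p ` {..m}" "E `` {v} = {p l}"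
    using attached_pendant[OF assms(1,3)] .
  have "w \<noteq> v" using w(5) v(5) p_eq[of k l] w(2) v(2) assms(4) by auto
  have rev: "inj_on (\<lambda>k. p (m - k)) {..m}" by (rule inj_on_reverse[OF inj])
  have "caterpillar_in E m (\<lambda>k. p (m - k)) {m - l, m - k} (\<lambda>x. if x = m - k then w else v)"
    unfolding caterpillar_in_def image_reverse
  proof (intro conjI allI impI ballI)
    show "(p (m - x), p (m - Suc x)) \<in> E" if "x < m" for x
      using that by (intro near) auto
    show "inj_on (\<lambda>x. if x = m - k then w else v) {m - l, m - k}"
      using \<open>w \<noteq> v\<close> by (auto simp: inj_on_def)
    show "(p (m - x), if x = m - k then w else v) \<in> E" "(if x = m - k then w else v) \<notin> p ` {..m}"
      if "x \<in> {m - l, m - k}" for x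
      using that w v assms(4) by (auto simp: diff_diff_cancel)
  qed (use rev in auto)
  then have "caterpillar_in E ((m - k) + k) (\<lambda>k. p (m - k)) {m - l, m - k} (\<lambda>x. if x = m - k then w else v)"
    using w(2) by simp
  then show False by (rule no_two) (use far v w assms(4) in auto)
qed

text \<open>Reversing the path where necessary puts the pendant vertex that is farther from its own
  end at position \<open>i\<close> on the left.\<close>

lemma longest_path_cases:
  assumes G: "pair_graph G" and lp: "longest_path (pverts G) (parcs G) N m p"
  obtains "\<And>v. v \<in> pverts G \<Longrightarrow> card (parcs G `` {v}) \<le> 2"
  | q S i j where "caterpillar G m q S" "1 \<le> j" "j \<le> i" "i < N" "i \<in> S" "S \<subseteq> {i, m - j}"
proof -
  interpret longest_path "pverts G" "parcs G" N m p by (rule lp)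
  show thesis
  proof (cases "(p 0, p m) \<in> parcs G")
    case True
    then show thesis using that(1) cycle_case by blast
  next
    case False
    note o = False
    show thesis
    proof (cases "attached = {}")
      case True
      then show thesis using that(1) card_le_2_if_unattached[OF o] by blast
    next
      case False
      have cat: "caterpillar G m p attached"
        unfolding caterpillar_def
      proof (intro conjI)
        show "p ` {..m} \<subseteq> pverts G" using p_in_V by blast
        show "\<forall>k<m. (p k, p (Suc k)) \<in> parcs G" using edge by blast
        show "\<forall>k\<le>m. \<forall>l\<le>m. (p k, p l) \<in> parcs G \<longrightarrow> l = Suc k \<or> k = Suc l"
          using path_neighbour[OF o] by blast
        show "\<forall>w\<in>pverts G - p ` {..m}. \<exists>k\<in>attached. parcs G `` {w} = {p k}"
          using V_path[OF o] by blast
        show "\<forall>k\<le>m. card (parcs G `` {p k} - p ` {..m}) \<le> 1" using card_outside[OF o] by blast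
        show "attached = {k. k \<le> m \<and> parcs G `` {p k} - p ` {..m} \<noteq> {}}" by (rule attached_def[OF o])
      qed (rule inj)
      have inner: "1 \<le> k \<and> k < m" if "k \<in> attached" for k
        using attached_pendant[OF o that] by blast
      obtain i j where ij: "1 \<le> j" "j \<le> i" "i < N"
        "i \<in> attached \<and> attached \<subseteq> {i, m - j} \<or> m - i \<in> attached \<and> attached \<subseteq> {m - i, j}"
        by (rule near_ends_cases[of attached m N])
          (use False inner N attached_near_end[OF o] attached_two[OF o] attached_two'[OF o] in auto)
      then consider "i \<in> attached" "attached \<subseteq> {i, m - j}" | "m - i \<in> attached" "attached \<subseteq> {m - i, j}" by blast
      then show thesis
      proof cases
        case 1
        then show thesis using that(2)[OF cat] ij by blast
      next
        case 2
        have im: "i \<le> m" using ij N by simp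
        show thesis
        proof (rule that(2)[OF caterpillar_reverse[OF G cat]])
          show "i \<in> (-) m ` attached" using 2 im by (intro image_eqI[of _ _ "m - i"]) auto
          show "(-) m ` attached \<subseteq> {i, m - j}" using 2(2) im by auto
        qed (use ij in auto)
      qed
    qed
  qed
qed

text \<open>The two boundary losses of a pendant vertex in the middle amount to at most
  \<open>4 * tau ^ (2 * N)\<close>, less than the gap between \<open>c\<close> and
  \<open>2 + epsilon\<close>.\<close>

lemma longest_path_of_small_rad:
  assumes C: "connected_graph G" and \<sigma>: "\<sigma> \<in> {-1, 1}" and tf: "\<sigma> = -1 \<Longrightarrow> twin_free G"
    and c: "rad \<sigma> G \<le> c" "c < 2 + epsilon" "4 * tau ^ (2 * N) < 2 + epsilon - c"
    and N: "2 \<le> N" "2 * N + 8 \<le> m"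
    and p: "inj_on p {..m}" "\<And>k. k < m \<Longrightarrow> (p k, p (Suc k)) \<in> parcs G"
      "\<And>q l. inj_on q {..l} \<Longrightarrow> (\<And>k. k < l \<Longrightarrow> (q k, q (Suc k)) \<in> parcs G) \<Longrightarrow> l \<le> m"
  shows "longest_path (pverts G) (parcs G) N m p"
proof (rule longest_path.intro)
  have G: "pair_graph G" using C by (simp add: connected_graph_def)
  let ?E = "parcs G"
  have lt: "rad \<sigma> G < 4384 / 1000" using c two_plus_epsilon_less by simp
  have pow: "tau ^ (2 * r) \<le> tau ^ (2 * N)" if "N \<le> r" for r
    using tau that by (intro power_decreasing) auto
  show "(u, v) \<in> ?E \<Longrightarrow> u \<in> pverts G" "(u, v) \<in> ?E \<Longrightarrow> (v, u) \<in> ?E" "(u, u) \<notin> ?E" for u v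
    using arc_fst[OF G] arc_sym[OF G] no_loop[OF G] by auto
  show "(u, v) \<in> ?E\<^sup>*" if "u \<in> pverts G" "v \<in> pverts G" for u v
    using C that by (simp add: connected_graph_def)
  show False if "(c, a1) \<in> ?E" "(c, a2) \<in> ?E" "(c, a3) \<in> ?E" "(c, a4) \<in> ?E"
    "distinct [c, a1, a2, a3, a4]" for c a1 a2 a3 a4
    using rad_star4[OF G \<sigma> that] lt by simp
  show False if "(c, a1) \<in> ?E" "(c, a2) \<in> ?E" "(c, a3) \<in> ?E" "(a1, b1) \<in> ?E" "(a2, b2) \<in> ?E" "(a3, b3) \<in> ?E"
    "distinct [c, a1, a2, a3, b1, b2, b3]" for c a1 a2 a3 b1 b2 b3
    using rad_spider222[OF G \<sigma> that] lt by simp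
  show False if "(a, b) \<in> ?E" "(b, c) \<in> ?E" "(c, d) \<in> ?E" "(d, a) \<in> ?E" "(a, e) \<in> ?E" "distinct [a, b, c, d, e]"
    for a b c d e
    using rad_banner[OF G \<sigma> that] lt by simp
  show "paw_free ?E
      \<or> bull_free ?E
        \<and> (\<forall>u v w. ?E `` {u} = {v, w} \<longrightarrow> ?E `` {v} = {u, w} \<longrightarrow> False)"
  proof (cases "\<sigma> = 1")
    case True
    then have "rad 1 G < 4384 / 1000" using lt by simp
    then show ?thesis using rad_paw[OF G] by (meson not_less)
  next
    case False
    then have s: "\<sigma> = -1" using \<sigma> by auto
    then have "rad (-1) G < 4384 / 1000" using lt by simp
    moreover have "\<forall>u v w. ?E `` {u} = {v, w} \<longrightarrow> ?E `` {v} = {u, w} \<longrightarrow> False"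
      using tf[OF s] by (simp add: twin_free_def)
    ultimately show ?thesis using rad_long_bull[OF G] by (meson not_less)
  qed
  show False if "caterpillar_in ?E (a + r) q S w" "a \<in> S" "N \<le> a" "N \<le> r" for a r q S w
  proof -
    have "2 + epsilon - 2 * (tau ^ (2 * a) + tau ^ (2 * r)) \<le> rad \<sigma> G"
      by (rule rad_ge_pendant_in_middle[OF G \<sigma> that(1,2)]) (use that N in auto)
    then show False using pow[OF that(3)] pow[OF that(4)] c by simp
  qed
  show False if "caterpillar_in ?E (a + r) q {b, a} w" "1 \<le> b" "b < a" "N \<le> r" for a r q b w
  proof -
    have "2 + epsilon - 2 * tau ^ (2 * r) \<le> rad \<sigma> G"
      by (rule rad_ge_two_pendants[OF G \<sigma> that(1,2,3)]) (use that N in auto)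
    moreover have "0 \<le> tau ^ (2 * N)" using tau by simp
    ultimately show False using pow[OF that(4)] c by simp
  qed
qed (fact N p)+

lemma path_caterpillar_in:
  assumes "inj_on p {..m}" "\<And>k. k < m \<Longrightarrow> (p k, p (Suc k)) \<in> E"
  shows "caterpillar_in E m p {} w"
  using assms by (simp add: caterpillar_in_def)

lemma caterpillar_caterpillar_in:
  assumes G: "pair_graph G" and cat: "caterpillar G m p S"
  obtains w where "caterpillar_in (parcs G) m p S w"
proof -
  have S: "S = {k. k \<le> m \<and> parcs G `` {p k} - p ` {..m} \<noteq> {}}" by (rule caterpillarD(7)[OF cat])
  have "\<forall>k\<in>S. \<exists>w. (p k, w) \<in> parcs G \<and> w \<notin> p ` {..m}" using S by blast
  then obtain w where w: "\<And>k. k \<in> S \<Longrightarrow> (p k, w k) \<in> parcs G" "\<And>k. k \<in> S \<Longrightarrow> w k \<notin> p ` {..m}"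
    by metis
  have Sm: "S \<subseteq> {..m}" using S by auto
  have "inj_on w S"
  proof (rule inj_onI)
    fix k l assume kl: "k \<in> S" "l \<in> S" "w k = w l"
    then have "w k \<in> pverts G - p ` {..m}" using w arc_snd[OF G] by blast
    then obtain i where "parcs G `` {w k} = {p i}" using caterpillarD(5)[OF cat] by blast
    moreover have "p k \<in> parcs G `` {w k}" "p l \<in> parcs G `` {w k}"
      using arc_sym[OF G w(1)[OF kl(1)]] arc_sym[OF G w(1)[OF kl(2)]] kl(3) by auto
    ultimately have "p k = p l" by simp
    then show "k = l" using caterpillarD(1)[OF cat] Sm kl by (auto simp: inj_on_def)
  qed
  then have "caterpillar_in (parcs G) m p S w"
    using caterpillarD(1,3)[OF cat] Sm w unfolding caterpillar_in_def by blast
  then show thesis by (rule that)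
qed

lemma sroot_power_eventually:
  assumes "0 < \<delta>"
  shows "eventually (\<lambda>m. \<forall>n\<in>{1..N}. 2 * sroot n ^ (2 * (m - n)) \<le> \<delta>) sequentially"
proof (intro eventually_ball_finite ballI)
  fix n assume n: "n \<in> {1..N}"
  have s: "0 < sroot n" "sroot n < 1" using sroot_pos sroot_less_1[of n] n by auto
  have "(\<lambda>r. ((sroot n)\<^sup>2) ^ r) \<longlonglongrightarrow> 0"
    using s by (intro LIMSEQ_power_zero) (simp add: power_less_one_iff)
  then have "eventually (\<lambda>r. ((sroot n)\<^sup>2) ^ r < \<delta> / 2) sequentially"
    using assms by (intro order_tendstoD) auto
  then have "eventually (\<lambda>m. ((sroot n)\<^sup>2) ^ (m - n) < \<delta> / 2) sequentially"
    using filterlim_minus_const_nat_at_top by (auto simp: filterlim_iff)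
  then show "eventually (\<lambda>m. 2 * sroot n ^ (2 * (m - n)) \<le> \<delta>) sequentially"
    by eventually_elim (simp add: power_mult)
qed simp

lemma large_graph_near_xi:
  assumes c: "c < 2 + epsilon" and \<delta>: "0 < \<delta>"
  obtains K where "\<And>\<sigma> G. connected_graph G \<Longrightarrow> \<sigma> \<in> {-1, 1} \<Longrightarrow> (\<sigma> = -1 \<Longrightarrow> 3 < rad \<sigma> G \<Longrightarrow> twin_free G) \<Longrightarrow>
    rad \<sigma> G \<le> c \<Longrightarrow> K < card (pverts G) \<Longrightarrow> \<exists>n. \<bar>rad \<sigma> G - xi n\<bar> \<le> \<delta>"
proof -
  have "(\<lambda>n. (tau\<^sup>2) ^ n) \<longlonglongrightarrow> 0"
    using tau by (intro LIMSEQ_power_zero) (simp add: power_less_one_iff)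
  then have "eventually (\<lambda>n. (tau\<^sup>2) ^ n < (2 + epsilon - c) / 4) sequentially"
    using c by (intro order_tendstoD) auto
  then have "eventually (\<lambda>n. (tau\<^sup>2) ^ n < (2 + epsilon - c) / 4 \<and> 2 \<le> n) sequentially"
    using eventually_ge_at_top[of 2] by eventually_elim simp
  then obtain N where "(tau\<^sup>2) ^ N < (2 + epsilon - c) / 4" "2 \<le> N"
    using eventually_happens'[OF sequentially_bot] by blast
  then have N: "4 * tau ^ (2 * N) < 2 + epsilon - c" "2 \<le> N" by (simp_all add: power_mult)
  have 1: "eventually (\<lambda>m. \<forall>n\<in>{1..N}. \<forall>G \<sigma> p S i j. pair_graph G \<longrightarrow> \<sigma> \<in> {-1, 1} \<longrightarrow> caterpillar G m p S \<longrightarrow>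
    S \<subseteq> {i, m - j} \<longrightarrow> i \<in> {1..n} \<longrightarrow> j \<in> {1..n} \<longrightarrow> rad \<sigma> G \<le> xi n + \<delta>) sequentially"
    using rad_le_xi_eventually[OF _ \<delta>] by (intro eventually_ball_finite) auto
  have 2: "eventually (\<lambda>m. 4 / (real m + 1) \<le> \<delta>) sequentially"
  proof -
    obtain k where "4 / \<delta> < real k" using reals_Archimedean2 by blast
    then have k: "4 < \<delta> * real k" using \<delta> by (simp add: field_simps)
    have "4 / (real m + 1) \<le> \<delta>" if "k \<le> m" for m
    proof -
      have "\<delta> * real k \<le> \<delta> * (real m + 1)" using \<delta> that by (intro mult_left_mono) auto
      then show ?thesis using k by (simp add: pos_divide_le_eq add_pos_nonneg)
    qed
    then show ?thesis by (auto simp: eventually_sequentially)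
  qed
  obtain M where M: "\<And>m. M \<le> m \<Longrightarrow> (\<forall>n\<in>{1..N}. \<forall>G \<sigma> p S i j. pair_graph G \<longrightarrow> \<sigma> \<in> {-1, 1} \<longrightarrow> caterpillar G m p S \<longrightarrow>
    S \<subseteq> {i, m - j} \<longrightarrow> i \<in> {1..n} \<longrightarrow> j \<in> {1..n} \<longrightarrow> rad \<sigma> G \<le> xi n + \<delta>) \<and> 4 / (real m + 1) \<le> \<delta> \<and>
    (\<forall>n\<in>{1..N}. 2 * sroot n ^ (2 * (m - n)) \<le> \<delta>) \<and> 2 * N + 8 \<le> m"
    using eventually_conj[OF 1 eventually_conj[OF 2 eventually_conj[OF sroot_power_eventually[OF \<delta>, of N]
      eventually_ge_at_top[of "2 * N + 8"]]]]
    unfolding eventually_sequentially by blast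
  show thesis
  \<comment> \<open>With degrees at most three, more vertices than this force a path of length at
    least \<open>M\<close>.\<close>
  proof (rule that[of "Suc M * 3 ^ M"])
    fix \<sigma> G
    assume C: "connected_graph G" and \<sigma>: "\<sigma> \<in> {-1, 1}" and tf: "\<sigma> = -1 \<Longrightarrow> 3 < rad \<sigma> G \<Longrightarrow> twin_free G"
      and r: "rad \<sigma> G \<le> c" and big: "Suc M * 3 ^ M < card (pverts G)"
    have G: "pair_graph G" and ne: "pverts G \<noteq> {}" using C by (auto simp: connected_graph_def)
    obtain m p where p: "inj_on p {..m}" "\<And>k. k < m \<Longrightarrow> (p k, p (Suc k)) \<in> parcs G"
      "\<And>q l. inj_on q {..l} \<Longrightarrow> (\<And>k. k < l \<Longrightarrow> (q k, q (Suc k)) \<in> parcs G) \<Longrightarrow> l \<le> m"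
      using exists_longest_path[OF G ne] by metis
    have deg: "card (parcs G `` {v}) \<le> 3" for v
    proof (rule ccontr)
      assume "\<not> card (parcs G `` {v}) \<le> 3"
      then obtain A where A: "A \<subseteq> parcs G `` {v}" "card A = 4"
        using obtain_subset_with_card_n[of 4 "parcs G `` {v}"] by force
      then obtain a1 a2 a3 a4 where "A = {a1, a2, a3, a4}" "distinct [a1, a2, a3, a4]"
        by (auto simp: card_Suc_eq numeral_eq_Suc)
      then have "(v, a1) \<in> parcs G" "(v, a2) \<in> parcs G" "(v, a3) \<in> parcs G" "(v, a4) \<in> parcs G"
        "distinct [v, a1, a2, a3, a4]" using A no_loop[OF G] by auto
      then have "5 \<le> rad \<sigma> G" by (rule rad_star4[OF G \<sigma>])
      then show False using r c two_plus_epsilon_less by simp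
    qed
    have "card (pverts G) \<le> Suc m * 3 ^ m" by (rule card_le_of_path_bound[OF C deg p(3)])
    then have "Suc M * 3 ^ M < Suc m * 3 ^ m" using big by linarith
    have Mm: "M \<le> m"
    proof (rule ccontr)
      assume "\<not> M \<le> m"
      then have "Suc m * 3 ^ m \<le> Suc M * (3::nat) ^ M" by (intro mult_mono power_increasing) auto
      then show False using \<open>Suc M * 3 ^ M < Suc m * 3 ^ m\<close> by linarith
    qed
    note M = M[OF Mm]
    have m: "12 \<le> m" using M N by auto
    have path: "4 - 4 / (real m + 1) \<le> rad \<sigma> G"
      by (rule rad_ge_path[OF G \<sigma> path_caterpillar_in[OF p(1,2)]]) (use m in auto)
    \<comment> \<open>A long path already pushes the radius above 3, where twin-freeness is
      available.\<close>
    have "4 / (real m + 1) \<le> 4 / 13" using m by (intro divide_left_mono) auto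
    then have "3 < rad \<sigma> G" using path by simp
    then have tf: "\<sigma> = -1 \<Longrightarrow> twin_free G" using tf by blast
    have lp: "longest_path (pverts G) (parcs G) N m p"
      by (rule longest_path_of_small_rad[OF C \<sigma> tf r c N(1,2) _ p]) (use M in auto)
    show "\<exists>n. \<bar>rad \<sigma> G - xi n\<bar> \<le> \<delta>"
    proof (rule longest_path_cases[OF G lp])
      assume "\<And>v. v \<in> pverts G \<Longrightarrow> card (parcs G `` {v}) \<le> 2"
      then have "rad \<sigma> G \<le> 4" by (rule rad_le_4[OF G \<sigma> ne])
      with path have "\<bar>rad \<sigma> G - xi 0\<bar> \<le> \<delta>" using M by (simp add: xi_0)
      then show ?thesis by blast
    next
      fix q S i j
      assume q: "caterpillar G m q S" "1 \<le> j" "j \<le> i" "i < N" "i \<in> S" "S \<subseteq> {i, m - j}"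
      obtain w where w: "caterpillar_in (parcs G) m q S w" using caterpillar_caterpillar_in[OF G q(1)] .
      have im: "i + (m - i) = m" "1 \<le> m - i" using q M by auto
      have "xi i - 2 * sroot i ^ (2 * (m - i)) \<le> rad \<sigma> G"
        by (rule rad_ge_xi[OF G \<sigma>, of i "m - i" q S w]) (use w q im in auto)
      moreover have "2 * sroot i ^ (2 * (m - i)) \<le> \<delta>" using M q by auto
      moreover have "rad \<sigma> G \<le> xi i + \<delta>"
      proof -
        have "i \<in> {1..N}" "j \<in> {1..i}" "i \<in> {1..i}" using q by auto
        then show ?thesis using M q(1,6) G \<sigma> by blast
      qed
      ultimately have "\<bar>rad \<sigma> G - xi i\<bar> \<le> \<delta>" by simp
      then show ?thesis by blast
    qed
  qed
qed

section \<open>Limit points\<close>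

text \<open>Arbitrarily good approximations put \<open>\<gamma>\<close> in the closure of
  \<open>range xi\<close>. Only finitely many \<open>xi n\<close> lie below a bound between
  \<open>\<gamma>\<close> and \<open>2 + epsilon\<close>, so \<open>\<gamma>\<close> is one of
  them.\<close>

lemma limit_point_in_range_xi:
  assumes \<sigma>: "\<sigma> \<in> {-1, 1}" and lim: "is_limit_point_of_graphs (rad \<sigma>) \<gamma>" and lt: "\<gamma> < 2 + epsilon"
  shows "\<gamma> \<in> range xi"
proof -
  obtain G where G: "\<And>k. pair_graph (G k)" "\<And>k. pverts (G k) \<noteq> {}"
    and dist: "\<And>i j. i \<noteq> j \<Longrightarrow> rad \<sigma> (G i) \<noteq> rad \<sigma> (G j)" and conv: "(\<lambda>k. rad \<sigma> (G k)) \<longlonglongrightarrow> \<gamma>"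
    using lim unfolding is_limit_point_of_graphs_def by blast
  define c where "c = (\<gamma> + (2 + epsilon)) / 2"
  have c: "\<gamma> < c" "c < 2 + epsilon" using lt by (simp_all add: c_def)
  have near: "\<exists>n. \<bar>\<gamma> - xi n\<bar> \<le> \<delta>" if \<delta>: "0 < \<delta>" for \<delta>
  proof -
    have d2: "0 < \<delta> / 2" using \<delta> by simp
    obtain K where K: "\<And>\<sigma> G. connected_graph G \<Longrightarrow> \<sigma> \<in> {-1, 1} \<Longrightarrow> (\<sigma> = -1 \<Longrightarrow> 3 < rad \<sigma> G \<Longrightarrow> twin_free G) \<Longrightarrow>
      rad \<sigma> G \<le> c \<Longrightarrow> K < card (pverts G) \<Longrightarrow> \<exists>n. \<bar>rad \<sigma> G - xi n\<bar> \<le> \<delta> / 2"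
      using large_graph_near_xi[OF c(2) d2] by blast
    define F where "F = {rad \<sigma> G | G. pair_graph G \<and> card (pverts G) \<le> K}"
    have "finite F" unfolding F_def by (rule finite_rad_values)
    \<comment> \<open>Pairwise distinct radii hit the finite set \<open>F\<close> only finitely
      often.\<close>
    then have "finite ((\<lambda>k. rad \<sigma> (G k)) -` F)"
      by (rule finite_vimageI) (use dist in \<open>auto simp: inj_def\<close>)
    then have "eventually (\<lambda>k. rad \<sigma> (G k) \<notin> F) sequentially"
      unfolding cofinite_eq_sequentially[symmetric] eventually_cofinite by (simp add: vimage_def)
    moreover have "eventually (\<lambda>k. rad \<sigma> (G k) < c) sequentially" using order_tendstoD(2)[OF conv c(1)] .
    moreover have "eventually (\<lambda>k. dist (rad \<sigma> (G k)) \<gamma> < \<delta> / 2) sequentially" using tendstoD[OF conv d2] .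
    ultimately have "eventually (\<lambda>k. rad \<sigma> (G k) \<notin> F \<and> rad \<sigma> (G k) < c \<and> dist (rad \<sigma> (G k)) \<gamma> < \<delta> / 2) sequentially"
      by eventually_elim blast
    then obtain k where k: "rad \<sigma> (G k) \<notin> F" "rad \<sigma> (G k) < c" "dist (rad \<sigma> (G k)) \<gamma> < \<delta> / 2"
      using eventually_happens'[OF sequentially_bot] by blast
    obtain H where H: "connected_graph H" "rad \<sigma> H = rad \<sigma> (G k)" "\<sigma> = -1 \<Longrightarrow> 3 < rad \<sigma> (G k) \<Longrightarrow> twin_free H"
      using exists_twin_free_same_rad[OF G(1) \<sigma> G(2), of k] by blast
    \<comment> \<open>\<open>H\<close> may be smaller than \<open>G k\<close>; since
      \<open>F\<close> collects radii and not graphs, its order is still large.\<close>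
    have "K < card (pverts H)"
    proof (rule ccontr)
      assume "\<not> K < card (pverts H)"
      then have "rad \<sigma> H \<in> F" using H(1) unfolding connected_graph_def F_def by auto
      then show False using k(1) H(2) by simp
    qed
    then obtain n where "\<bar>rad \<sigma> H - xi n\<bar> \<le> \<delta> / 2"
      using K[of H \<sigma>] H k(2) \<sigma> by auto
    moreover have "\<bar>rad \<sigma> H - \<gamma>\<bar> < \<delta> / 2" using k(3) H(2) by (simp only: dist_real_def)
    ultimately have "\<bar>\<gamma> - xi n\<bar> \<le> \<delta>" by linarith
    then show ?thesis by blast
  qed
  show ?thesis
  proof (rule ccontr)
    assume notin: "\<gamma> \<notin> range xi"
    have "eventually (\<lambda>n. c < xi n) sequentially" using order_tendstoD(1)[OF xi_tendsto c(2)] .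
    then obtain n0 where n0: "\<And>n. n0 \<le> n \<Longrightarrow> c < xi n" by (auto simp: eventually_sequentially)
    \<comment> \<open>The entry \<open>c - \<gamma>\<close> stands for all \<open>n \<ge> n0\<close>
      at once.\<close>
    define D where "D = insert (c - \<gamma>) ((\<lambda>n. \<bar>\<gamma> - xi n\<bar>) ` {..<n0})"
    have D: "finite D" "D \<noteq> {}" "\<And>x. x \<in> D \<Longrightarrow> 0 < x" using c notin by (auto simp: D_def)
    then have pos: "0 < Min D" by simp
    then obtain n where n: "\<bar>\<gamma> - xi n\<bar> \<le> Min D / 2" using near[of "Min D / 2"] by auto
    have "Min D \<le> \<bar>\<gamma> - xi n\<bar>"
    proof (cases "n < n0")
      case True
      then show ?thesis using D(1) by (intro Min_le) (auto simp: D_def)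
    next
      case False
      have "Min D \<le> c - \<gamma>" using D(1) by (intro Min_le) (auto simp: D_def)
      then show ?thesis using n0[of n] False c(1) by simp
    qed
    then show False using n pos by linarith
  qed
qed

text \<open>Choosing every graph strictly closer to \<open>\<gamma>\<close> than its predecessor
  makes the radii pairwise distinct.\<close>

lemma limit_pointI:
  assumes "\<And>\<delta>. 0 < \<delta> \<Longrightarrow> \<exists>G. pair_graph G \<and> pverts G \<noteq> {} \<and> \<rho> G \<noteq> \<gamma> \<and> \<bar>\<rho> G - \<gamma>\<bar> < \<delta>"
  shows "is_limit_point_of_graphs \<rho> \<gamma>"
proof -
  define d where "d G = \<bar>\<rho> G - \<gamma>\<bar>" for G
  define P where "P n G \<longleftrightarrow> pair_graph G \<and> pverts G \<noteq> {} \<and> 0 < d G \<and> d G < inverse (real (Suc n))" for n G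
  have ex: "\<exists>G. pair_graph G \<and> pverts G \<noteq> {} \<and> 0 < d G \<and> d G < \<delta>" if "0 < \<delta>" for \<delta>
    using assms[OF that] by (auto simp: d_def)
  have "\<exists>f. \<forall>n. P n (f n) \<and> d (f (Suc n)) < d (f n)"
  proof (rule dependent_nat_choice)
    show "\<exists>G. P 0 G" using ex[of 1] by (auto simp: P_def)
    fix G n assume "P n G"
    then have "0 < min (d G) (inverse (real (Suc (Suc n))))" by (simp add: P_def)
    from ex[OF this] show "\<exists>G'. P (Suc n) G' \<and> d G' < d G" by (auto simp: P_def)
  qed
  then obtain f where f: "\<And>n. P n (f n)" "\<And>n. d (f (Suc n)) < d (f n)" by blast
  have less: "d (f j) < d (f i)" if "i < j" for i j
    by (rule lift_Suc_mono_less[of "\<lambda>n. - d (f n)" i j, simplified]) (use f that in auto)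
  have "\<rho> (f i) \<noteq> \<rho> (f j)" if "i \<noteq> j" for i j
    using less[of i j] less[of j i] that by (cases "i < j") (auto simp: d_def)
  moreover have "(\<lambda>n. \<bar>\<rho> (f n) - \<gamma>\<bar>) \<longlonglongrightarrow> 0"
  proof (rule tendsto_sandwich[where f = "\<lambda>_. 0" and h = "\<lambda>n. inverse (real (Suc n))"])
    show "eventually (\<lambda>n. \<bar>\<rho> (f n) - \<gamma>\<bar> \<le> inverse (real (Suc n))) sequentially"
      using f(1) by (intro always_eventually allI less_imp_le) (simp only: P_def d_def)
    show "(\<lambda>n. inverse (real (Suc n))) \<longlonglongrightarrow> 0" by (rule LIMSEQ_inverse_real_of_nat)
  qed auto
  then have "(\<lambda>n. \<rho> (f n) - \<gamma>) \<longlonglongrightarrow> 0" by (rule tendsto_rabs_zero_cancel)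
  then have "(\<lambda>n. \<rho> (f n)) \<longlonglongrightarrow> \<gamma>" by (rule LIM_zero_cancel)
  moreover have "pair_graph (f k) \<and> pverts (f k) \<noteq> {}" for k using f(1)[of k] by (simp add: P_def)
  ultimately show ?thesis unfolding is_limit_point_of_graphs_def by (intro exI[of _ f]) blast
qed

section \<open>Graphs approaching each \<open>xi n\<close>\<close>

definition path_graph :: "nat \<Rightarrow> nat pair_pre_digraph" where
  "path_graph m = \<lparr>pverts = {..m}, parcs = {(k, l). k \<le> m \<and> l \<le> m \<and> (l = Suc k \<or> k = Suc l)}\<rparr>"

lemma path_graph:
  shows "pair_graph (path_graph m)" "caterpillar (path_graph m) m (\<lambda>k. k) {}"
proof -
  show "pair_graph (path_graph m)" unfolding path_graph_def by (rule pair_graphI) auto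
  have out: "parcs (path_graph m) `` {k} - {..m} = {}" for k by (auto simp: path_graph_def)
  have E: "(k, l) \<in> parcs (path_graph m) \<longleftrightarrow> k \<le> m \<and> l \<le> m \<and> (l = Suc k \<or> k = Suc l)"
    and V: "pverts (path_graph m) = {..m}" for k l by (auto simp: path_graph_def)
  show "caterpillar (path_graph m) m (\<lambda>k. k) {}"
    unfolding caterpillar_def image_ident out V by (simp add: E)
qed

text \<open>Pendant vertices at distance \<open>n\<close> from either end: the second one brings the
  radius strictly above \<open>xi n\<close> despite the finite length.\<close>

definition double_caterpillar :: "nat \<Rightarrow> nat \<Rightarrow> nat pair_pre_digraph" where
  "double_caterpillar n r = (let m = n + r; R = {(k, Suc k) | k. k < m} \<union> {(n, m + 1), (r, m + 2)} in
     \<lparr>pverts = {..m + 2}, parcs = R \<union> R\<inverse>\<rparr>)"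

lemma double_caterpillar:
  assumes "n < r"
  shows "pair_graph (double_caterpillar n r)" "caterpillar (double_caterpillar n r) (n + r) (\<lambda>k. k) {n, r}"
proof -
  let ?G = "double_caterpillar n r" and ?m = "n + r"
  have E: "(u, v) \<in> parcs ?G \<longleftrightarrow> (v = Suc u \<and> u < ?m) \<or> (u = Suc v \<and> v < ?m) \<or> (u = n \<and> v = ?m + 1) \<or> (u = ?m + 1 \<and> v = n)
    \<or> (u = r \<and> v = ?m + 2) \<or> (u = ?m + 2 \<and> v = r)" for u v
    by (auto simp: double_caterpillar_def Let_def)
  have G: "?G = \<lparr>pverts = {..?m + 2}, parcs = parcs ?G\<rparr>" by (simp add: double_caterpillar_def Let_def)
  show "pair_graph ?G" by (subst G, rule pair_graphI) (auto simp: E)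
  have out: "parcs ?G `` {k} - {..?m} = (if k = n then {?m + 1} else if k = r then {?m + 2} else {})" if "k \<le> ?m" for k
    using that assms by (auto simp: E)
  have pend: "parcs ?G `` {?m + 1} = {n}" "parcs ?G `` {?m + 2} = {r}" by (auto simp: E)
  have V: "pverts ?G = {..?m + 2}" by (simp add: double_caterpillar_def Let_def)
  show "caterpillar ?G ?m (\<lambda>k. k) {n, r}"
    unfolding caterpillar_def image_ident
  proof (intro conjI)
    show "{..?m} \<subseteq> pverts ?G" by (simp add: V)
    show "\<forall>k<?m. (k, Suc k) \<in> parcs ?G" by (simp add: E)
    show "\<forall>k\<le>?m. \<forall>l\<le>?m. (k, l) \<in> parcs ?G \<longrightarrow> l = Suc k \<or> k = Suc l" by (auto simp: E)
    show "\<forall>w\<in>pverts ?G - {..?m}. \<exists>k\<in>{n, r}. parcs ?G `` {w} = {k}"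
    proof
      fix w assume "w \<in> pverts ?G - {..?m}"
      then have "w = ?m + 1 \<or> w = ?m + 2" by (auto simp: V)
      then show "\<exists>k\<in>{n, r}. parcs ?G `` {w} = {k}" using pend by auto
    qed
    show "\<forall>k\<le>?m. card (parcs ?G `` {k} - {..?m}) \<le> 1" by (simp add: out)
    have "{k. k \<le> ?m \<and> parcs ?G `` {k} - {..?m} \<noteq> {}}
        = {k. k \<le> ?m \<and> (if k = n then {?m + 1} else if k = r then {?m + 2} else {}) \<noteq> {}}"
      by (intro Collect_cong conj_cong refl) (simp only: out)
    also have "\<dots> = {n, r}" by auto
    finally show "{n, r} = {k. k \<le> ?m \<and> parcs ?G `` {k} - {..?m} \<noteq> {}}" ..
  qed simp
qed

text \<open>Paths approach \<open>xi 0\<close> strictly from below, and for \<open>1 \<le> n\<close>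
  double caterpillars approach \<open>xi n\<close> strictly from above.\<close>

lemma xi_limit_point:
  assumes \<sigma>: "\<sigma> \<in> {-1, 1}"
  shows "is_limit_point_of_graphs (rad \<sigma>) (xi n)"
proof (rule limit_pointI)
  fix \<delta> :: real assume \<delta>: "0 < \<delta>"
  show "\<exists>G. pair_graph G \<and> pverts G \<noteq> {} \<and> rad \<sigma> G \<noteq> xi n \<and> \<bar>rad \<sigma> G - xi n\<bar> < \<delta>"
  proof (cases "n = 0")
    case True
    obtain m where "4 / \<delta> < real m" using reals_Archimedean2 by blast
    then have m4: "4 < \<delta> * real m" using \<delta> by (simp add: field_simps)
    then have "m \<noteq> 0" by (intro notI) simp
    with m4 have m: "4 < \<delta> * real m" "1 \<le> m" by simp_all
    note G = path_graph[of m]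
    obtain w where "caterpillar_in (parcs (path_graph m)) m (\<lambda>k. k) {} w"
      using caterpillar_caterpillar_in[OF G] .
    then have "4 - 4 / (real m + 1) \<le> rad \<sigma> (path_graph m)" by (rule rad_ge_path[OF G(1) \<sigma> _ m(2)])
    moreover have "rad \<sigma> (path_graph m) < 4" by (rule rad_path_less_4[OF G(1) \<sigma> G(2) m(2)])
    moreover have "4 / (real m + 1) < \<delta>" using m \<delta> by (simp add: pos_divide_less_eq distrib_left)
    moreover have "pverts (path_graph m) \<noteq> {}" by (auto simp: path_graph_def)
    ultimately show ?thesis using G(1) True by (intro exI[of _ "path_graph m"]) (auto simp: xi_0)
  next
    case False
    then have n: "1 \<le> n" by simp
    have "0 < \<delta> / 2" using \<delta> by simp
    from rad_le_xi_eventually[OF n this] obtain M where M: "\<And>m G \<sigma> p S i j. M \<le> m \<Longrightarrow> pair_graph G \<Longrightarrow> \<sigma> \<in> {-1, 1} \<Longrightarrow>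
      caterpillar G m p S \<Longrightarrow> S \<subseteq> {i, m - j} \<Longrightarrow> i \<in> {1..n} \<Longrightarrow> j \<in> {1..n} \<Longrightarrow> rad \<sigma> G \<le> xi n + \<delta> / 2"
      unfolding eventually_sequentially by blast
    define r where "r = M + n + 1"
    have nr: "n < r" by (simp add: r_def)
    note G = double_caterpillar[OF nr]
    obtain w where "caterpillar_in (parcs (double_caterpillar n r)) (n + r) (\<lambda>k. k) {n, r} w"
      using caterpillar_caterpillar_in[OF G] .
    then have "xi n < rad \<sigma> (double_caterpillar n r)" by (rule rad_gt_xi[OF G(1) \<sigma> _ n nr])
    moreover have "rad \<sigma> (double_caterpillar n r) \<le> xi n + \<delta> / 2"
      by (rule M[OF _ G(1) \<sigma> G(2), of n n]) (use n in \<open>auto simp: r_def\<close>)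
    moreover have "pverts (double_caterpillar n r) \<noteq> {}" by (auto simp: double_caterpillar_def Let_def)
    ultimately show ?thesis using G(1) \<delta> by (intro exI[of _ "double_caterpillar n r"]) auto
  qed
qed

lemma limit_points_eq:
  assumes "\<sigma> \<in> {-1, 1}"
  shows "{\<gamma>. is_limit_point_of_graphs (rad \<sigma>) \<gamma> \<and> \<gamma> < 2 + epsilon} = range xi"
  using limit_point_in_range_xi[OF assms] xi_limit_point[OF assms] xi_less by blast

theorem theorem5p2:
  shows "xi 0 = 4 \<and> strict_mono xi \<and> xi \<longlonglongrightarrow> 2 + epsilon \<and>
    {\<gamma>. is_limit_point_of_graphs laplacian_spectral_radius \<gamma> \<and> \<gamma> < 2 + epsilon} = range xi \<and>
    {\<gamma>. is_limit_point_of_graphs signless_laplacian_spectral_radius \<gamma> \<and> \<gamma> < 2 + epsilon} = range xi"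
proof -
  have "laplacian_spectral_radius = rad (-1)" "signless_laplacian_spectral_radius = rad 1"
    using laplacian_spectral_radius_eq signless_laplacian_spectral_radius_eq by blast+
  then show ?thesis using xi_0 strict_mono_xi xi_tendsto limit_points_eq[of "-1"] limit_points_eq[of 1] by simp
qed

end
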